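(* Let $X$ and $Y$ be two proper, geodesically complete, $\delta$-hyperbolic, Busemann spaces and let $d_{\bowtie}$ be an admissible distance on their horospherical product $X\bowtie Y$. Let $p=(p^X,p^Y)$ and $q=(q^X,q^Y)$ be two points of $X\bowtie Y$ and let $\alpha$ be a geodesic segment of $(X\bowtie Y,d_{\bowtie})$ linking $p$ to $q$. There exists a constant $M$ depending only on $(X\bowtie Y,d_{\bowtie})$, and there exist two vertical geodesics $V_1=(V_1^X,V_1^Y)$ and $V_2=(V_2^X,V_2^Y)$ of $X\bowtie Y$ such that: 1. if $h(p)\leq h(q)-M$, then $\alpha$ is in the $M$-neighbourhood of $V_1\cup(V_1^X,V_2^Y)\cup V_2$; 2. if $h(p)\geq h(q)+M$, then $\alpha$ is in the $M$-neighbourhood of $V_1\cup(V_2^X,V_1^Y)\cup V_2$; 3. if $|h(p)-h(q)|\leq M$, then at least one of the conclusions of 1. or 2. holds. Specifically, $V_1$ and $V_2$ can be chosen such that $p$ is close to $V_1$ and $q$ is close to $V_2$.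
   Context: A geodesic space is $\delta$-hyperbolic if every geodesic triangle is $\delta$-slim (each side lies in the $\delta$-neighbourhood of the union of the other two). A geodesic metric space is Busemann if for every pair of geodesic segments $\gamma:[a,b]\to H$, $\gamma':[a',b']\to H$ parametrised by arclength the function $(t,t')\mapsto d(\gamma(t),\gamma'(t'))$ is convex. It is geodesically complete if every geodesic segment extends to a geodesic line $\mathbb{R}\to H$. Geodesics are globally length minimising (isometric images of intervals). The boundary $\partial H$ of a proper hyperbolic space $H$ is the set of classes of geodesic rays at finite Hausdorff distance from each other. Given $a\in\partial H$ and $w\in H$ with $H$ proper, hyperbolic and Busemann, let $V_w$ be the unique geodesic ray in the class $a$ starting at $w$. The Busemann function is $\beta_{(a,w)}(x)=\limsup_{t\to+\infty}(d(x,V_w(t))-t)$, and the height function is $h=-\beta_{(a,w)}$. Fix $(w^X,a^X)\in X\times\partial X$ and $(w^Y,a^Y)\in Y\times\partial Y$, with height functions $h_X,h_Y$, and let $d^X,d^Y$ be the distances of $X,Y$. The horospherical product is $X\bowtie Y=\{(x,y)\in X\times Y : h_X(x)+h_Y(y)=0\}$. The height of $p=(p^X,p^Y)\in X\bowtie Y$ is $h(p)=h_X(p^X)=-h_Y(p^Y)$. A norm $N$ on $\mathbb{R}^2$ is admissible if $N(1,1)=1$ and $N(a,b)\ge \frac{a+b}{2}$ for all real $a,b$. For a path $\gamma=(\gamma_X,\gamma_Y):[t_1,t_2]\to X\times Y$, $l_N(\gamma)$ is the supremum over subdivisions $(\theta_i)$ of $[t_1,t_2]$ of $\sum_i N\big(d^X(\gamma_X(\theta_i),\gamma_X(\theta_{i+1})),d^Y(\gamma_Y(\theta_i),\gamma_Y(\theta_{i+1}))\big)$.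 The distance induced by $N$ is $d_{\bowtie}(p,q)=\inf\{l_N(\gamma): \gamma \text{ path in } X\bowtie Y \text{ linking } p \text{ to } q\}$. A distance on $X\bowtie Y$ is admissible if it is induced in this way by an admissible norm. Neighbourhoods are taken for $d_{\bowtie}$. A vertical geodesic of $X\bowtie Y$ is a path $V=(V^X,V^Y):\mathbb{R}\to X\bowtie Y$ parametrised by arclength for $d_{\bowtie}$ with $h(V(t))=t$ for all $t$; thus $h_X(V^X(t))=t$ and $h_Y(V^Y(t))=-t$. For two vertical geodesics $V_1,V_2$, $(V_1^X,V_2^Y)$ denotes the vertical geodesic $t\mapsto(V_1^X(t),V_2^Y(t))$, and a vertical geodesic is identified with its image. *)

theory Defs
  imports "HOL-Analysis.Analysis"
begin

section \<open>Geodesic metric spaces\<close>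

text \<open>A metric space is rendered as a type of class \<^class>\<open>metric_space\<close>, a proper one as a type of
  class \<^class>\<open>heine_borel\<close>. The distance \<open>d\<close> below may be real-valued or extended real-valued.\<close>

definition nbhd :: "('c \<Rightarrow> 'c \<Rightarrow> 'r::order) \<Rightarrow> 'r \<Rightarrow> 'c set \<Rightarrow> 'c set" where
  "nbhd d r S = {u. \<exists>v\<in>S. d u v \<le> r}"

definition geodesic_on :: "real set \<Rightarrow> (real \<Rightarrow> 'a::metric_space) \<Rightarrow> bool" where
  "geodesic_on I \<gamma> \<longleftrightarrow> (\<forall>s\<in>I. \<forall>t\<in>I. dist (\<gamma> s) (\<gamma> t) = \<bar>s - t\<bar>)"

definition geodesic_segment :: "'a::metric_space \<Rightarrow> 'a \<Rightarrow> 'a set \<Rightarrow> bool" where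
  "geodesic_segment x y S \<longleftrightarrow>
     (\<exists>\<gamma> a b. a \<le> b \<and> geodesic_on {a..b} \<gamma> \<and> \<gamma> a = x \<and> \<gamma> b = y \<and> S = \<gamma> ` {a..b})"

definition geodesic_space :: "'a::metric_space itself \<Rightarrow> bool" where
  "geodesic_space _ \<longleftrightarrow> (\<forall>(x::'a) y. \<exists>S. geodesic_segment x y S)"

definition hyperbolic_space :: "real \<Rightarrow> 'a::metric_space itself \<Rightarrow> bool" where
  "hyperbolic_space \<delta> _ \<longleftrightarrow> geodesic_space TYPE('a) \<and>
     (\<forall>(x::'a) y z A B C.
        geodesic_segment x y A \<and> geodesic_segment y z B \<and> geodesic_segment z x C \<longrightarrow>
          A \<subseteq> nbhd dist \<delta> (B \<union> C) \<and> B \<subseteq> nbhd dist \<delta> (C \<union> A) \<and> C \<subseteq> nbhd dist \<delta> (A \<union> B))"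

definition busemann_space :: "'a::metric_space itself \<Rightarrow> bool" where
  "busemann_space _ \<longleftrightarrow> geodesic_space TYPE('a) \<and>
     (\<forall>(\<gamma> :: real \<Rightarrow> 'a) \<gamma>' a b a' b'.
        a \<le> b \<and> a' \<le> b' \<and> geodesic_on {a..b} \<gamma> \<and> geodesic_on {a'..b'} \<gamma>' \<longrightarrow>
          convex_on ({a..b} \<times> {a'..b'}) (\<lambda>(t, t'). dist (\<gamma> t) (\<gamma>' t')))"

definition geodesically_complete :: "'a::metric_space itself \<Rightarrow> bool" where
  "geodesically_complete _ \<longleftrightarrow>
     (\<forall>(\<gamma> :: real \<Rightarrow> 'a) a b. a \<le> b \<and> geodesic_on {a..b} \<gamma> \<longrightarrow>
        (\<exists>\<gamma>'. geodesic_on UNIV \<gamma>' \<and> (\<forall>t\<in>{a..b}. \<gamma>' t = \<gamma> t)))"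

section \<open>Boundary and height functions\<close>

definition geodesic_ray :: "(real \<Rightarrow> 'a::metric_space) \<Rightarrow> bool" where
  "geodesic_ray \<gamma> \<longleftrightarrow> geodesic_on {0..} \<gamma>"

definition finite_Hausdorff_distance :: "'a::metric_space set \<Rightarrow> 'a set \<Rightarrow> bool" where
  "finite_Hausdorff_distance S T \<longleftrightarrow> (\<exists>r. S \<subseteq> nbhd dist r T \<and> T \<subseteq> nbhd dist r S)"

definition asymptotic :: "((real \<Rightarrow> 'a::metric_space) \<times> (real \<Rightarrow> 'a)) set" where
  "asymptotic = {(\<gamma>, \<gamma>'). geodesic_ray \<gamma> \<and> geodesic_ray \<gamma>' \<and>
     finite_Hausdorff_distance (\<gamma> ` {0..}) (\<gamma>' ` {0..})}"

definition geodesic_boundary :: "(real \<Rightarrow> 'a::metric_space) set set" where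
  "geodesic_boundary = {\<gamma>. geodesic_ray \<gamma>} // asymptotic"

text \<open>In a proper, hyperbolic, Busemann space the ray in the class \<open>a\<close> that starts at \<open>w\<close> is unique
  as a map on \<open>[0, \<infinity>)\<close>. Its values at negative arguments are arbitrary and never used,
  so it is selected by \<open>SOME\<close> and not by \<open>THE\<close>.\<close>

definition ray_from :: "(real \<Rightarrow> 'a::metric_space) set \<Rightarrow> 'a \<Rightarrow> real \<Rightarrow> 'a" where
  "ray_from a w = (SOME V. V \<in> a \<and> V 0 = w)"

text \<open>The upper limit is finite: \<open>dist x (V t) - t\<close> lies between \<open>- dist x w\<close> and \<open>dist x w\<close>.\<close>

definition busemann_fun :: "(real \<Rightarrow> 'a::metric_space) set \<Rightarrow> 'a \<Rightarrow> 'a \<Rightarrow> real" where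
  "busemann_fun a w x =
     real_of_ereal (Limsup at_top (\<lambda>t::real. ereal (dist x (ray_from a w t) - t)))"

definition height :: "(real \<Rightarrow> 'a::metric_space) set \<Rightarrow> 'a \<Rightarrow> 'a \<Rightarrow> real" where
  "height a w x = - busemann_fun a w x"

section \<open>Horospherical products and admissible distances\<close>

definition horo_product :: "('a \<Rightarrow> real) \<Rightarrow> ('b \<Rightarrow> real) \<Rightarrow> ('a \<times> 'b) set" where
  "horo_product hX hY = {(x, y). hX x + hY y = 0}"

definition norm_on_plane :: "(real \<times> real \<Rightarrow> real) \<Rightarrow> bool" where
  "norm_on_plane N \<longleftrightarrow>
     (\<forall>v. 0 \<le> N v) \<and> (\<forall>v. N v = 0 \<longleftrightarrow> v = 0) \<and>
     (\<forall>c v. N (c *\<^sub>R v) = \<bar>c\<bar> * N v) \<and> (\<forall>u v. N (u + v) \<le> N u + N v)"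

definition admissible_norm :: "(real \<times> real \<Rightarrow> real) \<Rightarrow> bool" where
  "admissible_norm N \<longleftrightarrow>
     norm_on_plane N \<and> N (1, 1) = 1 \<and> (\<forall>a b. (a + b) / 2 \<le> N (a, b))"

definition length_N ::
  "(real \<times> real \<Rightarrow> real) \<Rightarrow> real \<Rightarrow> real \<Rightarrow> (real \<Rightarrow> 'a::metric_space \<times> 'b::metric_space) \<Rightarrow> ereal"
where
  "length_N N t1 t2 \<gamma> =
     Sup {ereal (\<Sum>i<n. N (dist (fst (\<gamma> (\<theta> i))) (fst (\<gamma> (\<theta> (Suc i)))),
                           dist (snd (\<gamma> (\<theta> i))) (snd (\<gamma> (\<theta> (Suc i)))))) | n \<theta>.
          \<theta> 0 = t1 \<and> \<theta> n = t2 \<and> (\<forall>i<n. \<theta> i \<le> \<theta> (Suc i))}"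

text \<open>Distances on the horospherical product are extended real-valued, so that the infimum
  is meaningful also if no path of finite length links \<open>p\<close> to \<open>q\<close>.\<close>

definition horo_dist ::
  "(real \<times> real \<Rightarrow> real) \<Rightarrow> ('a::metric_space \<Rightarrow> real) \<Rightarrow> ('b::metric_space \<Rightarrow> real)
     \<Rightarrow> 'a \<times> 'b \<Rightarrow> 'a \<times> 'b \<Rightarrow> ereal" where
  "horo_dist N hX hY p q =
     Inf {length_N N t1 t2 \<gamma> | t1 t2 \<gamma>.
          t1 \<le> t2 \<and> continuous_on {t1..t2} \<gamma> \<and> \<gamma> ` {t1..t2} \<subseteq> horo_product hX hY \<and>
          \<gamma> t1 = p \<and> \<gamma> t2 = q}"

definition admissible_dist ::
  "('a::metric_space \<Rightarrow> real) \<Rightarrow> ('b::metric_space \<Rightarrow> real) \<Rightarrow> ('a \<times> 'b \<Rightarrow> 'a \<times> 'b \<Rightarrow> ereal) \<Rightarrow> bool"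
where
  "admissible_dist hX hY d \<longleftrightarrow> (\<exists>N. admissible_norm N \<and> d = horo_dist N hX hY)"

section \<open>Geodesics of the horospherical product\<close>

definition horo_geodesic_on ::
  "('a \<Rightarrow> real) \<Rightarrow> ('b \<Rightarrow> real) \<Rightarrow> ('a \<times> 'b \<Rightarrow> 'a \<times> 'b \<Rightarrow> ereal) \<Rightarrow> real set
     \<Rightarrow> (real \<Rightarrow> 'a \<times> 'b) \<Rightarrow> bool" where
  "horo_geodesic_on hX hY d I \<alpha> \<longleftrightarrow>
     \<alpha> ` I \<subseteq> horo_product hX hY \<and> (\<forall>s\<in>I. \<forall>t\<in>I. d (\<alpha> s) (\<alpha> t) = ereal \<bar>s - t\<bar>)"

definition horo_height :: "('a \<Rightarrow> real) \<Rightarrow> 'a \<times> 'b \<Rightarrow> real" where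
  "horo_height hX p = hX (fst p)"

definition vertical_geodesic ::
  "('a \<Rightarrow> real) \<Rightarrow> ('b \<Rightarrow> real) \<Rightarrow> ('a \<times> 'b \<Rightarrow> 'a \<times> 'b \<Rightarrow> ereal) \<Rightarrow> (real \<Rightarrow> 'a \<times> 'b) \<Rightarrow> bool" where
  "vertical_geodesic hX hY d V \<longleftrightarrow>
     horo_geodesic_on hX hY d UNIV V \<and> (\<forall>t. horo_height hX (V t) = t)"

definition mixed :: "(real \<Rightarrow> 'a \<times> 'b) \<Rightarrow> (real \<Rightarrow> 'a \<times> 'b) \<Rightarrow> real \<Rightarrow> 'a \<times> 'b" where
  "mixed V W t = (fst (V t), snd (W t))"

end

theory Submission
  imports Defs "HOL-Real_Asymp.Real_Asymp"
begin

text \<open>Through every point of a factor passes a line that is parametrised by height. Slimness of triangles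
  with one vertex at the base point at infinity shows that two points are joined, up to a bounded error,
  by the way up their two lines to the height where the lines merge. A path below a horosphere can only
  move far along it at exponential cost, while a point \<open>p\<close> and a point \<open>q\<close> of the product are at distance
  at most their height difference plus a linear error in the horizontal displacements. Hence a
  geodesic of the product between a lowest and a highest point is vertical up to a bounded error. A
  geodesic \<open>\<alpha>\<close> whose lowest point precedes its highest point must then be a path down, up and
  down: any further long zigzag could be replaced by a shorter detour. The vertical geodesics are
  read off from the turning points. The other case follows by exchanging the factors.

  An admissible norm need not be monotone, and then the induced distance may violate the triangle
  inequality and a detour may be longer than the sum of its pieces. Only two facts are used:
  \<open>N\<close> of the coordinate distances bounds the distance from below, and a path has length
  at most \<open>c\<close> if the values of \<open>N\<close> between its points are dominated by the increments of a
  function with total increment \<open>c\<close>. For the detours this is deduced from the corresponding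
  values of \<open>N\<close> along the geodesic.\<close>

section \<open>Convexity of the distance\<close>

text \<open>The bound on an almost vertical geodesic looks circular: its length is at most the
  height difference plus a multiple of the horizontal displacements \<open>m\<close> and
  \<open>n\<close>, which are controlled only through the length. The circle is broken by an
  estimate in each factor that charges displacement at an arbitrarily large rate \<open>L\<close>.
  Two facts couple the factors. That \<open>N (a, b)\<close> is at least half of
  \<open>a + b\<close> caps the sum of the two coordinate distances by twice the time, and each
  coordinate distance is at least the height difference; so a geodesic whose time is close to its
  height change has little room in either factor. And the heights are opposite, so a path that rises
  in \<open>X\<close> has to be reversed to rise in \<open>Y\<close>. Adding the two estimates with
  \<open>L\<close> above the rate of the detour absorbs \<open>m + n\<close>.\<close>

lemma geodesic_on_subset: "geodesic_on I \<gamma> \<Longrightarrow> J \<subseteq> I \<Longrightarrow> geodesic_on J \<gamma>"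
  unfolding geodesic_on_def by blast

lemma geodesic_onD: "geodesic_on I \<gamma> \<Longrightarrow> s \<in> I \<Longrightarrow> t \<in> I \<Longrightarrow> dist (\<gamma> s) (\<gamma> t) = \<bar>s - t\<bar>"
  unfolding geodesic_on_def by blast

lemma geodesic_on_shift: "geodesic_on I \<gamma> \<Longrightarrow> (\<lambda>t. t + c) ` J \<subseteq> I \<Longrightarrow> geodesic_on J (\<lambda>t. \<gamma> (t + c))"
  by (force simp: geodesic_on_def)

lemma busemann_convex:
  fixes \<gamma> \<gamma>' :: "real \<Rightarrow> 'a::metric_space"
  assumes B: "busemann_space TYPE('a)" and \<gamma>: "geodesic_on {a..b} \<gamma>" and \<gamma>': "geodesic_on {a'..b'} \<gamma>'"
    and "a \<le> b" "a' \<le> b'" "0 \<le> l" "l \<le> 1"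
  shows "dist (\<gamma> ((1 - l) * a + l * b)) (\<gamma>' ((1 - l) * a' + l * b'))
    \<le> (1 - l) * dist (\<gamma> a) (\<gamma>' a') + l * dist (\<gamma> b) (\<gamma>' b')"
proof -
  have "convex_on ({a..b} \<times> {a'..b'}) (\<lambda>(t, t'). dist (\<gamma> t) (\<gamma>' t'))"
    using B \<gamma> \<gamma>' assms(4,5) unfolding busemann_space_def by blast
  from convex_onD[OF this, of l "(a, a')" "(b, b')"] assms show ?thesis by simp
qed

lemma busemann_chord:
  fixes \<gamma> \<gamma>' :: "real \<Rightarrow> 'a::metric_space"
  assumes B: "busemann_space TYPE('a)" and \<gamma>: "geodesic_on {s..u} \<gamma>" and \<gamma>': "geodesic_on {s..u} \<gamma>'"
    and "s \<le> t" "t \<le> u"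
  shows "(u - s) * dist (\<gamma> t) (\<gamma>' t) \<le> (u - t) * dist (\<gamma> s) (\<gamma>' s) + (t - s) * dist (\<gamma> u) (\<gamma>' u)"
proof (cases "s = u")
  case False
  define l where "l = (t - s) / (u - s)"
  have l: "0 \<le> l" "l \<le> 1" "(u - s) * l = t - s" using assms False by (auto simp: l_def field_simps)
  have e: "(1 - l) * s + l * u = t" using l(3) by (simp add: algebra_simps)
  have "dist (\<gamma> t) (\<gamma>' t) \<le> (1 - l) * dist (\<gamma> s) (\<gamma>' s) + l * dist (\<gamma> u) (\<gamma>' u)"
    using busemann_convex[OF B \<gamma> \<gamma>' _ _ l(1,2)] assms by (simp add: e)
  then have "(u - s) * dist (\<gamma> t) (\<gamma>' t) \<le> (u - s) * ((1 - l) * dist (\<gamma> s) (\<gamma>' s) + l * dist (\<gamma> u) (\<gamma>' u))"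
    using assms by (intro mult_left_mono) auto
  also have "\<dots> = ((u - s) - (u - s) * l) * dist (\<gamma> s) (\<gamma>' s) + ((u - s) * l) * dist (\<gamma> u) (\<gamma>' u)"
    by (simp add: algebra_simps)
  finally show ?thesis by (simp add: l(3))
qed (use assms in auto)

lemma busemann_chord_point:
  fixes \<gamma> :: "real \<Rightarrow> 'a::metric_space"
  assumes B: "busemann_space TYPE('a)" and \<gamma>: "geodesic_on {s..u} \<gamma>" and "s \<le> t" "t \<le> u"
  shows "(u - s) * dist x (\<gamma> t) \<le> (u - t) * dist x (\<gamma> s) + (t - s) * dist x (\<gamma> u)"
proof (cases "s = u")
  case False
  define l where "l = (t - s) / (u - s)"
  have l: "0 \<le> l" "l \<le> 1" "(u - s) * l = t - s" using assms False by (auto simp: l_def field_simps)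
  have e: "(1 - l) * s + l * u = t" using l(3) by (simp add: algebra_simps)
  have "geodesic_on {0..0} (\<lambda>_. x)" by (simp add: geodesic_on_def)
  from busemann_convex[OF B this \<gamma> _ _ l(1,2)]
  have "dist x (\<gamma> t) \<le> (1 - l) * dist x (\<gamma> s) + l * dist x (\<gamma> u)"
    using assms by (simp add: e)
  then have "(u - s) * dist x (\<gamma> t) \<le> (u - s) * ((1 - l) * dist x (\<gamma> s) + l * dist x (\<gamma> u))"
    using assms by (intro mult_left_mono) auto
  also have "\<dots> = ((u - s) - (u - s) * l) * dist x (\<gamma> s) + ((u - s) * l) * dist x (\<gamma> u)"
    by (simp add: algebra_simps)
  finally show ?thesis by (simp add: l(3))
qed (use assms in auto)

text \<open>A convex function that increases from \<open>s\<close> to \<open>t\<close> keeps at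
  least that slope afterwards and exceeds every bound.\<close>

lemma chord_bounded_imp_antimono:
  fixes f :: "real \<Rightarrow> real"
  assumes chord: "\<And>u. t \<le> u \<Longrightarrow> (u - s) * f t \<le> (u - t) * f s + (t - s) * f u"
    and bdd: "\<And>u. c \<le> u \<Longrightarrow> f u \<le> K" and "s \<le> t"
  shows "f t \<le> f s"
proof (rule ccontr)
  assume "\<not> f t \<le> f s"
  then have pos: "f t - f s > 0" by simp
  define u where "u = max (max t c) (s + (t - s) * (\<bar>K - f s\<bar> + 1) / (f t - f s) + 1)"
  have u: "t \<le> u" "c \<le> u" "u - s > (t - s) * (\<bar>K - f s\<bar> + 1) / (f t - f s)" by (auto simp: u_def)
  have "(u - s) * (f t - f s) \<le> (t - s) * (f u - f s)"
    using chord[OF u(1)] by (simp add: algebra_simps)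
  also have "\<dots> \<le> (t - s) * (\<bar>K - f s\<bar> + 1)"
    using bdd[OF u(2)] \<open>s \<le> t\<close> by (intro mult_left_mono) auto
  also have "\<dots> < (u - s) * (f t - f s)" using u(3) pos by (simp add: divide_simps)
  finally show False by simp
qed

lemma geodesic_space_segment:
  fixes x y :: "'a::metric_space"
  assumes "geodesic_space TYPE('a)"
  obtains \<gamma> where "geodesic_on {0..dist x y} \<gamma>" "\<gamma> 0 = x" "\<gamma> (dist x y) = y"
proof -
  obtain \<gamma> a b where g: "a \<le> b" "geodesic_on {a..b} \<gamma>" "\<gamma> a = x" "\<gamma> b = y"
    using assms unfolding geodesic_space_def geodesic_segment_def by metis
  have d: "dist x y = b - a" using geodesic_onD[OF g(2), of a b] g by auto
  show ?thesis
    by (rule that[of "\<lambda>t. \<gamma> (t + a)"]) (use g d in \<open>auto intro!: geodesic_on_shift[OF g(2)]\<close>)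
qed

lemma geodesic_segment_of_map: "a \<le> b \<Longrightarrow> geodesic_on {a..b} \<gamma> \<Longrightarrow> geodesic_segment (\<gamma> a) (\<gamma> b) (\<gamma> ` {a..b})"
  unfolding geodesic_segment_def by blast

lemma geodesic_segment_sym:
  assumes "geodesic_segment x y S" shows "geodesic_segment y x S"
proof -
  obtain \<gamma> a b where g: "a \<le> b" "geodesic_on {a..b} \<gamma>" "\<gamma> a = x" "\<gamma> b = y" "S = \<gamma> ` {a..b}"
    using assms unfolding geodesic_segment_def by blast
  have "geodesic_on {-b..-a} (\<lambda>t. \<gamma> (- t))" using g(2) by (auto simp: geodesic_on_def)
  moreover have "\<gamma> ` {a..b} = (\<lambda>t. \<gamma> (- t)) ` {-b..-a}"
    by (auto simp: image_iff) (metis add.inverse_inverse atLeastAtMost_iff neg_le_iff_le)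
  ultimately show ?thesis unfolding geodesic_segment_def
    by (intro exI[of _ "\<lambda>t. \<gamma> (- t)"] exI[of _ "-b"] exI[of _ "-a"]) (use g in auto)
qed

section \<open>Rays asymptotic to a given ray\<close>

text \<open>At time \<open>min L n\<close> one of the two geodesics has reached \<open>V n\<close>
  and the other is \<open>\<bar>L - n\<bar>\<close> away from it, which is at most the distance of
  the starting points. Convexity carries this bound back to time \<open>t\<close>.\<close>

lemma busemann_geodesic_close:
  fixes V G :: "real \<Rightarrow> 'a::metric_space"
  assumes B: "busemann_space TYPE('a)" and V: "geodesic_on {0..} V"
    and G: "geodesic_on {0..L} G" "G 0 = x" "G L = V n" "L = dist x (V n)" and "0 \<le> n"
    and t: "0 \<le> t" "t \<le> L" "t \<le> n"
  shows "dist (G t) (V t) \<le> dist x (V 0)"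
proof (cases "min L n = 0")
  case True
  then have "t = 0" using t by linarith
  then show ?thesis using G by simp
next
  case False
  define e where "e = min L n"
  have e: "e > 0" "e \<le> L" "e \<le> n" "t \<le> e" using False t by (auto simp: e_def)
  have "dist (G e) (V e) \<le> dist (G e) (G L) + dist (V n) (V e)"
    using G(3) dist_triangle[of "G e" "V e" "V n"] by simp
  also have "\<dots> = (L - e) + (n - e)" using G(1) V e by (auto simp: geodesic_on_def)
  also have "\<dots> = \<bar>L - n\<bar>" by (auto simp: e_def)
  also have "\<dots> \<le> dist x (V 0)"
  proof -
    have "n = dist (V 0) (V n)" using geodesic_onD[OF V, of 0 n] \<open>0 \<le> n\<close> by simp
    then show ?thesis unfolding G(4) by (metis abs_dist_diff_le dist_commute)
  qed
  finally have 1: "dist (G e) (V e) \<le> dist x (V 0)" .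
  have "(e - 0) * dist (G t) (V t) \<le> (e - t) * dist (G 0) (V 0) + (t - 0) * dist (G e) (V e)"
    by (rule busemann_chord[OF B]) (use G(1) V e t in \<open>auto elim: geodesic_on_subset\<close>)
  also have "\<dots> \<le> (e - t) * dist x (V 0) + t * dist x (V 0)"
    using mult_left_mono[OF 1 t(1)] G(2) by simp
  finally have "e * dist (G t) (V t) \<le> e * dist x (V 0)" by (simp add: algebra_simps)
  then show ?thesis using e by simp
qed

text \<open>The ray is the limit of the segments from \<open>x\<close> to \<open>V n\<close>. Up to
  time \<open>n - D\<close> all later segments are defined and close to \<open>V\<close>; two of
  them start together and are at most \<open>2 * D\<close> apart at that time, so convexity makes
  them a Cauchy sequence at each fixed time.\<close>

lemma asymptotic_ray_exists:
  fixes V :: "real \<Rightarrow> 'a::complete_space"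
  assumes B: "busemann_space TYPE('a)" and V: "geodesic_on {0..} V"
  obtains W where "geodesic_on {0..} W" "W 0 = x" "\<And>t. 0 \<le> t \<Longrightarrow> dist (W t) (V t) \<le> dist x (V 0)"
proof -
  define D where "D = dist x (V 0)"
  define L where "L n = dist x (V (real n))" for n
  have gs: "geodesic_space TYPE('a)" using B by (simp add: busemann_space_def)
  have "\<exists>G. geodesic_on {0..L n} G \<and> G 0 = x \<and> G (L n) = V (real n)" for n
    using geodesic_space_segment[OF gs, of x "V (real n)"] unfolding L_def by metis
  then obtain G where G: "\<And>n. geodesic_on {0..L n} (G n)" "\<And>n. G n 0 = x" "\<And>n. G n (L n) = V (real n)"
    by metis
  have V0: "dist (V 0) (V (real n)) = real n" for n using geodesic_onD[OF V, of 0 "real n"] by simp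
  have L: "real n - D \<le> L n" for n
    using dist_triangle[of "V 0" "V (real n)" x] V0[of n] by (simp add: L_def D_def dist_commute)
  have close: "dist (G n t) (V t) \<le> D" if "0 \<le> t" "t \<le> real n - D" for n t
    unfolding D_def
    by (rule busemann_geodesic_close[OF B V G(1,2,3) L_def])
      (use that L[of n] zero_le_dist[of x "V 0"] in \<open>auto simp: D_def simp del: zero_le_dist\<close>)
  have step: "dist (G n t) (G m t) \<le> t * (2 * D) / (real n - D)"
    if "n \<le> m" "0 \<le> t" "t \<le> real n - D" "real n - D > 0" for n m t
  proof -
    let ?e = "real n - D"
    have mL: "?e \<le> L m" using L[of m] that by linarith
    have "dist (G n ?e) (G m ?e) \<le> dist (G n ?e) (V ?e) + dist (G m ?e) (V ?e)"
      by (metis dist_commute dist_triangle)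
    also have "\<dots> \<le> 2 * D" using close[of ?e n] close[of ?e m] that by auto
    finally have 1: "dist (G n ?e) (G m ?e) \<le> 2 * D" .
    have "(?e - 0) * dist (G n t) (G m t) \<le> (?e - t) * dist (G n 0) (G m 0) + (t - 0) * dist (G n ?e) (G m ?e)"
      by (rule busemann_chord[OF B]) (use L[of n] mL that in \<open>auto intro!: geodesic_on_subset[OF G(1)]\<close>)
    also have "\<dots> \<le> t * (2 * D)" using 1 that G(2) by (simp add: mult_left_mono)
    finally show ?thesis using that by (simp add: field_simps)
  qed
  have D0: "D \<ge> 0" by (simp add: D_def)
  have "convergent (\<lambda>n. G n t)" if t: "0 \<le> t" for t
  proof (rule Cauchy_convergent, rule metric_CauchyI)
    fix e :: real assume e: "e > 0"
    obtain N where N: "real N > D + t + t * (2 * D) / e + 1" using reals_Archimedean2 by blast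
    have main: "dist (G n t) (G m t) < e" if "N \<le> n" "n \<le> m" for n m
    proof -
      have q: "t * (2 * D) / e \<ge> 0" using t D0 e by simp
      have n: "real n - D > t * (2 * D) / e" "real n - D > 0" "t \<le> real n - D"
        using N that t q by linarith+
      have "dist (G n t) (G m t) \<le> t * (2 * D) / (real n - D)" using step that t n by auto
      also have "\<dots> < e" using n e by (simp add: field_simps)
      finally show ?thesis .
    qed
    show "\<exists>M. \<forall>m\<ge>M. \<forall>n\<ge>M. dist (G m t) (G n t) < e"
      by (metis main dist_commute nle_le)
  qed
  then obtain W where W: "\<And>t. 0 \<le> t \<Longrightarrow> (\<lambda>n. G n t) \<longlonglongrightarrow> W t"
    unfolding convergent_def by metis
  have ev: "\<forall>\<^sub>F n in sequentially. t \<le> real n - D" for t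
  proof -
    obtain N where "real N > D + t" using reals_Archimedean2 by blast
    then show ?thesis by (intro eventually_sequentiallyI[of N]) linarith
  qed
  show ?thesis
  proof (rule that[of W])
    have "dist (W s) (W t) = \<bar>s - t\<bar>" if "0 \<le> s" "0 \<le> t" for s t
    proof (rule LIMSEQ_unique)
      show "(\<lambda>n. dist (G n s) (G n t)) \<longlonglongrightarrow> dist (W s) (W t)" by (intro tendsto_dist W that)
      have "\<forall>\<^sub>F n in sequentially. dist (G n s) (G n t) = \<bar>s - t\<bar>"
        using ev[of s] ev[of t]
      proof eventually_elim
        case (elim n)
        then show ?case using L[of n] that by (intro geodesic_onD[OF G(1)]) auto
      qed
      then show "(\<lambda>n. dist (G n s) (G n t)) \<longlonglongrightarrow> \<bar>s - t\<bar>" by (rule tendsto_eventually)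
    qed
    then show "geodesic_on {0..} W" by (simp add: geodesic_on_def)
    have "(\<lambda>n. G n 0) \<longlonglongrightarrow> x" by (simp add: G)
    then show "W 0 = x" using W[of 0] LIMSEQ_unique by auto
    fix t :: real assume t: "0 \<le> t"
    show "dist (W t) (V t) \<le> dist x (V 0)"
    proof (rule tendsto_upperbound)
      show "(\<lambda>n. dist (G n t) (V t)) \<longlonglongrightarrow> dist (W t) (V t)" by (intro tendsto_dist W t tendsto_const)
      show "\<forall>\<^sub>F n in sequentially. dist (G n t) (V t) \<le> dist x (V 0)"
        using ev[of t] by eventually_elim (use close t D_def in auto)
    qed simp
  qed
qed

text \<open>Hausdorff closeness compares points at different parameters. These differ by a bounded
  amount, since a parameter is the distance from the initial point of its ray.\<close>

lemma asymptotic_iff_bounded: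
  "(V, W) \<in> asymptotic \<longleftrightarrow> geodesic_on {0..} V \<and> geodesic_on {0..} W \<and> (\<exists>K. \<forall>t\<ge>0. dist (V t) (W t) \<le> K)"
proof (intro iffI conjI)
  assume "(V, W) \<in> asymptotic"
  then have VW: "geodesic_on {0..} V" "geodesic_on {0..} W" and
    "finite_Hausdorff_distance (V ` {0..}) (W ` {0..})"
    by (auto simp: asymptotic_def geodesic_ray_def)
  then obtain r where r: "V ` {0..} \<subseteq> nbhd dist r (W ` {0..})" by (auto simp: finite_Hausdorff_distance_def)
  show "geodesic_on {0..} V" "geodesic_on {0..} W" by fact+
  have "dist (V t) (W t) \<le> 2 * r + dist (V 0) (W 0)" if t: "0 \<le> t" for t
  proof -
    obtain s where s: "0 \<le> s" "dist (V t) (W s) \<le> r" using r t by (force simp: nbhd_def)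
    have "\<bar>t - s\<bar> \<le> r + dist (V 0) (W 0)"
    proof -
      have "dist (V 0) (V t) = t" "dist (W 0) (W s) = s"
        using geodesic_onD[OF VW(1), of 0 t] geodesic_onD[OF VW(2), of 0 s] s t by auto
      moreover have "dist (V 0) (V t) \<le> dist (V 0) (W 0) + dist (W 0) (W s) + dist (W s) (V t)"
        using dist_triangle[of "V 0" "V t" "W 0"] dist_triangle[of "W 0" "V t" "W s"] by linarith
      moreover have "dist (W 0) (W s) \<le> dist (W 0) (V 0) + dist (V 0) (V t) + dist (V t) (W s)"
        using dist_triangle[of "W 0" "W s" "V 0"] dist_triangle[of "V 0" "W s" "V t"] by linarith
      ultimately show ?thesis using s by (simp add: dist_commute abs_le_iff)
    qed
    moreover have "dist (W s) (W t) = \<bar>t - s\<bar>" using geodesic_onD[OF VW(2), of s t] s t by auto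
    ultimately show ?thesis using s(2) dist_triangle[of "V t" "W t" "W s"] by linarith
  qed
  then show "\<exists>K. \<forall>t\<ge>0. dist (V t) (W t) \<le> K" by blast
next
  assume "geodesic_on {0..} V \<and> geodesic_on {0..} W \<and> (\<exists>K. \<forall>t\<ge>0. dist (V t) (W t) \<le> K)"
  then obtain K where *: "geodesic_on {0..} V" "geodesic_on {0..} W" "\<And>t. t \<ge> 0 \<Longrightarrow> dist (V t) (W t) \<le> K" by blast
  then show "(V, W) \<in> asymptotic"
    by (fastforce simp: asymptotic_def geodesic_ray_def finite_Hausdorff_distance_def nbhd_def dist_commute
        intro!: exI[of _ K])
qed

text \<open>Convexity turns the local geodesic obtained by gluing the ray to an extension of its initial
  segment into a global one.\<close>

lemma ray_extends_to_line:
  fixes W :: "real \<Rightarrow> 'a::metric_space"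
  assumes B: "busemann_space TYPE('a)" and "geodesically_complete TYPE('a)" and W: "geodesic_on {0..} W"
  obtains L where "geodesic_on UNIV L" "\<And>t. 0 \<le> t \<Longrightarrow> L t = W t"
proof -
  have "geodesic_on {0..1} W" using W by (rule geodesic_on_subset) auto
  then obtain E where E: "geodesic_on UNIV E" "\<And>t. t \<in> {0..1} \<Longrightarrow> E t = W t"
    using assms(2) unfolding geodesically_complete_def by (metis zero_le_one)
  define L where "L t = (if 0 \<le> t then W t else E t)" for t
  have cross: "dist (E s) (W t) = t - s" if "s < 0" "0 \<le> t" for s t
  proof (cases "t \<le> 1")
    case True
    then show ?thesis using E geodesic_onD[OF E(1), of s t] that by auto
  next
    case False
    have E01: "E 0 = W 0" "E 1 = W 1" using E(2) by auto
    have d: "dist (E s) (W 0) = - s" "dist (E s) (W 1) = 1 - s"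
      using geodesic_onD[OF E(1), of s 0] geodesic_onD[OF E(1), of s 1] that E01 by auto
    have "(t - 0) * dist (E s) (W 1) \<le> (t - 1) * dist (E s) (W 0) + (1 - 0) * dist (E s) (W t)"
      by (rule busemann_chord_point[OF B]) (use False W in \<open>auto elim!: geodesic_on_subset\<close>)
    then have "t - s \<le> dist (E s) (W t)" unfolding d by (simp add: algebra_simps)
    moreover have "dist (W 0) (W t) = t" using geodesic_onD[OF W, of 0 t] that by auto
    ultimately show ?thesis using d dist_triangle[of "E s" "W t" "W 0"] by linarith
  qed
  have "geodesic_on UNIV L"
    unfolding geodesic_on_def
  proof (intro ballI)
    fix s t
    show "dist (L s) (L t) = \<bar>s - t\<bar>"
      using cross[of s t] cross[of t s] geodesic_onD[OF W, of s t] geodesic_onD[OF E(1), of s t]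
      by (auto simp: L_def dist_commute)
  qed
  then show ?thesis by (rule that) (simp add: L_def)
qed

section \<open>Height functions and vertical lines\<close>

text \<open>What the argument uses about one factor: \<open>W x\<close> is a geodesic line through \<open>x\<close>,
  parametrised by height, whose upper half is the ray from \<open>x\<close> to the base point at infinity.\<close>

locale height_space =
  fixes h :: "'a::metric_space \<Rightarrow> real" and W :: "'a \<Rightarrow> real \<Rightarrow> 'a" and C :: real
  assumes height_lipschitz: "\<bar>h x - h y\<bar> \<le> dist x y"
    and segment_exists: "\<exists>\<gamma>. geodesic_on {0..dist x y} \<gamma> \<and> \<gamma> 0 = x \<and> \<gamma> (dist x y) = y"
    and line_base [simp]: "W x (h x) = x"
    and height_line [simp]: "h (W x t) = t"
    and dist_line: "dist (W x s) (W x t) = \<bar>s - t\<bar>"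
    and line_antimono: "s \<le> t \<Longrightarrow> dist (W x t) (W y t) \<le> dist (W x s) (W y s)"
    and line_merge: "0 \<le> r \<Longrightarrow> dist (W x t) (W y t) \<le> 2 * r \<Longrightarrow> dist (W x (t + r)) (W y (t + r)) \<le> C"
    and dist_lower: "h x \<le> h z \<Longrightarrow> h z - h x + dist (W x (h z)) z \<le> dist x z + C"

text \<open>The height is given by a true limit instead of an upper limit, so that linear
  inequalities between distances pass to heights.\<close>

locale busemann_ray =
  fixes V :: "real \<Rightarrow> 'a::complete_space" and h :: "'a \<Rightarrow> real" and \<delta> :: real
  assumes busemann: "busemann_space TYPE('a)" and complete: "geodesically_complete TYPE('a)"
    and hyperbolic: "hyperbolic_space \<delta> TYPE('a)" and ray: "geodesic_on {0..} V"
    and height_limit: "((\<lambda>t. dist x (V t) - t) \<longlongrightarrow> - h x) at_top"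
begin

lemma segment_exists: "\<exists>\<gamma>. geodesic_on {0..dist x y} \<gamma> \<and> \<gamma> 0 = x \<and> \<gamma> (dist x y) = (y :: 'a)"
proof -
  have "geodesic_space TYPE('a)" using busemann by (simp add: busemann_space_def)
  then show ?thesis using geodesic_space_segment[of x y] by blast
qed

lemma height_lipschitz: "\<bar>h x - h y\<bar> \<le> dist x y"
proof -
  have *: "- h x - - h y \<le> dist x y" for x y
  proof (rule tendsto_upperbound)
    show "((\<lambda>t. (dist x (V t) - t) - (dist y (V t) - t)) \<longlongrightarrow> - h x - - h y) at_top"
      by (intro tendsto_diff height_limit)
    have "(dist x (V t) - t) - (dist y (V t) - t) \<le> dist x y" for t
      using dist_triangle[of x "V t" y] by simp
    then show "\<forall>\<^sub>F t in at_top. (dist x (V t) - t) - (dist y (V t) - t) \<le> dist x y"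
      by (intro always_eventually allI)
  qed simp
  show ?thesis using *[of x y] *[of y x] by (simp add: dist_commute abs_le_iff)
qed

lemma height_ray:
  assumes "0 \<le> t" shows "h (V t) = t"
proof -
  have "\<forall>\<^sub>F u in at_top. dist (V t) (V u) - u = - t"
    using eventually_ge_at_top[of t]
    by eventually_elim (use assms geodesic_onD[OF ray] in auto)
  then have "((\<lambda>u. dist (V t) (V u) - u) \<longlongrightarrow> - t) at_top" by (rule tendsto_eventually)
  from tendsto_unique[OF _ this height_limit[of "V t"]] show ?thesis by simp
qed

section \<open>Lines asymptotic to the base ray\<close>

definition asymptotic_line :: "(real \<Rightarrow> 'a) \<Rightarrow> bool" where
  "asymptotic_line L \<longleftrightarrow> geodesic_on UNIV L \<and> (\<exists>K. \<forall>t\<ge>0. dist (L t) (V t) \<le> K)"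

text \<open>The function \<open>t - h (L t)\<close> is convex as a limit of convex functions, and
  bounded above for large \<open>t\<close> because \<open>L\<close> stays near \<open>V\<close>;
  hence it is nonincreasing. Since \<open>h\<close> is 1-Lipschitz it is also nondecreasing. The
  unit rise thus extends to the backward half, about which asymptoticity says nothing.\<close>

lemma height_asymptotic_line:
  assumes L: "asymptotic_line L" shows "h (L t) = h (L 0) + t"
proof -
  obtain K where K: "\<And>t. t \<ge> 0 \<Longrightarrow> dist (L t) (V t) \<le> K" and G: "geodesic_on UNIV L"
    using L by (auto simp: asymptotic_line_def)
  define f where "f t = t - h (L t)" for t
  have chord: "(u - s) * f t \<le> (u - t) * f s + (t - s) * f u" if "s \<le> t" "t \<le> u" for s t u
  proof -
    have "(u - s) * - h (L t) \<le> (u - t) * - h (L s) + (t - s) * - h (L u)"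
    proof (rule tendsto_le)
      show "((\<lambda>v. (u - s) * (dist (L t) (V v) - v)) \<longlongrightarrow> (u - s) * - h (L t)) at_top"
        by (intro tendsto_intros height_limit)
      show "((\<lambda>v. (u - t) * (dist (L s) (V v) - v) + (t - s) * (dist (L u) (V v) - v)) \<longlongrightarrow>
          (u - t) * - h (L s) + (t - s) * - h (L u)) at_top"
        by (intro tendsto_intros height_limit)
      have "(u - s) * (dist (L t) (V v) - v) \<le> (u - t) * (dist (L s) (V v) - v) + (t - s) * (dist (L u) (V v) - v)" for v
      proof -
        have "(u - s) * dist (V v) (L t) \<le> (u - t) * dist (V v) (L s) + (t - s) * dist (V v) (L u)"
          by (rule busemann_chord_point[OF busemann geodesic_on_subset[OF G]]) (use that in auto)
        then show ?thesis by (simp add: dist_commute algebra_simps)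
      qed
      then show "\<forall>\<^sub>F v in at_top. (u - s) * (dist (L t) (V v) - v)
          \<le> (u - t) * (dist (L s) (V v) - v) + (t - s) * (dist (L u) (V v) - v)"
        by (intro always_eventually allI)
    qed simp
    then show ?thesis by (simp add: f_def algebra_simps)
  qed
  have bdd: "f u \<le> K" if "0 \<le> u" for u
    using height_lipschitz[of "V u" "L u"] height_ray[OF that] K[OF that] by (simp add: f_def dist_commute)
  have "f t \<le> f s" if "s \<le> t" for s t
    by (rule chord_bounded_imp_antimono[of t s f 0 K]) (fact chord[OF that] bdd that)+
  moreover have "f s \<le> f t" if "s \<le> t" for s t
    using height_lipschitz[of "L t" "L s"] geodesic_onD[OF G, of t s] that by (simp add: f_def)
  ultimately have "f t = f 0" by (metis le_cases order_antisym)
  then show ?thesis by (simp add: f_def)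
qed

definition vertical :: "(real \<Rightarrow> 'a) \<Rightarrow> bool" where
  "vertical L \<longleftrightarrow> asymptotic_line L \<and> (\<forall>t. h (L t) = t)"

lemma vertical_line_exists: "\<exists>L. vertical L \<and> L (h x) = x"
proof -
  obtain R where R: "geodesic_on {0..} R" "R 0 = x" "\<And>t. 0 \<le> t \<Longrightarrow> dist (R t) (V t) \<le> dist x (V 0)"
    using asymptotic_ray_exists[OF busemann ray] by blast
  obtain L where L: "geodesic_on UNIV L" "\<And>t. 0 \<le> t \<Longrightarrow> L t = R t"
    using ray_extends_to_line[OF busemann complete R(1)] by blast
  have a: "asymptotic_line L" using L R by (auto simp: asymptotic_line_def)
  define M where "M t = L (t - h x)" for t
  have "dist (M t) (V t) \<le> \<bar>h x\<bar> + dist x (V 0)" if "0 \<le> t" for t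
    using dist_triangle[of "M t" "V t" "L t"] geodesic_onD[OF L(1), of "t - h x" t] R(3)[OF that] L(2)[OF that]
    by (simp add: M_def)
  moreover have "geodesic_on UNIV M" using L(1) by (auto simp: M_def geodesic_on_def)
  ultimately have "asymptotic_line M" unfolding asymptotic_line_def by blast
  moreover have "L 0 = x" using L(2) R by simp
  ultimately show ?thesis
    by (intro exI[of _ M]) (use height_asymptotic_line[OF a] in \<open>auto simp: vertical_def M_def\<close>)
qed

lemma vertical_geodesic: "vertical L \<Longrightarrow> geodesic_on I L"
  by (meson asymptotic_line_def geodesic_on_subset subset_UNIV vertical_def)

lemma vertical_bounded:
  assumes "vertical A" "vertical B"
  obtains K where "0 \<le> K" "\<And>t. 0 \<le> t \<Longrightarrow> dist (A t) (B t) \<le> K"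
proof -
  obtain K K' where K: "\<And>t. 0 \<le> t \<Longrightarrow> dist (A t) (V t) \<le> K" "\<And>t. 0 \<le> t \<Longrightarrow> dist (B t) (V t) \<le> K'"
    using assms by (auto simp: vertical_def asymptotic_line_def)
  have *: "dist (A t) (B t) \<le> K + K'" if "0 \<le> t" for t
    using K[OF that] by (smt (verit) dist_commute dist_triangle)
  have "0 \<le> K + K'" using *[of 0] zero_le_dist[of "A 0" "B 0"] by linarith
  then show ?thesis using * by (rule that)
qed

lemma vertical_antimono:
  assumes A: "vertical A" and B: "vertical B" and "s \<le> t"
  shows "dist (A t) (B t) \<le> dist (A s) (B s)"
proof -
  obtain K where K: "\<And>t. 0 \<le> t \<Longrightarrow> dist (A t) (B t) \<le> K" using vertical_bounded[OF A B] by blast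
  show ?thesis
  proof (rule chord_bounded_imp_antimono[where c = 0 and K = K and f = "\<lambda>t. dist (A t) (B t)"])
    fix u assume "t \<le> u"
    then show "(u - s) * dist (A t) (B t) \<le> (u - t) * dist (A s) (B s) + (t - s) * dist (A u) (B u)"
      by (intro busemann_chord[OF busemann] vertical_geodesic A B \<open>s \<le> t\<close>)
  qed (fact K \<open>s \<le> t\<close>)+
qed

text \<open>The ideal triangle is replaced by a finite one whose third vertex \<open>A T\<close>
  lies far up. Its side from \<open>z\<close> to that vertex follows \<open>B\<close> for a bounded
  time up to an error of 1, which is the 1 added to \<open>\<bar>\<delta>\<bar>\<close>.\<close>

lemma slim_vertical:
  assumes A: "vertical A" "A a = x" and B: "vertical B" "B b = z"
    and \<gamma>: "geodesic_on {0..dist x z} \<gamma>" "\<gamma> 0 = x" "\<gamma> (dist x z) = z" and t: "a \<le> t"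
  shows "(\<exists>\<sigma>\<in>{0..dist x z}. dist (A t) (\<gamma> \<sigma>) \<le> \<bar>\<delta>\<bar> + 1) \<or> (\<exists>\<tau>. dist (A t) (B \<tau>) \<le> \<bar>\<delta>\<bar> + 1)"
proof -
  obtain K where K: "0 \<le> K" "\<And>t. 0 \<le> t \<Longrightarrow> dist (A t) (B t) \<le> K" using vertical_bounded[OF A(1) B(1)] by blast
  \<comment> \<open>\<open>S\<close> bounds the parameter of a point of the side \<open>G\<close>
    that lies within \<open>\<delta>\<close> of \<open>A t\<close>. \<open>T\<close> makes this side
    so long, \<open>2 * K * S \<le> l\<close>, that an end displacement of at most
    \<open>2 * K\<close> shrinks by convexity to at most 1 at parameters up to
    \<open>S\<close>.\<close>
  define S where "S = dist z (A t) + \<bar>\<delta>\<bar>"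
  have S: "S \<ge> 0" by (simp add: S_def)
  define T where "T = \<bar>t\<bar> + \<bar>b\<bar> + K + 2 * K * S + 1"
  have KS: "0 \<le> 2 * K * S" using K S by simp
  have T: "t \<le> T" "0 \<le> T" "b \<le> T" "b + K + 2 * K * S + 1 \<le> T" using K KS by (auto simp: T_def)
  define y where "y = A T"
  define l where "l = dist z y"
  have zT: "dist z (B T) = T - b" using B T geodesic_onD[OF vertical_geodesic[OF B(1), of UNIV], of b T] by auto
  have yT: "dist y (B T) \<le> K" using K T by (simp add: y_def)
  have l: "\<bar>T - b - l\<bar> \<le> K"
    using zT yT dist_triangle[of z y "B T"] dist_triangle[of z "B T" y] by (simp add: l_def dist_commute)
  have l0: "2 * K * S \<le> l" "0 < l" using l T KS by linarith+
  obtain G where G: "geodesic_on {0..l} G" "G 0 = z" "G l = y"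
    using segment_exists[of z y] unfolding l_def by blast
  have seg: "geodesic_segment x y (A ` {a..T})" "geodesic_segment y z (G ` {0..l})"
      "geodesic_segment z x (\<gamma> ` {0..dist x z})"
    using geodesic_segment_of_map[of a T A] vertical_geodesic[OF A(1)] A t T y_def
      geodesic_segment_of_map[of 0 l G] G l0 geodesic_segment_of_map[of 0 "dist x z" \<gamma>] \<gamma>
    by (auto intro: geodesic_segment_sym)
  have "A ` {a..T} \<subseteq> nbhd dist \<delta> (G ` {0..l} \<union> \<gamma> ` {0..dist x z})"
    using hyperbolic seg unfolding hyperbolic_space_def by blast
  then have "A t \<in> nbhd dist \<delta> (G ` {0..l} \<union> \<gamma> ` {0..dist x z})" using t T by auto
  then consider \<sigma> where "\<sigma> \<in> {0..l}" "dist (A t) (G \<sigma>) \<le> \<delta>" | \<sigma> where "\<sigma> \<in> {0..dist x z}" "dist (A t) (\<gamma> \<sigma>) \<le> \<delta>"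
    unfolding nbhd_def by blast
  then show ?thesis
  proof cases
    case 2
    then show ?thesis by force
  next
    case 1
    have "\<sigma> = dist z (G \<sigma>)" using geodesic_onD[OF G(1), of 0 \<sigma>] 1 l0 G by auto
    then have \<sigma>S: "\<sigma> \<le> S" using 1 dist_triangle[of z "G \<sigma>" "A t"] by (auto simp: S_def)
    have "dist y (B (b + l)) \<le> dist y (B T) + dist (B T) (B (b + l))" by (rule dist_triangle)
    also have "\<dots> \<le> 2 * K"
      using yT l geodesic_onD[OF vertical_geodesic[OF B(1), of UNIV], of T "b + l"] by (simp add: diff_diff_eq)
    finally have end_bd: "dist y (B (b + l)) \<le> 2 * K" .
    have "(l - 0) * dist (G \<sigma>) (B (\<sigma> + b)) \<le> (l - \<sigma>) * dist (G 0) (B (0 + b)) + (\<sigma> - 0) * dist (G l) (B (l + b))"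
      by (rule busemann_chord[OF busemann G(1) geodesic_on_shift[OF vertical_geodesic[OF B(1), of UNIV]]])
        (use 1 in auto)
    also have "\<dots> = \<sigma> * dist y (B (b + l))" using G B by (simp add: add.commute)
    also have "\<dots> \<le> S * (2 * K)" using \<sigma>S end_bd 1 S by (intro mult_mono) auto
    also have "\<dots> \<le> l * 1" using l0 by (simp add: algebra_simps)
    finally have "dist (G \<sigma>) (B (\<sigma> + b)) \<le> 1" using l0 by simp
    then have "dist (A t) (B (\<sigma> + b)) \<le> \<bar>\<delta>\<bar> + 1"
      using 1 dist_triangle[of "A t" "B (\<sigma> + b)" "G \<sigma>"] by linarith
    then show ?thesis by blast
  qed
qed

lemma vertical_close_same_height:
  assumes "vertical A" "vertical B" "dist (A t) (B s) \<le> r"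
  shows "dist (A t) (B t) \<le> 2 * r"
proof -
  have "\<bar>t - s\<bar> \<le> r" using height_lipschitz[of "A t" "B s"] assms by (simp add: vertical_def)
  then show ?thesis
    using dist_triangle[of "A t" "B t" "B s"] geodesic_onD[OF vertical_geodesic[OF assms(2), of UNIV], of s t] assms(3)
    by (simp add: abs_minus_commute)
qed

lemma vertical_shift:
  assumes "vertical A" "vertical B" "s \<le> t"
  shows "dist (A s) (B s) \<le> dist (A t) (B t) + 2 * (t - s)"
  using dist_triangle[of "A s" "B s" "A t"] dist_triangle[of "A t" "B s" "B t"]
    geodesic_onD[OF vertical_geodesic[OF assms(1), of UNIV], of s t]
    geodesic_onD[OF vertical_geodesic[OF assms(2), of UNIV], of t s] assms(3) by simp

text \<open>A geodesic of length at most \<open>2 * r\<close> between points of height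
  \<open>t\<close> does not rise above \<open>t + r\<close>. The point of \<open>A\<close> at height
  \<open>t + r + 2 * D\<close> is therefore not within \<open>D\<close> of it, and slimness puts it
  near \<open>B\<close>. Returning to height \<open>t + r\<close> adds \<open>4 * D\<close> to the
  \<open>2 * D\<close> found there.\<close>

lemma vertical_merge:
  assumes A: "vertical A" and B: "vertical B" and r: "0 \<le> r" "dist (A t) (B t) \<le> 2 * r"
  shows "dist (A (t + r)) (B (t + r)) \<le> 6 * (\<bar>\<delta>\<bar> + 1)"
proof -
  define D where "D = \<bar>\<delta>\<bar> + 1"
  have D: "D > 0" by (simp add: D_def)
  define l where "l = dist (A t) (B t)"
  obtain \<gamma> where \<gamma>: "geodesic_on {0..l} \<gamma>" "\<gamma> 0 = A t" "\<gamma> l = B t"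
    using segment_exists[of "A t" "B t"] unfolding l_def by blast
  have h: "h (A u) = u" "h (B u) = u" for u using A B by (auto simp: vertical_def)
  let ?u = "t + r + 2 * D"
  from slim_vertical[OF A refl B refl \<gamma>[unfolded l_def], of ?u]
  have "(\<exists>\<sigma>\<in>{0..l}. dist (A ?u) (\<gamma> \<sigma>) \<le> D) \<or> (\<exists>\<tau>. dist (A ?u) (B \<tau>) \<le> D)"
    using D r by (simp add: D_def[symmetric] l_def[symmetric])
  then have "dist (A ?u) (B ?u) \<le> 2 * D"
  proof
    assume "\<exists>\<sigma>\<in>{0..l}. dist (A ?u) (\<gamma> \<sigma>) \<le> D"
    then obtain \<sigma> where \<sigma>: "\<sigma> \<in> {0..l}" "dist (A ?u) (\<gamma> \<sigma>) \<le> D" by blast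
    have "dist (A t) (\<gamma> \<sigma>) = \<sigma>" "dist (\<gamma> \<sigma>) (B t) = l - \<sigma>"
      using geodesic_onD[OF \<gamma>(1), of 0 \<sigma>] geodesic_onD[OF \<gamma>(1), of \<sigma> l] \<gamma> \<sigma> by auto
    then have "h (\<gamma> \<sigma>) - t \<le> \<sigma>" "h (\<gamma> \<sigma>) - t \<le> l - \<sigma>"
      using height_lipschitz[of "A t" "\<gamma> \<sigma>"] height_lipschitz[of "\<gamma> \<sigma>" "B t"] h by auto
    moreover have "?u - h (\<gamma> \<sigma>) \<le> D" using height_lipschitz[of "A ?u" "\<gamma> \<sigma>"] h \<sigma> by auto
    ultimately show ?thesis using r D by (simp add: l_def)
  qed (use vertical_close_same_height[OF A B] in blast)
  then show ?thesis using vertical_shift[OF A B, of "t + r" ?u] D by (simp add: D_def)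
qed

text \<open>The height \<open>u\<close> is just low enough that the two lines cannot have met yet,
  so slimness makes the geodesic from \<open>x\<close> to \<open>z\<close> pass within
  \<open>D\<close> of \<open>A u\<close>. Climbing to height \<open>u - D\<close> and descending to
  \<open>z\<close> costs the left-hand side up to \<open>6 * D\<close>.\<close>

lemma vertical_dist_lower:
  assumes A: "vertical A" "A (h x) = x" and xz: "h x \<le> h z"
  shows "h z - h x + dist (A (h z)) z \<le> dist x z + 6 * (\<bar>\<delta>\<bar> + 1)"
proof -
  define D where "D = \<bar>\<delta>\<bar> + 1"
  have D: "D > 0" by (simp add: D_def)
  obtain B where B: "vertical B" "B (h z) = z" using vertical_line_exists by blast
  obtain \<gamma> where \<gamma>: "geodesic_on {0..dist x z} \<gamma>" "\<gamma> 0 = x" "\<gamma> (dist x z) = z"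
    using segment_exists[of x z] by blast
  have h: "h (A u) = u" "h (B u) = u" for u using A B by (auto simp: vertical_def)
  define r where "r = dist (A (h z)) z"
  show ?thesis
  proof (cases "r \<le> 4 * D")
    case True
    then show ?thesis using height_lipschitz[of x z] D by (simp add: r_def D_def)
  next
    case False
    define u where "u = h z + r / 2 - 2 * D"
    have u: "h z \<le> u" using False by (simp add: u_def)
    have notB: "\<not> dist (A u) (B \<tau>) \<le> D" for \<tau>
    proof
      assume "dist (A u) (B \<tau>) \<le> D"
      then have "dist (A u) (B u) \<le> 2 * D" by (rule vertical_close_same_height[OF A(1) B(1)])
      then show False using vertical_shift[OF A(1) B(1) u] D B(2) by (simp add: u_def r_def)
    qed
    obtain \<sigma> where \<sigma>: "\<sigma> \<in> {0..dist x z}" "dist (A u) (\<gamma> \<sigma>) \<le> D"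
      using slim_vertical[OF A B \<gamma>, of u] u xz notB by (auto simp: D_def)
    have "dist x (\<gamma> \<sigma>) = \<sigma>" "dist (\<gamma> \<sigma>) z = dist x z - \<sigma>"
      using geodesic_onD[OF \<gamma>(1), of 0 \<sigma>] geodesic_onD[OF \<gamma>(1), of \<sigma> "dist x z"] \<gamma> \<sigma> by auto
    then have "h (\<gamma> \<sigma>) - h x \<le> \<sigma>" "h (\<gamma> \<sigma>) - h z \<le> dist x z - \<sigma>"
      using height_lipschitz[of x "\<gamma> \<sigma>"] height_lipschitz[of "\<gamma> \<sigma>" z] by auto
    moreover have "u - h (\<gamma> \<sigma>) \<le> D" using height_lipschitz[of "A u" "\<gamma> \<sigma>"] h \<sigma> by auto
    ultimately show ?thesis by (simp add: u_def r_def D_def)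
  qed
qed

lemma height_space_exists: "\<exists>W. height_space h W (6 * (\<bar>\<delta>\<bar> + 1))"
proof -
  obtain W where W: "\<And>x. vertical (W x)" "\<And>x. W x (h x) = x" using vertical_line_exists by metis
  have "height_space h W (6 * (\<bar>\<delta>\<bar> + 1))"
  proof
    fix x y
    show "dist (W x s) (W x t) = \<bar>s - t\<bar>" for s t
      using geodesic_onD[OF vertical_geodesic[OF W(1), of UNIV]] by auto
    show "h (W x t) = t" for t using W(1) by (auto simp: vertical_def)
  qed (fact W segment_exists height_lipschitz vertical_antimono[OF W(1) W(1)] vertical_merge[OF W(1) W(1)]
      vertical_dist_lower[OF W(1) W(2)])+
  then show ?thesis by blast
qed

end

section \<open>Rays and heights attached to a boundary point\<close>

lemma ray_from_props:
  fixes w :: "'a::complete_space"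
  assumes B: "busemann_space TYPE('a)" and a: "a \<in> geodesic_boundary"
  shows "geodesic_on {0..} (ray_from a w)"
proof -
  obtain V where V: "geodesic_on {0..} V" "a = asymptotic `` {V}"
    using a by (auto simp: geodesic_boundary_def quotient_def geodesic_ray_def)
  obtain R where R: "geodesic_on {0..} R" "R 0 = w" "\<And>t. 0 \<le> t \<Longrightarrow> dist (R t) (V t) \<le> dist w (V 0)"
    using asymptotic_ray_exists[OF B V(1)] by blast
  have "R \<in> a \<and> R 0 = w"
    using R V by (auto simp: asymptotic_iff_bounded dist_commute intro!: exI[of _ "dist w (V 0)"])
  then have "ray_from a w \<in> a \<and> ray_from a w 0 = w" 
    unfolding ray_from_def by (rule someI[of "\<lambda>V. V \<in> a \<and> V 0 = w"])
  then show ?thesis using V by (auto simp: asymptotic_iff_bounded)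
qed

text \<open>The triangle inequality makes this function nonincreasing on the ray and bounded below,
  so the upper limit that defines the height is a limit.\<close>

lemma busemann_limit:
  assumes V: "geodesic_on {0..} V"
  shows "\<exists>l. ((\<lambda>t. dist x (V t) - t) \<longlongrightarrow> l) at_top"
proof -
  define f where "f t = dist x (V t) - t" for t
  have anti: "f t \<le> f s" if "0 \<le> s" "s \<le> t" for s t
    using dist_triangle[of x "V t" "V s"] geodesic_onD[OF V, of s t] that by (simp add: f_def)
  have lb: "- dist x (V 0) \<le> f t" if "0 \<le> t" for t
    using dist_triangle[of "V 0" "V t" x] geodesic_onD[OF V, of 0 t] that by (simp add: f_def dist_commute)
  define l where "l = Inf (f ` {0..})"
  have bb: "bdd_below (f ` {0..})" using lb by (auto intro!: bdd_belowI)
  have "(f \<longlongrightarrow> l) at_top"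
  proof (rule decreasing_tendsto)
    show "\<forall>\<^sub>F t in at_top. l \<le> f t"
      using eventually_ge_at_top[of 0] by eventually_elim (auto simp: l_def intro!: cInf_lower bb)
    fix y assume "l < y"
    then obtain s where s: "0 \<le> s" "f s < y" unfolding l_def by (subst (asm) cInf_less_iff) (auto simp: bb)
    show "\<forall>\<^sub>F t in at_top. f t < y"
      using eventually_ge_at_top[of s] by eventually_elim (use s anti in force)
  qed
  then show ?thesis unfolding f_def by blast
qed

lemma height_space_of_boundary_point:
  fixes w :: "'a::complete_space"
  assumes "geodesically_complete TYPE('a)" "hyperbolic_space \<delta> TYPE('a)" "busemann_space TYPE('a)"
    and "a \<in> geodesic_boundary"
  shows "\<exists>W. height_space (height a w) W (6 * (\<bar>\<delta>\<bar> + 1))"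
proof -
  have ray: "geodesic_on {0..} (ray_from a w)" using ray_from_props assms by blast
  interpret busemann_ray "ray_from a w" "height a w" \<delta>
  proof
    fix x
    obtain l where l: "((\<lambda>t. dist x (ray_from a w t) - t) \<longlongrightarrow> l) at_top" using busemann_limit[OF ray] by blast
    then have "((\<lambda>t. ereal (dist x (ray_from a w t) - t)) \<longlongrightarrow> ereal l) at_top" by simp
    then have "Limsup at_top (\<lambda>t. ereal (dist x (ray_from a w t) - t)) = ereal l" by (intro lim_imp_Limsup) auto
    then show "((\<lambda>t. dist x (ray_from a w t) - t) \<longlongrightarrow> - height a w x) at_top"
      using l by (simp add: height_def busemann_fun_def)
  qed (use assms ray in auto)
  show ?thesis by (rule height_space_exists)
qed

section \<open>Bounds for the distance induced by a norm\<close>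

text \<open>One summand of an \<open>N\<close>-length. If \<open>N\<close> is not monotone it may
  violate the triangle inequality, so along a path it has to be bounded for all pairs of
  times.\<close>

definition gap :: "(real \<times> real \<Rightarrow> real) \<Rightarrow> 'a::metric_space \<times> 'b::metric_space \<Rightarrow> 'a \<times> 'b \<Rightarrow> real" where
  "gap N p q = N (dist (fst p) (fst q), dist (snd p) (snd q))"

lemma horo_dist_ge_gap: "ereal (gap N p q) \<le> horo_dist N hX hY p q"
  unfolding horo_dist_def
proof (rule Inf_greatest, clarify)
  fix t1 t2 :: real and \<gamma> :: "real \<Rightarrow> 'a \<times> 'b"
  assume t: "t1 \<le> t2"
  let ?\<theta> = "\<lambda>i::nat. if i = 0 then t1 else t2"
  have "ereal (\<Sum>i<1. N (dist (fst (\<gamma> (?\<theta> i))) (fst (\<gamma> (?\<theta> (Suc i)))),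
                           dist (snd (\<gamma> (?\<theta> i))) (snd (\<gamma> (?\<theta> (Suc i)))))) \<le> length_N N t1 t2 \<gamma>"
    unfolding length_N_def
    by (rule Sup_upper, intro CollectI exI[of _ "1::nat"] exI[of _ ?\<theta>]) (use t in auto)
  then show "ereal (gap N (\<gamma> t1) (\<gamma> t2)) \<le> length_N N t1 t2 \<gamma>" by (simp add: gap_def)
qed

lemma horo_dist_le:
  fixes \<gamma> :: "real \<Rightarrow> 'a::metric_space \<times> 'b::metric_space"
  assumes "0 \<le> T" "continuous_on {0..T} \<gamma>" "\<gamma> ` {0..T} \<subseteq> horo_product hX hY"
    and gap: "\<And>s t. 0 \<le> s \<Longrightarrow> s \<le> t \<Longrightarrow> t \<le> T \<Longrightarrow> gap N (\<gamma> s) (\<gamma> t) \<le> \<phi> t - \<phi> s"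
  shows "horo_dist N hX hY (\<gamma> 0) (\<gamma> T) \<le> ereal (\<phi> T - \<phi> 0)"
proof -
  have "length_N N 0 T \<gamma> \<le> ereal (\<phi> T - \<phi> 0)"
    unfolding length_N_def
  proof (rule Sup_least, clarify)
    fix n and \<theta> :: "nat \<Rightarrow> real"
    assume \<theta>: "\<theta> 0 = 0" "T = \<theta> n" "\<forall>i<n. \<theta> i \<le> \<theta> (Suc i)"
    have low: "0 \<le> \<theta> i" if "i \<le> n" for i
      using that by (induction i) (use \<theta> in \<open>auto intro: order_trans\<close>)
    have up: "\<theta> i \<le> \<theta> n" if "i \<le> n" for i
      using that by (induction rule: inc_induct) (use \<theta> in \<open>auto intro: order_trans\<close>)
    have "(\<Sum>i<n. gap N (\<gamma> (\<theta> i)) (\<gamma> (\<theta> (Suc i)))) \<le> (\<Sum>i<n. \<phi> (\<theta> (Suc i)) - \<phi> (\<theta> i))"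
      by (intro sum_mono gap) (use \<theta> low up in auto)
    also have "\<dots> = \<phi> (\<theta> n) - \<phi> (\<theta> 0)" by (rule sum_lessThan_telescope)
    finally show "ereal (\<Sum>i<n. N (dist (fst (\<gamma> (\<theta> i))) (fst (\<gamma> (\<theta> (Suc i)))),
                           dist (snd (\<gamma> (\<theta> i))) (snd (\<gamma> (\<theta> (Suc i)))))) \<le> ereal (\<phi> (\<theta> n) - \<phi> 0)"
      using \<theta> by (simp add: gap_def)
  qed
  moreover have "horo_dist N hX hY (\<gamma> 0) (\<gamma> T) \<le> length_N N 0 T \<gamma>"
    unfolding horo_dist_def by (rule Inf_lower) (use assms in blast)
  ultimately show ?thesis by (rule order_trans[rotated])
qed

lemma length_N_swap: "length_N (N \<circ> prod.swap) t1 t2 (prod.swap \<circ> \<gamma>) = length_N N t1 t2 \<gamma>"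
  by (simp add: length_N_def)

lemma horo_product_swap: "prod.swap p \<in> horo_product hY hX \<longleftrightarrow> p \<in> horo_product hX hY"
  by (cases p) (auto simp: horo_product_def)

lemma horo_dist_swap_le: "horo_dist (N \<circ> prod.swap) hY hX (prod.swap p) (prod.swap q) \<le> horo_dist N hX hY p q"
  unfolding horo_dist_def[of N]
proof (rule Inf_greatest, clarify)
  fix t1 t2 :: real and \<gamma> :: "real \<Rightarrow> 'b \<times> 'a"
  assume t: "t1 \<le> t2" "continuous_on {t1..t2} \<gamma>" "\<gamma> ` {t1..t2} \<subseteq> horo_product hX hY"
  have 1: "continuous_on {t1..t2} (prod.swap \<circ> \<gamma>)"
    using t(2) by (auto simp: comp_def prod.swap_def intro!: continuous_intros)
  have 2: "(prod.swap \<circ> \<gamma>) ` {t1..t2} \<subseteq> horo_product hY hX"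
    using t(3) by (auto simp: image_subset_iff horo_product_swap)
  show "horo_dist (N \<circ> prod.swap) hY hX (prod.swap (\<gamma> t1)) (prod.swap (\<gamma> t2)) \<le> length_N N t1 t2 \<gamma>"
    unfolding horo_dist_def length_N_swap[of N t1 t2 \<gamma>, symmetric]
    by (rule Inf_lower, intro CollectI exI[of _ t1] exI[of _ t2] exI[of _ "prod.swap \<circ> \<gamma>"] conjI)
      (use 1 2 t in simp_all)
qed

lemma horo_dist_swap: "horo_dist (N \<circ> prod.swap) hY hX (prod.swap p) (prod.swap q) = horo_dist N hX hY p q"
  using horo_dist_swap_le[of N hY hX p q] horo_dist_swap_le[of "N \<circ> prod.swap" hX hY "prod.swap p" "prod.swap q"]
  by (intro antisym) (simp_all add: comp_assoc)

section \<open>Admissible norms\<close>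

locale admissible =
  fixes N :: "real \<times> real \<Rightarrow> real"
  assumes admissible: "admissible_norm N"
begin

text \<open>A Lipschitz constant of \<open>N\<close> for the sum of absolute values; perturbation by
  it takes the place of monotonicity.\<close>

definition K :: real where "K = max 1 (max (N (1, 0)) (N (0, 1)))"

lemma K_ge: "1 \<le> K" "0 \<le> K" "N (1, 0) \<le> K" "N (0, 1) \<le> K" by (auto simp: K_def)

lemma N_add: "N (a + a', b + b') \<le> N (a, b) + N (a', b')"
  using admissible unfolding admissible_norm_def norm_on_plane_def by (metis add_Pair)

lemma N_scale: "N (c * a, c * b) = \<bar>c\<bar> * N (a, b)"
  using admissible unfolding admissible_norm_def norm_on_plane_def by (metis real_scaleR_def scaleR_Pair)

lemma N_diag: "N (t, t) = \<bar>t\<bar>"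
  using N_scale[of t 1 1] admissible by (simp add: admissible_norm_def)

lemma N_nonneg: "0 \<le> N v"
  using admissible unfolding admissible_norm_def norm_on_plane_def by blast

lemma N_lower: "a + b \<le> 2 * N (a, b)"
proof -
  have "(a + b) / 2 \<le> N (a, b)" using admissible unfolding admissible_norm_def by blast
  then show ?thesis by simp
qed

lemma N_upper: "N (a, b) \<le> K * (\<bar>a\<bar> + \<bar>b\<bar>)"
proof -
  have "N (a, b) \<le> N (a, 0) + N (0, b)" using N_add[of a 0 0 b] by simp
  also have "\<dots> = \<bar>a\<bar> * N (1, 0) + \<bar>b\<bar> * N (0, 1)" using N_scale[of a 1 0] N_scale[of b 0 1] by simp
  also have "\<dots> \<le> \<bar>a\<bar> * K + \<bar>b\<bar> * K" using K_ge by (intro add_mono mult_left_mono) auto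
  finally show ?thesis by (simp add: algebra_simps)
qed

lemma N_diff: "N (a, b) \<le> N (a', b') + K * (\<bar>a - a'\<bar> + \<bar>b - b'\<bar>)"
  using N_add[of a' "a - a'" b' "b - b'"] N_upper[of "a - a'" "b - b'"] by simp

lemma N_error:
  assumes "\<bar>a - a'\<bar> \<le> e" "\<bar>b - b'\<bar> \<le> e'"
  shows "N (a, b) \<le> N (a', b') + K * (e + e')"
proof -
  have "K * (\<bar>a - a'\<bar> + \<bar>b - b'\<bar>) \<le> K * (e + e')" using assms K_ge by (intro mult_left_mono) auto
  then show ?thesis using N_diff[of a b a' b'] by linarith
qed

lemma admissible_swap: "admissible (N \<circ> prod.swap)"
proof
  have "(a + b) / 2 \<le> N (b, a)" for a b using N_lower[of b a] by simp
  then show "admissible_norm (N \<circ> prod.swap)"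
    using admissible unfolding admissible_norm_def norm_on_plane_def by (auto simp: zero_prod_def)
qed

lemma gap_change:
  assumes "dist (fst p) (fst p') \<le> r" "dist (snd p) (snd p') \<le> r"
    and "dist (fst q) (fst q') \<le> r'" "dist (snd q) (snd q') \<le> r'"
  shows "gap N p q \<le> gap N p' q' + 2 * K * (r + r')"
proof -
  have *: "\<bar>dist x y - dist x' y'\<bar> \<le> dist x x' + dist y y'" for x y x' y' :: "'c::metric_space"
    using dist_triangle[of x y x'] dist_triangle[of x' y y'] dist_triangle[of x' y' x] dist_triangle[of x y' y]
    by (simp add: dist_commute abs_le_iff)
  have "gap N p q \<le> gap N p' q' + K * ((r + r') + (r + r'))"
    unfolding gap_def
  proof (rule N_error)
    show "\<bar>dist (fst p) (fst q) - dist (fst p') (fst q')\<bar> \<le> r + r'"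
      using *[of "fst p" "fst q" "fst p'" "fst q'"] assms by linarith
    show "\<bar>dist (snd p) (snd q) - dist (snd p') (snd q')\<bar> \<le> r + r'"
      using *[of "snd p" "snd q" "snd p'" "snd q'"] assms by linarith
  qed
  then show ?thesis by (simp add: algebra_simps)
qed

lemma gap_nonneg: "0 \<le> gap N p q"
  unfolding gap_def by (rule N_nonneg)

end

section \<open>Concatenating paths in the horospherical product\<close>

definition glue :: "real \<Rightarrow> (real \<Rightarrow> 'a) \<Rightarrow> (real \<Rightarrow> 'a) \<Rightarrow> real \<Rightarrow> 'a" where
  "glue c f g t = (if t \<le> c then f t else g (t - c))"

lemma glue_continuous:
  fixes f g :: "real \<Rightarrow> 'a::topological_space"
  assumes "continuous_on {0..a} f" "continuous_on {0..b} g" "f a = g 0" "0 \<le> a" "0 \<le> b"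
  shows "continuous_on {0..a + b} (glue a f g)"
proof -
  have "continuous_on ({0..a} \<union> {a..a + b}) (\<lambda>t. if t \<le> a then f t else g (t - a))"
  proof (rule continuous_on_cases)
    show "continuous_on {a..a + b} (\<lambda>t. g (t - a))"
      by (rule continuous_on_compose2[OF assms(2)]) (auto intro!: continuous_intros)
  qed (use assms in auto)
  moreover have "{0..a} \<union> {a..a + b} = {0..a + b}" using assms by auto
  ultimately show ?thesis unfolding glue_def by simp
qed

definition contracting :: "real \<Rightarrow> (real \<Rightarrow> 'a::metric_space) \<Rightarrow> bool" where
  "contracting T f \<longleftrightarrow> (\<forall>s\<in>{0..T}. \<forall>t\<in>{0..T}. dist (f s) (f t) \<le> \<bar>s - t\<bar>)"

lemma contracting_continuous:
  assumes "contracting T f" shows "continuous_on {0..T} f"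
  unfolding continuous_on_iff
proof (intro ballI allI impI)
  fix x e :: real assume "x \<in> {0..T}" "0 < e"
  then show "\<exists>d>0. \<forall>x'\<in>{0..T}. dist x' x < d \<longrightarrow> dist (f x') (f x) < e"
    using assms by (intro exI[of _ e]) (force simp: contracting_def dist_real_def)
qed

lemma contracting_glue:
  assumes "contracting a f" "contracting b g" "f a = g 0" "0 \<le> a" "0 \<le> b"
  shows "contracting (a + b) (glue a f g)"
proof -
  have fa: "dist (f s) (f t) \<le> \<bar>s - t\<bar>" if "s \<in> {0..a}" "t \<in> {0..a}" for s t
    using assms(1) that by (auto simp: contracting_def)
  have gb: "dist (g s) (g t) \<le> \<bar>s - t\<bar>" if "s \<in> {0..b}" "t \<in> {0..b}" for s t
    using assms(2) that by (auto simp: contracting_def)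
  have mid: "dist (f s) (g (t - a)) \<le> t - s" if "0 \<le> s" "s \<le> a" "a < t" "t \<le> a + b" for s t
    using fa[of s a] gb[of 0 "t - a"] dist_triangle[of "f s" "g (t - a)" "f a"] that assms by auto
  show ?thesis
    unfolding contracting_def
  proof (intro ballI)
    fix s t assume st: "s \<in> {0..a + b}" "t \<in> {0..a + b}"
    show "dist (glue a f g s) (glue a f g t) \<le> \<bar>s - t\<bar>"
      using st fa[of s t] gb[of "s - a" "t - a"] mid[of s t] mid[of t s]
      by (auto simp: glue_def dist_commute)
  qed
qed

text \<open>Coordinatewise closeness is what the perturbation bound for \<open>gap\<close> consumes.
  For two points of the product at equal height, \<open>level_route\<close> converts it into a bound
  for the induced distance.\<close>

definition close :: "'a::metric_space \<times> 'b::metric_space \<Rightarrow> 'a \<times> 'b \<Rightarrow> real \<Rightarrow> bool" where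
  "close p q r \<longleftrightarrow> dist (fst p) (fst q) \<le> r \<and> dist (snd p) (snd q) \<le> r"

lemma close_sym: "close p q r \<Longrightarrow> close q p r"
  by (simp add: close_def dist_commute)

lemma close_trans: "close p q r \<Longrightarrow> close q u r' \<Longrightarrow> close p u (r + r')"
  unfolding close_def by (meson add_mono dist_triangle order_trans)

locale horo_pair = X: height_space hX WX CX + Y: height_space hY WY CY + admissible N
  for hX :: "'a::metric_space \<Rightarrow> real" and WX CX and hY :: "'b::metric_space \<Rightarrow> real" and WY CY and N
begin

abbreviation HP :: "('a \<times> 'b) set" where "HP \<equiv> horo_product hX hY"

text \<open>The potential \<open>\<phi>\<close> bounds the length of \<open>\<gamma>\<close> also if \<open>N\<close> is not monotone; in that case the
  length of a concatenation can exceed the sum of the lengths.\<close>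

definition route :: "(real \<Rightarrow> 'a \<times> 'b) \<Rightarrow> real \<Rightarrow> (real \<Rightarrow> real) \<Rightarrow> bool" where
  "route \<gamma> T \<phi> \<longleftrightarrow> 0 \<le> T \<and> continuous_on {0..T} \<gamma> \<and> \<gamma> ` {0..T} \<subseteq> HP \<and>
     (\<forall>s t. 0 \<le> s \<and> s \<le> t \<and> t \<le> T \<longrightarrow> gap N (\<gamma> s) (\<gamma> t) \<le> \<phi> t - \<phi> s)"

lemma routeD:
  assumes "route \<gamma> T \<phi>" "0 \<le> s" "s \<le> t" "t \<le> T"
  shows "gap N (\<gamma> s) (\<gamma> t) \<le> \<phi> t - \<phi> s"
  using assms unfolding route_def by blast

lemma route_mono: "route \<gamma> T \<phi> \<Longrightarrow> 0 \<le> s \<Longrightarrow> s \<le> t \<Longrightarrow> t \<le> T \<Longrightarrow> \<phi> s \<le> \<phi> t"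
  using routeD[of \<gamma> T \<phi> s t] gap_nonneg[of "\<gamma> s" "\<gamma> t"] by linarith

lemma route_horo_dist: "route \<gamma> T \<phi> \<Longrightarrow> horo_dist N hX hY (\<gamma> 0) (\<gamma> T) \<le> ereal (\<phi> T - \<phi> 0)"
  unfolding route_def by (intro horo_dist_le) auto

text \<open>Times on opposite sides of the seam are not controlled by the two potentials. Their
  excess is at most \<open>\<kappa>\<close>, and raising the second potential by
  \<open>\<kappa>\<close> at the seam pays for it once.\<close>

lemma route_glue:
  assumes r1: "route \<gamma>1 T1 \<phi>1" and r2: "route \<gamma>2 T2 \<phi>2" and eq: "\<gamma>1 T1 = \<gamma>2 0"
    and cross: "\<And>s t. s \<in> {0..T1} \<Longrightarrow> t \<in> {0..T2} \<Longrightarrow>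
      gap N (\<gamma>1 s) (\<gamma>2 t) \<le> (\<phi>1 T1 - \<phi>1 s) + (\<phi>2 t - \<phi>2 0) + \<kappa>"
  shows "route (glue T1 \<gamma>1 \<gamma>2) (T1 + T2) (glue T1 \<phi>1 (\<lambda>t. \<phi>1 T1 + \<kappa> + (\<phi>2 t - \<phi>2 0)))"
proof -
  have T: "0 \<le> T1" "0 \<le> T2" using r1 r2 by (auto simp: route_def)
  have cont: "continuous_on {0..T1 + T2} (glue T1 \<gamma>1 \<gamma>2)"
    using r1 r2 eq by (intro glue_continuous) (auto simp: route_def)
  have sub: "glue T1 \<gamma>1 \<gamma>2 ` {0..T1 + T2} \<subseteq> HP"
    using r1 r2 by (auto simp: route_def glue_def image_subset_iff)
  show ?thesis
    unfolding route_def
  proof (intro conjI allI impI cont sub)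
    fix s t assume st: "0 \<le> s \<and> s \<le> t \<and> t \<le> T1 + T2"
    consider "t \<le> T1" | "s \<le> T1" "T1 < t" | "T1 < s" using st by linarith
    then show "gap N (glue T1 \<gamma>1 \<gamma>2 s) (glue T1 \<gamma>1 \<gamma>2 t)
      \<le> glue T1 \<phi>1 (\<lambda>t. \<phi>1 T1 + \<kappa> + (\<phi>2 t - \<phi>2 0)) t - glue T1 \<phi>1 (\<lambda>t. \<phi>1 T1 + \<kappa> + (\<phi>2 t - \<phi>2 0)) s"
    proof cases
      case 1
      then show ?thesis using routeD[OF r1, of s t] st by (simp add: glue_def)
    next
      case 2
      then show ?thesis using cross[of s "t - T1"] st by (simp add: glue_def)
    next
      case 3
      then show ?thesis using routeD[OF r2, of "s - T1" "t - T1"] st by (simp add: glue_def)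
    qed
  qed (use T in auto)
qed

text \<open>One coordinate moves along a geodesic of its factor while the other slides on its
  vertical line to compensate the height; as the heights at both ends agree, the sliding coordinate
  returns. Doing this for each coordinate in turn gives a coordinatewise 1-Lipschitz path of
  duration at most \<open>2 * R\<close>, whose gaps grow at rate at most
  \<open>2 * K\<close>.\<close>

lemma level_route:
  assumes p: "p \<in> HP" and q: "q \<in> HP" and hpq: "hX (fst p) = hX (fst q)" and cl: "close p q R"
  obtains \<gamma> T \<phi> where "route \<gamma> T \<phi>" "\<gamma> 0 = p" "\<gamma> T = q" "\<phi> T - \<phi> 0 \<le> 4 * K * R"
    "\<And>t. t \<in> {0..T} \<Longrightarrow> close (\<gamma> t) q (2 * R)"
proof -
  obtain x y x' y' where pq: "p = (x, y)" "q = (x', y')" by (cases p; cases q)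
  have hh: "hY y = - hX x" "hY y' = - hX x" "hX x' = hX x"
    using p q hpq by (auto simp: pq horo_product_def)
  define a b where "a = dist x x'" and "b = dist y y'"
  obtain g where g: "geodesic_on {0..a} g" "g 0 = x" "g a = x'"
    using X.segment_exists[of x x'] unfolding a_def by blast
  obtain k where k: "geodesic_on {0..b} k" "k 0 = y" "k b = y'"
    using Y.segment_exists[of y y'] unfolding b_def by blast
  have ab: "0 \<le> a" "0 \<le> b" "a \<le> R" "b \<le> R" using cl by (auto simp: a_def b_def close_def pq)
  define \<gamma>1 where "\<gamma>1 t = (g t, WY y (- hX (g t)))" for t
  define \<gamma>2 where "\<gamma>2 t = (WX x' (- hY (k t)), k t)" for t
  define \<gamma> where "\<gamma> = glue a \<gamma>1 \<gamma>2"
  have y: "WY y (- hX x) = y" "WX x' (hX x) = x'"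
    using Y.line_base[of y] X.line_base[of x'] by (simp_all only: hh)
  have join: "\<gamma>1 a = \<gamma>2 0" by (simp add: \<gamma>1_def \<gamma>2_def g k hh y)
  have gs: "dist (g s) (g t) = \<bar>s - t\<bar>" if "s \<in> {0..a}" "t \<in> {0..a}" for s t
    using geodesic_onD[OF g(1)] that by blast
  have ks: "dist (k s) (k t) = \<bar>s - t\<bar>" if "s \<in> {0..b}" "t \<in> {0..b}" for s t
    using geodesic_onD[OF k(1)] that by blast
  have gh: "\<bar>hX (g s) - hX (g t)\<bar> \<le> \<bar>s - t\<bar>" if "s \<in> {0..a}" "t \<in> {0..a}" for s t
    using gs[OF that] X.height_lipschitz[of "g s" "g t"] by simp
  have kh: "\<bar>hY (k s) - hY (k t)\<bar> \<le> \<bar>s - t\<bar>" if "s \<in> {0..b}" "t \<in> {0..b}" for s t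
    using ks[OF that] Y.height_lipschitz[of "k s" "k t"] by simp
  have c1: "contracting a (fst \<circ> \<gamma>1)" "contracting a (snd \<circ> \<gamma>1)"
    unfolding contracting_def using gs gh by (auto simp: \<gamma>1_def Y.dist_line abs_minus_commute)
  have c2: "contracting b (fst \<circ> \<gamma>2)" "contracting b (snd \<circ> \<gamma>2)"
    unfolding contracting_def using ks kh by (auto simp: \<gamma>2_def X.dist_line abs_minus_commute)
  have gl: "fst \<circ> \<gamma> = glue a (fst \<circ> \<gamma>1) (fst \<circ> \<gamma>2)" "snd \<circ> \<gamma> = glue a (snd \<circ> \<gamma>1) (snd \<circ> \<gamma>2)"
    by (auto simp: \<gamma>_def glue_def)
  have c: "contracting (a + b) (fst \<circ> \<gamma>)" "contracting (a + b) (snd \<circ> \<gamma>)"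
    unfolding gl by (intro contracting_glue c1 c2; use join ab in simp)+
  have cl: "close (\<gamma> s) (\<gamma> t) \<bar>s - t\<bar>" if "s \<in> {0..a + b}" "t \<in> {0..a + b}" for s t
    using c that by (auto simp: contracting_def close_def)
  have ends: "\<gamma> 0 = p" "\<gamma> (a + b) = q"
  proof -
    show "\<gamma> 0 = p" using ab by (simp add: \<gamma>_def glue_def \<gamma>1_def g y pq)
    have "\<gamma> (a + b) = \<gamma>2 b" using ab join by (cases "b = 0") (auto simp: \<gamma>_def glue_def)
    then show "\<gamma> (a + b) = q" by (simp add: \<gamma>2_def k hh y pq)
  qed
  have r: "route \<gamma> (a + b) (\<lambda>t. 2 * K * t)"
    unfolding route_def
  proof (intro conjI allI impI)
    have "continuous_on {0..a + b} (\<lambda>t. ((fst \<circ> \<gamma>) t, (snd \<circ> \<gamma>) t))"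
      using c by (intro continuous_on_Pair contracting_continuous)
    then show "continuous_on {0..a + b} \<gamma>" by simp
    show "\<gamma> ` {0..a + b} \<subseteq> HP"
      by (auto simp: \<gamma>_def glue_def \<gamma>1_def \<gamma>2_def horo_product_def)
    fix s t assume st: "0 \<le> s \<and> s \<le> t \<and> t \<le> a + b"
    have "gap N (\<gamma> s) (\<gamma> t) \<le> gap N (\<gamma> t) (\<gamma> t) + 2 * K * (\<bar>s - t\<bar> + 0)"
      by (rule gap_change) (use cl[of s t] st in \<open>auto simp: close_def\<close>)
    then show "gap N (\<gamma> s) (\<gamma> t) \<le> 2 * K * t - 2 * K * s"
      using st N_diag[of 0] by (simp add: gap_def algebra_simps)
  qed (use ab in auto)
  show ?thesis
  proof (rule that[OF r ends])
    show "2 * K * (a + b) - 2 * K * 0 \<le> 4 * K * R"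
      using mult_left_mono[of "a + b" "2 * R" "2 * K"] ab K_ge by simp
    fix t assume t: "t \<in> {0..a + b}"
    show "close (\<gamma> t) q (2 * R)" using cl[OF t, of "a + b"] t ab ends by (auto simp: close_def)
  qed
qed

lemma close_gap:
  assumes "close p p' r"
  shows "gap N p q \<le> gap N p' q + 2 * K * r" "gap N q p \<le> gap N q p' + 2 * K * r"
  using gap_change[of p p' r q q 0] gap_change[of q q 0 p p' r] assms by (auto simp: close_def)

text \<open>A level route bridges the jump. The 14 consists of 4 for its length, 4 for its seam with
  \<open>\<gamma>2\<close> (closeness \<open>2 * R\<close>) and 6 for its seam with
  \<open>\<gamma>1\<close> (closeness \<open>3 * R\<close>). The last clause traces each point of
  the result back to one of the pieces together with the potential still to be spent; this supplies
  the cross condition when a third piece is attached.\<close>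

lemma jump_glue:
  assumes r1: "route \<gamma>1 T1 \<phi>1" and r2: "route \<gamma>2 T2 \<phi>2"
    and hh: "hX (fst (\<gamma>1 T1)) = hX (fst (\<gamma>2 0))" and cl: "close (\<gamma>1 T1) (\<gamma>2 0) R" and \<kappa>: "0 \<le> \<kappa>"
    and cross: "\<And>s t. s \<in> {0..T1} \<Longrightarrow> t \<in> {0..T2} \<Longrightarrow>
      gap N (\<gamma>1 s) (\<gamma>2 t) \<le> (\<phi>1 T1 - \<phi>1 s) + (\<phi>2 t - \<phi>2 0) + \<kappa>"
  obtains \<gamma> T \<phi> where "route \<gamma> T \<phi>" "\<gamma> 0 = \<gamma>1 0" "\<gamma> T = \<gamma>2 T2"
    "\<phi> T - \<phi> 0 \<le> (\<phi>1 T1 - \<phi>1 0) + (\<phi>2 T2 - \<phi>2 0) + \<kappa> + 14 * K * R"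
    "\<And>s. s \<in> {0..T} \<Longrightarrow>
      (\<exists>s1\<in>{0..T1}. close (\<gamma> s) (\<gamma>1 s1) (3 * R) \<and> (\<phi>1 T1 - \<phi>1 s1) + (\<phi>2 T2 - \<phi>2 0) \<le> \<phi> T - \<phi> s) \<or>
      (\<exists>s2\<in>{0..T2}. \<gamma> s = \<gamma>2 s2 \<and> \<phi>2 T2 - \<phi>2 s2 \<le> \<phi> T - \<phi> s)"
proof -
  have T: "0 \<le> T1" "0 \<le> T2" using r1 r2 by (auto simp: route_def)
  have R: "0 \<le> R" using cl zero_le_dist order_trans unfolding close_def by blast
  have KR: "0 \<le> K * R" using K_ge R by simp
  have "\<gamma>1 T1 \<in> HP" "\<gamma>2 0 \<in> HP" using r1 r2 T by (auto simp: route_def image_subset_iff)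
  then obtain c Tc \<phi>c where c: "route c Tc \<phi>c" "c 0 = \<gamma>1 T1" "c Tc = \<gamma>2 0" "\<phi>c Tc - \<phi>c 0 \<le> 4 * K * R"
    "\<And>t. t \<in> {0..Tc} \<Longrightarrow> close (c t) (\<gamma>2 0) (2 * R)"
    using level_route[OF _ _ hh cl] by blast
  have Tc: "0 \<le> Tc" using c(1) by (auto simp: route_def)
  define \<gamma>3 where "\<gamma>3 = glue Tc c \<gamma>2"
  define \<phi>3 where "\<phi>3 = glue Tc \<phi>c (\<lambda>t. \<phi>c Tc + 4 * K * R + (\<phi>2 t - \<phi>2 0))"
  have r3: "route \<gamma>3 (Tc + T2) \<phi>3"
    unfolding \<gamma>3_def \<phi>3_def
  proof (rule route_glue[OF c(1) r2 c(3)])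
    fix s t assume st: "s \<in> {0..Tc}" "t \<in> {0..T2}"
    have "gap N (c s) (\<gamma>2 t) \<le> gap N (\<gamma>2 0) (\<gamma>2 t) + 2 * K * (2 * R)" by (rule close_gap) (rule c(5)[OF st(1)])
    moreover have "gap N (\<gamma>2 0) (\<gamma>2 t) \<le> \<phi>2 t - \<phi>2 0" using routeD[OF r2, of 0 t] st by auto
    moreover have "\<phi>c s \<le> \<phi>c Tc" using route_mono[OF c(1), of s Tc] st by auto
    ultimately show "gap N (c s) (\<gamma>2 t) \<le> (\<phi>c Tc - \<phi>c s) + (\<phi>2 t - \<phi>2 0) + 4 * K * R" by simp
  qed
  define \<kappa>' where "\<kappa>' = \<kappa> + 6 * K * R"
  define \<gamma> where "\<gamma> = glue T1 \<gamma>1 \<gamma>3"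
  define \<phi> where "\<phi> = glue T1 \<phi>1 (\<lambda>t. \<phi>1 T1 + \<kappa>' + (\<phi>3 t - \<phi>3 0))"
  have c3: "close (c t) (\<gamma>1 T1) (3 * R)" if "t \<in> {0..Tc}" for t
    using close_trans[OF c(5)[OF that] close_sym[OF cl]] by simp
  have \<phi>30: "\<phi>3 0 = \<phi>c 0" "\<gamma>3 0 = \<gamma>1 T1" using Tc c by (auto simp: \<phi>3_def \<gamma>3_def glue_def)
  have \<phi>c: "\<phi>c s \<le> \<phi>c t" if "0 \<le> s" "s \<le> t" "t \<le> Tc" for s t by (rule route_mono[OF c(1) that])
  have \<phi>3': "\<phi>3 t - \<phi>3 0 \<ge> \<phi>2 (t - Tc) - \<phi>2 0" if "Tc < t" for t
    using that \<phi>30 KR \<phi>c[of 0 Tc] Tc by (simp add: \<phi>3_def glue_def)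
  have r: "route \<gamma> (T1 + (Tc + T2)) \<phi>"
    unfolding \<gamma>_def \<phi>_def
  proof (rule route_glue[OF r1 r3])
    fix s t assume st: "s \<in> {0..T1}" "t \<in> {0..Tc + T2}"
    show "gap N (\<gamma>1 s) (\<gamma>3 t) \<le> (\<phi>1 T1 - \<phi>1 s) + (\<phi>3 t - \<phi>3 0) + \<kappa>'"
    proof (cases "t \<le> Tc")
      case True
      then have "gap N (\<gamma>1 s) (c t) \<le> gap N (\<gamma>1 s) (\<gamma>1 T1) + 2 * K * (3 * R)"
        using st by (intro close_gap(2) c3) auto
      moreover have "gap N (\<gamma>1 s) (\<gamma>1 T1) \<le> \<phi>1 T1 - \<phi>1 s" using routeD[OF r1, of s T1] st by auto
      moreover have "0 \<le> \<phi>3 t - \<phi>3 0" using route_mono[OF r3, of 0 t] st by auto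
      ultimately show ?thesis using \<kappa> True by (simp add: \<kappa>'_def \<gamma>3_def glue_def)
    next
      case False
      then show ?thesis using cross[of s "t - Tc"] st \<phi>3'[of t] KR by (simp add: \<kappa>'_def \<gamma>3_def glue_def)
    qed
  qed (use \<phi>30 in simp)
  let ?T = "T1 + (Tc + T2)"
  have end3: "\<gamma>3 (Tc + T2) = \<gamma>2 T2" using T Tc c(3) by (cases "T2 = 0") (auto simp: \<gamma>3_def glue_def)
  have ends: "\<gamma> 0 = \<gamma>1 0" "\<gamma> ?T = \<gamma>2 T2"
    using T Tc end3 \<phi>30 by (cases "Tc + T2 = 0"; auto simp: \<gamma>_def glue_def)+
  have \<phi>3_end: "\<phi>3 (Tc + T2) - \<phi>3 0 \<le> (\<phi>2 T2 - \<phi>2 0) + 8 * K * R"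
    using \<phi>30 c(4) T KR Tc by (cases "T2 = 0") (auto simp: \<phi>3_def glue_def algebra_simps)
  have \<phi>3_tail: "\<phi>2 T2 - \<phi>2 0 \<le> \<phi>3 (Tc + T2) - \<phi>3 t" if "t \<in> {0..Tc}" for t
    using that T KR \<phi>c[of t Tc] by (cases "T2 = 0") (auto simp: \<phi>3_def glue_def)
  have \<kappa>': "0 \<le> \<kappa>'" using \<kappa> KR by (simp add: \<kappa>'_def)
  have total: "\<phi> ?T - \<phi> 0 \<le> (\<phi>1 T1 - \<phi>1 0) + (\<phi>3 (Tc + T2) - \<phi>3 0) + \<kappa>'"
    and \<phi>T: "\<phi>1 T1 + (\<phi>3 (Tc + T2) - \<phi>3 0) \<le> \<phi> ?T"
    using T Tc \<kappa>' by (cases "Tc + T2 = 0"; auto simp: \<phi>_def glue_def)+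
  have \<phi>d: "\<phi>3 (Tc + T2) - \<phi>3 (s - T1) \<le> \<phi> ?T - \<phi> s" if "T1 < s" "s \<le> ?T" for s
    using that by (auto simp: \<phi>_def glue_def)
  show ?thesis
  proof (rule that[OF r ends])
    show "\<phi> ?T - \<phi> 0 \<le> (\<phi>1 T1 - \<phi>1 0) + (\<phi>2 T2 - \<phi>2 0) + \<kappa> + 14 * K * R"
      using total \<phi>3_end by (simp add: \<kappa>'_def)
    fix s assume s: "s \<in> {0..?T}"
    consider "s \<le> T1" | "T1 < s" "s \<le> T1 + Tc" | "T1 + Tc < s" by linarith
    then show "(\<exists>s1\<in>{0..T1}. close (\<gamma> s) (\<gamma>1 s1) (3 * R) \<and> (\<phi>1 T1 - \<phi>1 s1) + (\<phi>2 T2 - \<phi>2 0) \<le> \<phi> ?T - \<phi> s) \<or>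
      (\<exists>s2\<in>{0..T2}. \<gamma> s = \<gamma>2 s2 \<and> \<phi>2 T2 - \<phi>2 s2 \<le> \<phi> ?T - \<phi> s)"
    proof cases
      case 1
      have "close (\<gamma> s) (\<gamma>1 s) (3 * R)" using 1 R by (auto simp: \<gamma>_def glue_def close_def)
      moreover have "(\<phi>1 T1 - \<phi>1 s) + (\<phi>2 T2 - \<phi>2 0) \<le> \<phi> ?T - \<phi> s"
        using 1 \<phi>T \<phi>3_tail[of 0] Tc by (auto simp: \<phi>_def glue_def)
      ultimately show ?thesis using s 1 by (intro disjI1 bexI[of _ s]) auto
    next
      case 2
      then have m: "s - T1 \<in> {0..Tc}" by auto
      have "close (\<gamma> s) (\<gamma>1 T1) (3 * R)" using 2 c3[OF m] by (auto simp: \<gamma>_def \<gamma>3_def glue_def)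
      moreover have "(\<phi>1 T1 - \<phi>1 T1) + (\<phi>2 T2 - \<phi>2 0) \<le> \<phi> ?T - \<phi> s"
        using 2 \<phi>3_tail[OF m] \<phi>d[of s] s by auto
      ultimately show ?thesis using T by (intro disjI1 bexI[of _ T1]) auto
    next
      case 3
      have "\<gamma> s = \<gamma>2 (s - T1 - Tc)" using 3 Tc by (auto simp: \<gamma>_def \<gamma>3_def glue_def)
      moreover have "\<phi>3 (Tc + T2) - \<phi>3 (s - T1) = \<phi>2 T2 - \<phi>2 (s - T1 - Tc)"
        using 3 s by (auto simp: \<phi>3_def glue_def)
      ultimately show ?thesis using 3 s \<phi>d[of s] Tc
        by (intro disjI2 bexI[of _ "s - T1 - Tc"]) auto
    qed
  qed
qed

end

section \<open>The cost of moving below a horosphere\<close>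

context height_space
begin

lemma C_nonneg: "0 \<le> C"
  using line_merge[of 0 x t x] by (simp add: dist_line)

text \<open>The two lines meet at height \<open>s\<close> and cannot separate upwards. Below
  \<open>s\<close> they may differ, since downward halves are chosen point by point.\<close>

lemma line_line: "s \<le> t \<Longrightarrow> W (W x s) t = W x t"
  using line_antimono[of s t "W x s" x] line_base[of "W x s"] by simp

lemma dist_lower_line: "s \<le> t \<Longrightarrow> t - s + dist (W x t) (W y t) \<le> dist (W x s) (W y t) + C"
  using dist_lower[of "W x s" "W y t"] by (simp add: line_line)

lemma dist_upper_line: "dist (W x s) (W y t) \<le> \<bar>t - s\<bar> + dist (W x t) (W y t)"
  using dist_triangle[of "W x s" "W y t" "W x t"] by (simp add: dist_line abs_minus_commute)

lemma line_shift: "dist (W x s) (W y s) \<le> dist (W x t) (W y t) + 2 * \<bar>t - s\<bar>"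
  using dist_triangle[of "W x s" "W y s" "W x t"] dist_triangle[of "W x t" "W y s" "W y t"]
  by (simp add: dist_line abs_minus_commute)

lemma line_dist_le:
  assumes "h x \<le> c" "h y \<le> c"
  shows "dist (W x c) (W y c) \<le> 2 * dist x y"
proof -
  have *: "dist (W x c) (W y c) \<le> 2 * dist x y" if "h x \<le> h y" "h y \<le> c" for x y
  proof -
    have "dist (W x c) (W y c) \<le> dist (W x (h y)) (W y (h y))" using that by (intro line_antimono)
    also have "\<dots> \<le> dist (W x (h y)) (W x (h x)) + dist x y"
      using dist_triangle[of "W x (h y)" y x] by simp
    also have "\<dots> \<le> 2 * dist x y" using height_lipschitz[of y x] unfolding dist_line by (simp add: dist_commute)
    finally show ?thesis .
  qed
  show ?thesis using *[of x y] *[of y x] assms by (cases "h x \<le> h y") (auto simp: dist_commute)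
qed

text \<open>Below the level \<open>c\<close> each doubling of the length of a path costs only a bounded amount of height
  at which the lines through its ends have merged.\<close>

lemma path_below_block:
  fixes f :: "real \<Rightarrow> 'a"
  assumes lip: "\<And>u v. u \<in> {a..b} \<Longrightarrow> v \<in> {a..b} \<Longrightarrow> dist (f u) (f v) \<le> 2 * \<bar>u - v\<bar>"
    and below: "\<And>u. u \<in> {a..b} \<Longrightarrow> h (f u) \<le> c"
    and "a \<le> s" "s \<le> t" "t \<le> b" "t - s \<le> 2 ^ n"
  shows "dist (W (f s) (c + n * (C + 4))) (W (f t) (c + n * (C + 4))) \<le> C + 4"
  using assms(3-)
proof (induction n arbitrary: s t)
  case 0
  have "dist (W (f s) c) (W (f t) c) \<le> 2 * dist (f s) (f t)" using 0 by (intro line_dist_le below) auto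
  also have "\<dots> \<le> 4" using lip[of s t] 0 by auto
  finally show ?case using C_nonneg by simp
next
  case (Suc n)
  define m where "m = (s + t) / 2"
  have m: "s \<le> m" "m \<le> t" "m - s \<le> 2 ^ n" "t - m \<le> 2 ^ n" using Suc.prems by (auto simp: m_def field_simps)
  let ?c = "c + n * (C + 4)"
  have "dist (W (f s) ?c) (W (f t) ?c) \<le> dist (W (f s) ?c) (W (f m) ?c) + dist (W (f m) ?c) (W (f t) ?c)"
    by (rule dist_triangle)
  also have "\<dots> \<le> 2 * (C + 4)" using Suc.IH[of s m] Suc.IH[of m t] m Suc.prems by simp
  finally have "dist (W (f s) (?c + (C + 4))) (W (f t) (?c + (C + 4))) \<le> C"
    using C_nonneg by (intro line_merge) auto
  then show ?case by (simp add: algebra_simps)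
qed

text \<open>On a stretch of length \<open>2 ^ n\<close> the lines have merged at height
  \<open>c + n * D\<close>; going back to \<open>c\<close> costs \<open>2 * n * D\<close>. This is
  linear in \<open>n\<close> and so below \<open>\<epsilon> * 2 ^ n\<close> for some
  \<open>n\<close>. Cutting the path into such stretches gives the slope
  \<open>\<epsilon>\<close>.\<close>

lemma path_below:
  assumes "0 < \<epsilon>"
  shows "\<exists>B\<ge>0. \<forall>(f :: real \<Rightarrow> 'a) a b c.
    (\<forall>u\<in>{a..b}. \<forall>v\<in>{a..b}. dist (f u) (f v) \<le> 2 * \<bar>u - v\<bar>) \<longrightarrow>
    (\<forall>u\<in>{a..b}. h (f u) \<le> c) \<longrightarrow> a \<le> b \<longrightarrow> dist (W (f a) c) (W (f b) c) \<le> \<epsilon> * (b - a) + B"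
proof -
  define D where "D = C + 4"
  have D: "D > 0" using C_nonneg by (simp add: D_def)
  have "(\<lambda>n. D * (1 + 2 * real n) / 2 ^ n) \<longlonglongrightarrow> 0" by real_asymp
  then have "\<forall>\<^sub>F n in sequentially. D * (1 + 2 * real n) / 2 ^ n < \<epsilon>" using assms by (rule order_tendstoD)
  then obtain n where n: "D * (1 + 2 * real n) / 2 ^ n < \<epsilon>" by (auto simp: eventually_sequentially)
  define B where "B = D * (1 + 2 * real n)"
  have B: "0 \<le> B" "B \<le> \<epsilon> * 2 ^ n" using D n by (auto simp: B_def field_simps)
  show ?thesis
  proof (intro exI[of _ B] conjI allI impI B(1))
    fix f :: "real \<Rightarrow> 'a" and a b c
    assume "\<forall>u\<in>{a..b}. \<forall>v\<in>{a..b}. dist (f u) (f v) \<le> 2 * \<bar>u - v\<bar>"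
      and "\<forall>u\<in>{a..b}. h (f u) \<le> c" and ab: "a \<le> b"
    note lip = this(1)[rule_format] and below = this(2)[rule_format]
    have block: "dist (W (f s) c) (W (f t) c) \<le> B" if "a \<le> s" "s \<le> t" "t \<le> b" "t - s \<le> 2 ^ n" for s t
    proof -
      have "dist (W (f s) c) (W (f t) c) \<le> dist (W (f s) (c + n * D)) (W (f t) (c + n * D)) + 2 * \<bar>(c + n * D) - c\<bar>"
        by (rule line_shift)
      also have "\<dots> \<le> D + 2 * (n * D)"
        using path_below_block[of a b f c, OF lip below that] D by (simp add: D_def)
      finally show ?thesis by (simp add: B_def algebra_simps)
    qed
    have chain: "t - a \<le> m * 2 ^ n \<Longrightarrow> a \<le> t \<Longrightarrow> t \<le> b \<Longrightarrow> dist (W (f a) c) (W (f t) c) \<le> m * B" for m :: nat and t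
    proof (induction m arbitrary: t)
      case 0
      then have "t = a" by simp
      then show ?case by simp
    next
      case (Suc m)
      define s where "s = max a (t - 2 ^ n)"
      have s: "a \<le> s" "s \<le> t" "t - s \<le> 2 ^ n" "s - a \<le> m * 2 ^ n" using Suc.prems by (auto simp: s_def algebra_simps)
      have "dist (W (f a) c) (W (f t) c) \<le> dist (W (f a) c) (W (f s) c) + dist (W (f s) c) (W (f t) c)"
        by (rule dist_triangle)
      also have "\<dots> \<le> m * B + B" using Suc.IH[of s] block[of s t] s Suc.prems by (intro add_mono) auto
      finally show ?case by (simp add: algebra_simps)
    qed
    define m where "m = nat \<lceil>(b - a) / 2 ^ n\<rceil>"
    have q: "0 \<le> (b - a) / 2 ^ n" using ab by simp
    have m: "(b - a) / 2 ^ n \<le> m" "m \<le> (b - a) / 2 ^ n + 1"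
      using q unfolding m_def by linarith+
    have "dist (W (f a) c) (W (f b) c) \<le> m * B"
      by (rule chain) (use m ab in \<open>auto simp: field_simps\<close>)
    also have "\<dots> \<le> ((b - a) / 2 ^ n + 1) * B" using m B by (intro mult_right_mono) auto
    also have "\<dots> = (b - a) / 2 ^ n * B + B" by (simp add: algebra_simps)
    also have "(b - a) / 2 ^ n * B \<le> (b - a) / 2 ^ n * (\<epsilon> * 2 ^ n)" using B q by (intro mult_left_mono)
    finally show "dist (W (f a) c) (W (f b) c) \<le> \<epsilon> * (b - a) + B" by (simp add: mult.commute)
  qed
qed

text \<open>The factor \<open>L\<close> is arbitrary so that it can be chosen larger than the factor of the
  horizontal error in the upper bound for the distance.\<close>

lemma climb_estimate:
  assumes L: "1 \<le> L"
  shows "\<exists>B\<ge>0. \<forall>(f :: real \<Rightarrow> 'a) a b c k.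
    (\<forall>u\<in>{a..b}. \<forall>v\<in>{a..b}. dist (f u) (f v) + \<bar>h (f u) - h (f v)\<bar> \<le> 2 * \<bar>u - v\<bar>) \<longrightarrow>
    (\<forall>u\<in>{a..b}. h (f u) \<le> c) \<longrightarrow> a \<le> b \<longrightarrow> 0 \<le> k \<longrightarrow> c - k \<le> h (f b) \<longrightarrow>
    (c - h (f a)) + L * dist (W (f a) c) (W (f b) c) \<le> (b - a) + k + B"
proof -
  \<comment> \<open>Displacement is charged at three times the rate \<open>L\<close>: it has to pay
    for the term \<open>L * m\<close> of the claim and also for the one hidden in the depth
    \<open>j\<close>.\<close>
  have e: "0 < 1 / (3 * L)" using L by simp
  obtain B0 where B0: "0 \<le> B0" "\<forall>(f :: real \<Rightarrow> 'a) a b c.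
    (\<forall>u\<in>{a..b}. \<forall>v\<in>{a..b}. dist (f u) (f v) \<le> 2 * \<bar>u - v\<bar>) \<longrightarrow>
    (\<forall>u\<in>{a..b}. h (f u) \<le> c) \<longrightarrow> a \<le> b \<longrightarrow> dist (W (f a) c) (W (f b) c) \<le> 1 / (3 * L) * (b - a) + B0"
    using path_below[OF e] by blast
  define B where "B = 3 * L * (C + B0)"
  have "1 * (C + B0) \<le> (3 * L) * (C + B0)" using L C_nonneg B0 by (intro mult_right_mono) auto
  then have B: "0 \<le> B" "C \<le> B" "3 * L * B0 \<le> B" using L C_nonneg B0 by (auto simp: B_def algebra_simps)
  show ?thesis
  proof (intro exI[of _ B] conjI allI impI B(1))
    \<comment> \<open>The Lipschitz condition is the trace in one factor of a geodesic of the
      product: the coordinate distances sum to at most twice the time, and the distance in the other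
      factor is at least the height difference.\<close>
    fix f :: "real \<Rightarrow> 'a" and a b c k
    assume lip': "\<forall>u\<in>{a..b}. \<forall>v\<in>{a..b}. dist (f u) (f v) + \<bar>h (f u) - h (f v)\<bar> \<le> 2 * \<bar>u - v\<bar>"
      and below': "\<forall>u\<in>{a..b}. h (f u) \<le> c" and ab: "a \<le> b" and k: "0 \<le> k" and top: "c - k \<le> h (f b)"
    note lip = lip'[rule_format] and below = below'[rule_format]
    define m where "m = dist (W (f a) c) (W (f b) c)"
    \<comment> \<open>The path is cut where it reaches depth \<open>j\<close> below
      \<open>c\<close>. Rising from there to height \<open>c - k\<close> takes time at least
      \<open>L * m\<close>, exactly the displacement term of the claim.\<close>
    define j where "j = L * m + k"
    have Lm: "0 \<le> L * m" using L by (simp add: m_def)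
    have lip1: "dist (f u) (f v) \<le> 2 * \<bar>u - v\<bar>" if "u \<in> {a..b}" "v \<in> {a..b}" for u v
      using lip[OF that] by linarith
    have lip2: "\<bar>h (f u) - h (f v)\<bar> \<le> \<bar>u - v\<bar>" if "u \<in> {a..b}" "v \<in> {a..b}" for u v
      using lip[OF that] height_lipschitz[of "f u" "f v"] by (smt (verit))
    have far: "3 * L * dist (W (f u) c) (W (f b) c) \<le> (b - u) + 3 * L * B0" if "u \<in> {a..b}" for u
    proof -
      have "dist (W (f u) c) (W (f b) c) \<le> 1 / (3 * L) * (b - u) + B0"
        using that by (intro B0(2)[rule_format] lip1 below) auto
      then have "3 * L * dist (W (f u) c) (W (f b) c) \<le> 3 * L * (1 / (3 * L) * (b - u) + B0)"
        using L by (intro mult_left_mono) auto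
      also have "\<dots> = (b - u) + 3 * L * B0" using L by (simp add: field_simps)
      finally show ?thesis .
    qed
    show "(c - h (f a)) + L * dist (W (f a) c) (W (f b) c) \<le> (b - a) + k + B"
    proof (cases "c - j \<le> h (f a)")
      case True
      then show ?thesis using far[of a] ab B Lm by (simp add: j_def m_def[symmetric])
    next
      case False
      have "continuous_on {a..b} (\<lambda>u. h (f u))"
        unfolding continuous_on_iff
      proof (intro ballI allI impI)
        fix x e :: real assume "x \<in> {a..b}" "0 < e"
        then show "\<exists>d>0. \<forall>x'\<in>{a..b}. dist x' x < d \<longrightarrow> dist (h (f x')) (h (f x)) < e"
          using lip2 by (intro exI[of _ e]) (force simp: dist_real_def)
      qed
      then obtain u where u: "u \<in> {a..b}" "h (f u) = c - j"
        using IVT'[of "\<lambda>u. h (f u)" a "c - j" b] False top Lm ab by (auto simp: j_def)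
      define r where "r = dist (W (f a) (c - j)) (f u)"
      have "c - j - h (f a) + r \<le> dist (f a) (f u) + C"
        using dist_lower[of "f a" "f u"] False u by (simp add: r_def)
      then have au: "2 * (c - j - h (f a)) + r - C \<le> 2 * (u - a)"
        using lip[of a u] u ab False by auto
      have ub: "j - k \<le> b - u" using lip2[of u b] u ab top by auto
      show ?thesis
      \<comment> \<open>If the displacement \<open>r\<close> at depth \<open>j\<close> is large, the
        first part already takes the additional time \<open>j\<close> and the second part pays for
        \<open>L * m\<close>. If it is small, the lines through \<open>f a\<close> and
        \<open>f u\<close> have merged by height \<open>c\<close>, so \<open>m\<close> arises in the
        second part and is charged there at rate \<open>3 * L\<close>.\<close>
      proof (cases "2 * j \<le> r")
        case True
        then show ?thesis using au ub B k by (simp add: j_def m_def[symmetric])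
      next
        case False
        have j: "0 \<le> j" using Lm k by (simp add: j_def)
        have "dist (W (f a) (c - j + j)) (W (f u) (c - j + j)) \<le> C"
          using False j u line_base[of "f u"] by (intro line_merge) (auto simp: r_def)
        then have "m \<le> C + dist (W (f u) c) (W (f b) c)"
          using dist_triangle[of "W (f a) c" "W (f b) c" "W (f u) c"] by (simp add: m_def)
        then have "3 * L * m \<le> 3 * L * (C + dist (W (f u) c) (W (f b) c))"
          using L by (intro mult_left_mono) auto
        then have "3 * L * m \<le> 3 * L * C + (b - u) + 3 * L * B0" using far[OF u(1)] by (simp add: algebra_simps)
        moreover have "c - j - h (f a) \<le> u - a" using lip2[of a u] u ab by auto
        ultimately show ?thesis using B_def Lm by (simp add: j_def m_def[symmetric] algebra_simps)
      qed
    qed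
  qed
qed

end

section \<open>Broken vertical paths\<close>

context horo_pair
begin

text \<open>For fixed \<open>x\<close> and \<open>y\<close> this is a vertical geodesic in
  \<open>g\<close>. The points \<open>x\<close> and \<open>y\<close> only name lines of the factors,
  so their heights need not be related.\<close>

definition pt :: "'a \<Rightarrow> 'b \<Rightarrow> real \<Rightarrow> 'a \<times> 'b" where
  "pt x y g = (WX x g, WY y (- g))"

lemma pt_in: "pt x y g \<in> HP"
  by (simp add: pt_def horo_product_def)

lemma pt_simps [simp]: "fst (pt x y g) = WX x g" "snd (pt x y g) = WY y (- g)"
  by (simp_all add: pt_def)

lemma gap_pt_same: "gap N (pt x y g) (pt x y g') = \<bar>g - g'\<bar>"
proof -
  have "\<bar>- g - - g'\<bar> = \<bar>g - g'\<bar>" by linarith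
  then show ?thesis by (simp add: gap_def X.dist_line Y.dist_line N_diag)
qed

lemma gap_commute: "gap N p q = gap N q p"
  by (simp add: gap_def dist_commute)

lemma pt_route: "route (\<lambda>t. pt x y (g + sgn (g' - g) * t)) \<bar>g' - g\<bar> (\<lambda>t. t)"
proof -
  have "continuous_on {0..\<bar>g' - g\<bar>} (\<lambda>t. pt x y (g + sgn (g' - g) * t))"
  proof -
    have "contracting \<bar>g' - g\<bar> (\<lambda>t. WX x (g + sgn (g' - g) * t))"
      "contracting \<bar>g' - g\<bar> (\<lambda>t. WY y (- (g + sgn (g' - g) * t)))"
      by (auto simp: contracting_def X.dist_line Y.dist_line sgn_if)
    then show ?thesis unfolding pt_def by (intro continuous_on_Pair contracting_continuous)
  qed
  then show ?thesis
    unfolding route_def by (auto simp: pt_in gap_pt_same sgn_if)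
qed

text \<open>Three vertical legs with two level jumps. Tracing the first two legs through the first
  jump costs \<open>6 * K * R\<close> in the cross condition with the third leg, whence 34 = 14 + 14
  + 6 and the double \<open>\<kappa>\<close>. The comparison of the outer legs is a separate
  hypothesis because gaps cannot be chained.\<close>

lemma broken_vertical:
  assumes cl1: "close (pt x1 y1 g1) (pt x2 y2 g1) R" and cl2: "close (pt x2 y2 g2) (pt x3 y3 g2) R"
    and \<kappa>: "0 \<le> \<kappa>"
    and c12: "\<And>g g'. g \<in> closed_segment g0 g1 \<Longrightarrow> g' \<in> closed_segment g1 g2 \<Longrightarrow>
      gap N (pt x1 y1 g) (pt x2 y2 g') \<le> \<bar>g1 - g\<bar> + \<bar>g' - g1\<bar> + \<kappa>"
    and c23: "\<And>g g'. g \<in> closed_segment g1 g2 \<Longrightarrow> g' \<in> closed_segment g2 g3 \<Longrightarrow>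
      gap N (pt x2 y2 g) (pt x3 y3 g') \<le> \<bar>g2 - g\<bar> + \<bar>g' - g2\<bar> + \<kappa>"
    and c13: "\<And>g g'. g \<in> closed_segment g0 g1 \<Longrightarrow> g' \<in> closed_segment g2 g3 \<Longrightarrow>
      gap N (pt x1 y1 g) (pt x3 y3 g') \<le> \<bar>g1 - g\<bar> + \<bar>g2 - g1\<bar> + \<bar>g' - g2\<bar> + \<kappa>"
  shows "horo_dist N hX hY (pt x1 y1 g0) (pt x3 y3 g3)
    \<le> ereal (\<bar>g1 - g0\<bar> + \<bar>g2 - g1\<bar> + \<bar>g3 - g2\<bar> + 2 * \<kappa> + 34 * K * R)"
proof -
  have seg: "g + sgn (g' - g) * t \<in> closed_segment g g'" "\<bar>g' - (g + sgn (g' - g) * t)\<bar> = \<bar>g' - g\<bar> - t"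
      "\<bar>g + sgn (g' - g) * t - g\<bar> = t"
    if "t \<in> {0..\<bar>g' - g\<bar>}" for g g' t :: real
    using that by (auto simp: closed_segment_eq_real_ivl sgn_if)
  have fin: "g + sgn (g' - g) * \<bar>g' - g\<bar> = g'" for g g' :: real by (auto simp: sgn_if)
  define \<gamma>1 where "\<gamma>1 = (\<lambda>t. pt x1 y1 (g0 + sgn (g1 - g0) * t))"
  define \<gamma>2 where "\<gamma>2 = (\<lambda>t. pt x2 y2 (g1 + sgn (g2 - g1) * t))"
  define \<gamma>3 where "\<gamma>3 = (\<lambda>t. pt x3 y3 (g2 + sgn (g3 - g2) * t))"
  have r1: "route \<gamma>1 \<bar>g1 - g0\<bar> (\<lambda>t. t)" and r2: "route \<gamma>2 \<bar>g2 - g1\<bar> (\<lambda>t. t)" and r3: "route \<gamma>3 \<bar>g3 - g2\<bar> (\<lambda>t. t)"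
    unfolding \<gamma>1_def \<gamma>2_def \<gamma>3_def by (rule pt_route)+
  have R: "0 \<le> R" using cl1 zero_le_dist order_trans unfolding close_def by blast
  then have KR: "0 \<le> K * R" using K_ge by simp
  have x12: "gap N (\<gamma>1 s) (\<gamma>2 t) \<le> (\<bar>g1 - g0\<bar> - s) + (t - 0) + \<kappa>"
    if "s \<in> {0..\<bar>g1 - g0\<bar>}" "t \<in> {0..\<bar>g2 - g1\<bar>}" for s t
    using c12[OF seg(1)[OF that(1)] seg(1)[OF that(2)]] seg(2)[OF that(1)] seg(3)[OF that(2)]
    by (simp add: \<gamma>1_def \<gamma>2_def)
  have x23: "gap N (\<gamma>2 s) (\<gamma>3 t) \<le> (\<bar>g2 - g1\<bar> - s) + (t - 0) + \<kappa>"
    if "s \<in> {0..\<bar>g2 - g1\<bar>}" "t \<in> {0..\<bar>g3 - g2\<bar>}" for s t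
    using c23[OF seg(1)[OF that(1)] seg(1)[OF that(2)]] seg(2)[OF that(1)] seg(3)[OF that(2)]
    by (simp add: \<gamma>2_def \<gamma>3_def)
  have x13: "gap N (\<gamma>1 s) (\<gamma>3 t) \<le> (\<bar>g1 - g0\<bar> - s) + \<bar>g2 - g1\<bar> + (t - 0) + \<kappa>"
    if "s \<in> {0..\<bar>g1 - g0\<bar>}" "t \<in> {0..\<bar>g3 - g2\<bar>}" for s t
    using c13[OF seg(1)[OF that(1)] seg(1)[OF that(2)]] seg(2)[OF that(1)] seg(3)[OF that(2)]
    by (simp add: \<gamma>1_def \<gamma>3_def)
  have ends: "\<gamma>1 0 = pt x1 y1 g0" "\<gamma>1 \<bar>g1 - g0\<bar> = pt x1 y1 g1" "\<gamma>2 0 = pt x2 y2 g1"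
    "\<gamma>2 \<bar>g2 - g1\<bar> = pt x2 y2 g2" "\<gamma>3 0 = pt x3 y3 g2" "\<gamma>3 \<bar>g3 - g2\<bar> = pt x3 y3 g3"
    by (simp_all add: \<gamma>1_def \<gamma>2_def \<gamma>3_def fin)
  obtain \<gamma> T \<phi> where \<gamma>: "route \<gamma> T \<phi>" "\<gamma> 0 = \<gamma>1 0" "\<gamma> T = \<gamma>2 \<bar>g2 - g1\<bar>"
    "\<phi> T - \<phi> 0 \<le> (\<bar>g1 - g0\<bar> - 0) + (\<bar>g2 - g1\<bar> - 0) + \<kappa> + 14 * K * R"
    and tr: "\<And>s. s \<in> {0..T} \<Longrightarrow>
      (\<exists>s1\<in>{0..\<bar>g1 - g0\<bar>}. close (\<gamma> s) (\<gamma>1 s1) (3 * R) \<and> (\<bar>g1 - g0\<bar> - s1) + (\<bar>g2 - g1\<bar> - 0) \<le> \<phi> T - \<phi> s) \<or>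
      (\<exists>s2\<in>{0..\<bar>g2 - g1\<bar>}. \<gamma> s = \<gamma>2 s2 \<and> \<bar>g2 - g1\<bar> - s2 \<le> \<phi> T - \<phi> s)"
    by (rule jump_glue[OF r1 r2 _ _ \<kappa> x12, of R]) (use cl1 in \<open>auto simp: ends\<close>)
  have x: "gap N (\<gamma> s) (\<gamma>3 t) \<le> (\<phi> T - \<phi> s) + (t - 0) + (\<kappa> + 6 * K * R)"
    if s: "s \<in> {0..T}" and t: "t \<in> {0..\<bar>g3 - g2\<bar>}" for s t
    using tr[OF s]
  proof (elim disjE bexE conjE)
    fix s1 assume s1: "s1 \<in> {0..\<bar>g1 - g0\<bar>}" "close (\<gamma> s) (\<gamma>1 s1) (3 * R)"
      "(\<bar>g1 - g0\<bar> - s1) + (\<bar>g2 - g1\<bar> - 0) \<le> \<phi> T - \<phi> s"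
    show ?thesis using close_gap(1)[OF s1(2), of "\<gamma>3 t"] x13[OF s1(1) t] s1(3) by simp
  next
    fix s2 assume s2: "s2 \<in> {0..\<bar>g2 - g1\<bar>}" "\<gamma> s = \<gamma>2 s2" "\<bar>g2 - g1\<bar> - s2 \<le> \<phi> T - \<phi> s"
    show ?thesis using x23[OF s2(1) t] s2 KR by simp
  qed
  obtain \<gamma>' T' \<phi>' where \<gamma>': "route \<gamma>' T' \<phi>'" "\<gamma>' 0 = \<gamma> 0" "\<gamma>' T' = \<gamma>3 \<bar>g3 - g2\<bar>"
    "\<phi>' T' - \<phi>' 0 \<le> (\<phi> T - \<phi> 0) + (\<bar>g3 - g2\<bar> - 0) + (\<kappa> + 6 * K * R) + 14 * K * R"
    by (rule jump_glue[OF \<gamma>(1) r3 _ _ _ x, of R]) (use cl2 \<kappa> KR in \<open>auto simp: ends \<gamma>(3)\<close>)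
  have "horo_dist N hX hY (pt x1 y1 g0) (pt x3 y3 g3) \<le> ereal (\<phi>' T' - \<phi>' 0)"
    using route_horo_dist[OF \<gamma>'(1)] by (simp add: \<gamma>' \<gamma> ends)
  also have "\<dots> \<le> ereal (\<bar>g1 - g0\<bar> + \<bar>g2 - g1\<bar> + \<bar>g3 - g2\<bar> + 2 * \<kappa> + 34 * K * R)"
    using \<gamma>'(4) \<gamma>(4) by (simp add: algebra_simps)
  finally show ?thesis .
qed

text \<open>Geodesic triangles over a common base are tripods up to a bounded error, which makes the gap
  decompose into a vertical part and the two horizontal parts.\<close>

lemma gap_pt:
  assumes "g \<le> g'"
  shows "gap N (pt x y g) (pt x' y' g') \<le> (g' - g) + N (dist (WX x g') (WX x' g'), 0)
    + N (0, dist (WY y (- g)) (WY y' (- g))) + K * (CX + CY)"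
proof -
  define u where "u = dist (WX x g') (WX x' g')"
  define v where "v = dist (WY y (- g)) (WY y' (- g))"
  have 1: "\<bar>dist (WX x g) (WX x' g') - ((g' - g) + u)\<bar> \<le> CX"
    using X.dist_lower_line[OF assms, of x x'] X.dist_upper_line[of x g x' g'] X.C_nonneg assms by (simp add: u_def)
  have 2: "\<bar>dist (WY y (- g)) (WY y' (- g')) - ((g' - g) + v)\<bar> \<le> CY"
    using Y.dist_lower_line[of "- g'" "- g" y' y] Y.dist_upper_line[of y' "- g'" y "- g"] Y.C_nonneg assms
    by (simp add: v_def dist_commute)
  have "gap N (pt x y g) (pt x' y' g') \<le> N ((g' - g) + u, (g' - g) + v) + K * (CX + CY)"
    unfolding gap_def pt_simps by (rule N_error[OF 1 2])
  also have "N ((g' - g) + u, (g' - g) + v) \<le> N (g' - g, g' - g) + N (u, v)" by (rule N_add)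
  also have "N (u, v) \<le> N (u, 0) + N (0, v)" using N_add[of u 0 0 v] by simp
  finally show ?thesis using assms by (simp add: N_diag u_def v_def)
qed

lemma pt_self:
  assumes "p \<in> HP" shows "pt (fst p) (snd p) (hX (fst p)) = p"
proof -
  have "- hX (fst p) = hY (snd p)" using assms by (cases p) (auto simp: horo_product_def)
  then show ?thesis unfolding pt_def by simp
qed

text \<open>Only the middle leg of the broken path is nontrivial: it follows the line of
  \<open>p\<close> in \<open>X\<close> and the line of \<open>q\<close> in \<open>Y\<close>. Each
  jump changes a gap by at most \<open>2 * K * e\<close>, so \<open>\<kappa>\<close> is
  \<open>4 * K * e\<close> and 42 = 34 + 2 * 4.\<close>

lemma near_vertical:
  assumes p: "p \<in> HP" and q: "q \<in> HP"
    and eX: "dist (WX (fst p) (hX (fst q))) (fst q) \<le> e" and eY: "dist (WY (snd q) (hY (snd p))) (snd p) \<le> e"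
  shows "horo_dist N hX hY p q \<le> ereal (\<bar>hX (fst q) - hX (fst p)\<bar> + 42 * K * e)"
proof -
  define x y x' y' g g' where "x = fst p" and "y = snd p" and "x' = fst q" and "y' = snd q"
    and "g = hX (fst p)" and "g' = hX (fst q)"
  note d = x_def y_def x'_def y'_def g_def g'_def
  have pq: "pt x y g = p" "pt x' y' g' = q" using pt_self[OF p] pt_self[OF q] by (simp_all add: d)
  have hh: "- g = hY y" "- g' = hY y'" using p q by (auto simp: d horo_product_def)
  have e: "0 \<le> e" using eX zero_le_dist order_trans by blast
  have Ke: "0 \<le> K * e" using e K_ge by simp
  have cl1: "close (pt x y g) (pt x y' g) e"
    using eY e unfolding close_def pt_simps hh by (simp add: d dist_commute)
  have cl2: "close (pt x y' g') (pt x' y' g') e"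
    using eX e by (simp add: close_def d)
  have "horo_dist N hX hY (pt x y g) (pt x' y' g')
    \<le> ereal (\<bar>g - g\<bar> + \<bar>g' - g\<bar> + \<bar>g' - g'\<bar> + 2 * (4 * K * e) + 34 * K * e)"
  proof (rule broken_vertical[OF cl1 cl2])
    fix u v assume "u \<in> closed_segment g g"
    then have u: "u = g" by simp
    show "gap N (pt x y u) (pt x y' v) \<le> \<bar>g - u\<bar> + \<bar>v - g\<bar> + 4 * K * e"
      using close_gap(1)[OF cl1, of "pt x y' v"] gap_pt_same[of x y' g v] Ke u by simp
    assume "v \<in> closed_segment g' g'"
    then have v: "v = g'" by simp
    show "gap N (pt x y u) (pt x' y' v) \<le> \<bar>g - u\<bar> + \<bar>g' - g\<bar> + \<bar>v - g'\<bar> + 4 * K * e"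
      using close_gap(1)[OF cl1, of "pt x' y' g'"] close_gap(2)[OF close_sym[OF cl2], of "pt x y' g"]
        gap_pt_same[of x y' g g'] Ke u v by simp
  next
    fix u v assume "v \<in> closed_segment g' g'"
    then have v: "v = g'" by simp
    show "gap N (pt x y' u) (pt x' y' v) \<le> \<bar>g' - u\<bar> + \<bar>v - g'\<bar> + 4 * K * e"
      using close_gap(2)[OF close_sym[OF cl2], of "pt x y' u"] gap_pt_same[of x y' u g'] Ke v by simp
  qed (use Ke in \<open>simp add: mult.assoc\<close>)
  then show ?thesis unfolding pq by (simp add: d algebra_simps)
qed

section \<open>Geodesics between extreme heights are almost vertical\<close>

definition geo :: "(real \<Rightarrow> 'a \<times> 'b) \<Rightarrow> real \<Rightarrow> real \<Rightarrow> bool" where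
  "geo \<alpha> a b \<longleftrightarrow> a \<le> b \<and> horo_geodesic_on hX hY (horo_dist N hX hY) {a..b} \<alpha>"

abbreviation ht :: "'a \<times> 'b \<Rightarrow> real" where "ht p \<equiv> hX (fst p)"

lemma geo_sub: "geo \<alpha> a b \<Longrightarrow> a \<le> s \<Longrightarrow> s \<le> t \<Longrightarrow> t \<le> b \<Longrightarrow> geo \<alpha> s t"
  unfolding geo_def horo_geodesic_on_def by (auto simp: image_subset_iff)

lemma geo_reverse: "geo \<alpha> a b \<Longrightarrow> geo (\<lambda>t. \<alpha> (- t)) (- b) (- a)"
  unfolding geo_def horo_geodesic_on_def by (auto simp: image_subset_iff abs_minus_commute)

lemma geo_in: "geo \<alpha> a b \<Longrightarrow> s \<in> {a..b} \<Longrightarrow> \<alpha> s \<in> HP"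
  unfolding geo_def horo_geodesic_on_def by blast

lemma HP_height: "p \<in> HP \<Longrightarrow> hY (snd p) = - ht p"
  by (cases p) (auto simp: horo_product_def)

lemma geo_gap:
  assumes "geo \<alpha> a b" "s \<in> {a..b}" "t \<in> {a..b}"
  shows "gap N (\<alpha> s) (\<alpha> t) \<le> \<bar>s - t\<bar>"
proof -
  have "horo_dist N hX hY (\<alpha> s) (\<alpha> t) = ereal \<bar>s - t\<bar>"
    using assms unfolding geo_def horo_geodesic_on_def by blast
  then show ?thesis using horo_dist_ge_gap[of N "\<alpha> s" "\<alpha> t" hX hY] by simp
qed

lemma geo_upper:
  assumes "geo \<alpha> a b" "s \<in> {a..b}" "t \<in> {a..b}" "horo_dist N hX hY (\<alpha> s) (\<alpha> t) \<le> ereal r"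
  shows "\<bar>s - t\<bar> \<le> r"
  using assms unfolding geo_def horo_geodesic_on_def by auto

lemma geo_dist:
  assumes "geo \<alpha> a b" "s \<in> {a..b}" "t \<in> {a..b}"
  shows "dist (fst (\<alpha> s)) (fst (\<alpha> t)) + dist (snd (\<alpha> s)) (snd (\<alpha> t)) \<le> 2 * \<bar>s - t\<bar>"
  using geo_gap[OF assms] N_lower[of "dist (fst (\<alpha> s)) (fst (\<alpha> t))" "dist (snd (\<alpha> s)) (snd (\<alpha> t))"]
  by (simp add: gap_def)

lemma geo_heights:
  assumes "geo \<alpha> a b" "s \<in> {a..b}" "t \<in> {a..b}"
  shows "\<bar>ht (\<alpha> s) - ht (\<alpha> t)\<bar> \<le> dist (fst (\<alpha> s)) (fst (\<alpha> t))"
    "\<bar>ht (\<alpha> s) - ht (\<alpha> t)\<bar> \<le> dist (snd (\<alpha> s)) (snd (\<alpha> t))"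
    "\<bar>ht (\<alpha> s) - ht (\<alpha> t)\<bar> \<le> \<bar>s - t\<bar>"
proof -
  show 1: "\<bar>ht (\<alpha> s) - ht (\<alpha> t)\<bar> \<le> dist (fst (\<alpha> s)) (fst (\<alpha> t))" by (rule X.height_lipschitz)
  show 2: "\<bar>ht (\<alpha> s) - ht (\<alpha> t)\<bar> \<le> dist (snd (\<alpha> s)) (snd (\<alpha> t))"
    using Y.height_lipschitz[of "snd (\<alpha> s)" "snd (\<alpha> t)"] HP_height[OF geo_in[OF assms(1,2)]]
      HP_height[OF geo_in[OF assms(1,3)]] by simp
  show "\<bar>ht (\<alpha> s) - ht (\<alpha> t)\<bar> \<le> \<bar>s - t\<bar>"
    using add_mono[OF 1 2] geo_dist[OF assms] by simp
qed

lemma geo_ht_continuous: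
  assumes "geo \<alpha> a b" shows "continuous_on {a..b} (\<lambda>u. ht (\<alpha> u))"
  unfolding continuous_on_iff
proof (intro ballI allI impI)
  fix x e :: real assume "x \<in> {a..b}" "0 < e"
  then show "\<exists>d>0. \<forall>x'\<in>{a..b}. dist x' x < d \<longrightarrow> dist (ht (\<alpha> x')) (ht (\<alpha> x)) < e"
    using geo_heights(3)[OF assms] by (intro exI[of _ e]) (force simp: dist_real_def)
qed

text \<open>The slack \<open>k\<close> allows the end points to miss the extreme heights; it is
  needed for the outer pieces of a geodesic, which are extremal only up to a bounded error.\<close>

lemma geo_almost_vertical:
  shows "\<exists>M\<ge>0. \<forall>\<alpha> a b c c' k. geo \<alpha> a b \<longrightarrow> 0 \<le> k \<longrightarrow>
    (\<forall>u\<in>{a..b}. c' \<le> ht (\<alpha> u) \<and> ht (\<alpha> u) \<le> c) \<longrightarrow>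
    ht (\<alpha> a) \<le> c' + k \<longrightarrow> c - k \<le> ht (\<alpha> b) \<longrightarrow> b - a \<le> ht (\<alpha> b) - ht (\<alpha> a) + M * (1 + k)"
proof -
  \<comment> \<open>\<open>near_vertical\<close> charges \<open>42 * K\<close> per unit of
    \<open>e\<close>, and the two climbing estimates are added against twice the duration. The
    excess of \<open>L\<close> over \<open>84 * K\<close> is what bounds
    \<open>m + n\<close>.\<close>
  define L where "L = 84 * K + 1"
  have L: "1 \<le> L" using K_ge by (simp add: L_def)
  obtain BX where BX: "0 \<le> BX" "\<forall>(f :: real \<Rightarrow> 'a) a b c k.
    (\<forall>u\<in>{a..b}. \<forall>v\<in>{a..b}. dist (f u) (f v) + \<bar>hX (f u) - hX (f v)\<bar> \<le> 2 * \<bar>u - v\<bar>) \<longrightarrow>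
    (\<forall>u\<in>{a..b}. hX (f u) \<le> c) \<longrightarrow> a \<le> b \<longrightarrow> 0 \<le> k \<longrightarrow> c - k \<le> hX (f b) \<longrightarrow>
    (c - hX (f a)) + L * dist (WX (f a) c) (WX (f b) c) \<le> (b - a) + k + BX"
    using X.climb_estimate[OF L] by blast
  obtain BY where BY: "0 \<le> BY" "\<forall>(f :: real \<Rightarrow> 'b) a b c k.
    (\<forall>u\<in>{a..b}. \<forall>v\<in>{a..b}. dist (f u) (f v) + \<bar>hY (f u) - hY (f v)\<bar> \<le> 2 * \<bar>u - v\<bar>) \<longrightarrow>
    (\<forall>u\<in>{a..b}. hY (f u) \<le> c) \<longrightarrow> a \<le> b \<longrightarrow> 0 \<le> k \<longrightarrow> c - k \<le> hY (f b) \<longrightarrow>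
    (c - hY (f a)) + L * dist (WY (f a) c) (WY (f b) c) \<le> (b - a) + k + BY"
    using Y.climb_estimate[OF L] by blast
  define M where "M = 2 + 42 * K * (10 + 336 * K) + 42 * K * (BX + BY)"
  have KB: "0 \<le> K * (BX + BY)" "0 \<le> K * K" "0 \<le> K" using K_ge BX BY by auto
  have M: "0 \<le> M" unfolding M_def using KB BX BY by (intro add_nonneg_nonneg mult_nonneg_nonneg) auto
  show ?thesis
  proof (intro exI[of _ M] conjI allI impI M)
    fix \<alpha> a b c c' k
    assume g: "geo \<alpha> a b" and k: "0 \<le> k" and rng': "\<forall>u\<in>{a..b}. c' \<le> ht (\<alpha> u) \<and> ht (\<alpha> u) \<le> c"
      and lo: "ht (\<alpha> a) \<le> c' + k" and hi: "c - k \<le> ht (\<alpha> b)"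
    have ab: "a \<le> b" using g by (simp add: geo_def)
    have rng: "c' \<le> ht (\<alpha> u) \<and> ht (\<alpha> u) \<le> c" if "u \<in> {a..b}" for u using rng' that by blast
    note hY = HP_height[OF geo_in[OF g]]
    define m where "m = dist (WX (fst (\<alpha> a)) c) (WX (fst (\<alpha> b)) c)"
    define n where "n = dist (WY (snd (\<alpha> b)) (- c')) (WY (snd (\<alpha> a)) (- c'))"
    have 1: "(c - ht (\<alpha> a)) + L * m \<le> (b - a) + k + BX"
      unfolding m_def
    proof (rule BX(2)[rule_format, where f = "\<lambda>u. fst (\<alpha> u)" and k = k])
      fix u v assume "u \<in> {a..b}" "v \<in> {a..b}"
      then show "dist (fst (\<alpha> u)) (fst (\<alpha> v)) + \<bar>ht (\<alpha> u) - ht (\<alpha> v)\<bar> \<le> 2 * \<bar>u - v\<bar>"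
        using geo_dist[OF g, of u v] geo_heights(2)[OF g, of u v] by linarith
    qed (use rng ab k hi in auto)
    have 2: "(- c' + ht (\<alpha> b)) + L * n \<le> (b - a) + k + BY"
    proof -
      \<comment> \<open>The lowest point of the geodesic is the highest one in \<open>Y\<close>, so
        there the climb is run backwards in time.\<close>
      have "(- c' - hY (snd (\<alpha> (- (- b))))) + L * dist (WY (snd (\<alpha> (- (- b)))) (- c')) (WY (snd (\<alpha> (- (- a)))) (- c'))
        \<le> (- a - (- b)) + k + BY"
      proof (rule BY(2)[rule_format, where f = "\<lambda>t. snd (\<alpha> (- t))" and k = k])
        fix u v :: real assume "u \<in> {- b..- a}" "v \<in> {- b..- a}"
        then have uv: "- u \<in> {a..b}" "- v \<in> {a..b}" by auto
        have "\<bar>- u - - v\<bar> = \<bar>u - v\<bar>" by linarith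
        then show "dist (snd (\<alpha> (- u))) (snd (\<alpha> (- v))) + \<bar>hY (snd (\<alpha> (- u))) - hY (snd (\<alpha> (- v)))\<bar> \<le> 2 * \<bar>u - v\<bar>"
          using geo_dist[OF g uv] geo_heights(1)[OF g uv] hY[OF uv(1)] hY[OF uv(2)] by (smt (verit))
      next
        fix u assume "u \<in> {- b..- a}"
        then have u: "- u \<in> {a..b}" by auto
        show "hY (snd (\<alpha> (- u))) \<le> - c'" using rng[OF u] hY[OF u] by simp
      qed (use ab k lo hY[of a] in auto)
      then show ?thesis using hY[of b] ab by (simp add: n_def)
    qed
    define e where "e = m + n + 2 * k"
    have mn: "0 \<le> m" "0 \<le> n" by (auto simp: m_def n_def)
    have eX: "dist (WX (fst (\<alpha> a)) (ht (\<alpha> b))) (fst (\<alpha> b)) \<le> e"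
      using X.line_shift[of "fst (\<alpha> a)" "ht (\<alpha> b)" "fst (\<alpha> b)" c] rng[of b] hi ab mn
      by (simp add: m_def[symmetric] e_def)
    have "WY (snd (\<alpha> a)) (- ht (\<alpha> a)) = snd (\<alpha> a)"
      using Y.line_base[of "snd (\<alpha> a)"] hY[of a] ab by simp
    then have eY: "dist (WY (snd (\<alpha> b)) (hY (snd (\<alpha> a)))) (snd (\<alpha> a)) \<le> e"
      using Y.line_shift[of "snd (\<alpha> b)" "hY (snd (\<alpha> a))" "snd (\<alpha> a)" "- c'"] rng[of a] hY[of a] lo ab mn
      by (simp add: n_def[symmetric] e_def)
    have "\<bar>a - b\<bar> \<le> \<bar>ht (\<alpha> b) - ht (\<alpha> a)\<bar> + 42 * K * e"
      by (rule geo_upper[OF g]) (use ab near_vertical[OF _ _ eX eY] geo_in[OF g] in auto)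
    moreover have "\<bar>ht (\<alpha> b) - ht (\<alpha> a)\<bar> \<le> ht (\<alpha> b) - ht (\<alpha> a) + 2 * k"
      using lo rng[of b] ab k by auto
    ultimately have 3: "b - a \<le> ht (\<alpha> b) - ht (\<alpha> a) + 2 * k + 42 * K * e" using ab by linarith
    \<comment> \<open>The sum of both climbs meets twice the upper bound \<open>3\<close>: the
      height differences cancel and a linear inequality for \<open>m + n\<close> remains.\<close>
    have "2 * (ht (\<alpha> b) - ht (\<alpha> a)) + L * m + L * n \<le> 2 * (b - a) + 2 * k + (BX + BY)"
      using 1 2 rng[of a] rng[of b] ab by auto
    then have "L * m + L * n \<le> 6 * k + 84 * K * e + (BX + BY)" using 3 by (simp add: algebra_simps)
    then have mnb: "m + n \<le> 6 * k + 168 * (K * k) + (BX + BY)"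
      by (simp add: L_def e_def algebra_simps)
    then have "e \<le> (8 + 168 * K) * k + (BX + BY)" by (simp add: e_def algebra_simps)
    then have "42 * K * e \<le> 42 * K * ((8 + 168 * K) * k + (BX + BY))" using K_ge by (intro mult_left_mono) auto
    also have "\<dots> \<le> (M - 2) * (1 + k)"
    proof -
      have "(M - 2) * (1 + k) - 42 * K * ((8 + 168 * K) * k + (BX + BY))
        = 84 * (K * k) + 420 * K + 42 * (K * (BX + BY) * k) + 14112 * (K * K) + 7056 * (K * K * k)"
        unfolding M_def by (simp add: algebra_simps)
      moreover have "0 \<le> K * k" "0 \<le> K * (BX + BY) * k" "0 \<le> K * K * k" using K_ge k KB by auto
      ultimately show ?thesis using KB by linarith
    qed
    finally have "42 * K * e \<le> (M - 2) * (1 + k)" .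
    then have "2 * k + 42 * K * e \<le> M * (1 + k)" by (simp add: algebra_simps)
    then show "b - a \<le> ht (\<alpha> b) - ht (\<alpha> a) + M * (1 + k)" using 3 by linarith
  qed
qed

end

section \<open>Zigzags of geodesics\<close>

lemma first_time_at_level:
  fixes f :: "real \<Rightarrow> real"
  assumes f: "continuous_on {u..v} f" and uv: "u \<le> v" "f u \<le> c" "c \<le> f v"
  shows "\<exists>t\<in>{u..v}. f t = c \<and> (\<forall>r\<in>{u..t}. f r \<le> c)"
proof -
  define S where "S = {r \<in> {u..v}. c \<le> f r}"
  have "closed S" unfolding S_def by (intro continuous_on_closed_Collect_le f continuous_intros closed_atLeastAtMost)
  moreover have "S \<noteq> {}" using uv by (auto simp: S_def)
  moreover have bdd: "bdd_below S" by (auto simp: S_def intro: bdd_belowI[of _ u])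
  ultimately have "Inf S \<in> S" by (intro closed_contains_Inf)
  define t where "t = Inf S"
  have t: "t \<in> {u..v}" "c \<le> f t" using \<open>Inf S \<in> S\<close> by (auto simp: t_def S_def)
  have before: "f r < c" if "r \<in> {u..v}" "r < t" for r
    using cInf_lower[OF _ bdd, of r] that by (force simp: t_def S_def)
  have "f t = c"
  proof (rule ccontr)
    assume "f t \<noteq> c"
    have "continuous_on {u..t} f" using f t by (auto elim: continuous_on_subset)
    then obtain r where "u \<le> r" "r \<le> t" "f r = c" using IVT'[of f u c t] uv t by auto
    then show False using before[of r] t \<open>f t \<noteq> c\<close> by (cases "r = t") auto
  qed
  then show ?thesis using t before by (intro bexI[of _ t]) (force simp: le_less)+
qed

lemma last_time_at_level:
  fixes f :: "real \<Rightarrow> real"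
  assumes f: "continuous_on {u..v} f" and uv: "u \<le> v" "f u \<le> c" "c \<le> f v"
  shows "\<exists>t\<in>{u..v}. f t = c \<and> (\<forall>r\<in>{t..v}. c \<le> f r)"
proof -
  have "continuous_on {- v..- u} (\<lambda>t. - f (- t))"
    by (intro continuous_intros continuous_on_compose2[OF f]) auto
  from first_time_at_level[OF this, of "- c"] uv obtain t where
    t: "t \<in> {- v..- u}" "f (- t) = c" "\<forall>r\<in>{- v..t}. c \<le> f (- r)" by auto
  have "c \<le> f r" if "r \<in> {- t..v}" for r using t(3)[rule_format, of "- r"] that by auto
  then show ?thesis using t by (intro bexI[of _ "- t"]) auto
qed

context horo_pair
begin

lemma horo_pair_swap: "horo_pair hY WY CY hX WX CX (N \<circ> prod.swap)"
  by (intro horo_pair.intro X.height_space_axioms Y.height_space_axioms admissible_swap)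

lemma geo_swap: "geo \<alpha> a b \<Longrightarrow> horo_pair.geo hY hX (N \<circ> prod.swap) (prod.swap \<circ> \<alpha>) a b"
  unfolding geo_def horo_pair.geo_def[OF horo_pair_swap] horo_geodesic_on_def
  by (auto simp: horo_dist_swap horo_product_swap image_subset_iff)

text \<open>The complementary piece takes at least as much time as its height change, so no piece
  wastes more time than the whole.\<close>

lemma geo_cut:
  assumes g: "geo \<alpha> a b" and ab: "b - a \<le> \<bar>ht (\<alpha> a) - ht (\<alpha> b)\<bar> + w" and t: "t \<in> {a..b}"
  shows "t - a \<le> \<bar>ht (\<alpha> a) - ht (\<alpha> t)\<bar> + w" "b - t \<le> \<bar>ht (\<alpha> t) - ht (\<alpha> b)\<bar> + w"
  using geo_heights(3)[OF g, of t b] geo_heights(3)[OF g, of a t] ab t by auto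

text \<open>Both coordinate distances sum to at most twice the time, and the one in \<open>Y\<close>
  uses up at least the height difference. What is left in \<open>X\<close> exceeds the height
  difference by at most \<open>2 * w\<close>, and \<open>dist_lower\<close> turns this excess into
  horizontal closeness.\<close>

lemma geo_close_X:
  assumes g: "geo \<alpha> a b" and st: "s \<in> {a..b}" "t \<in> {a..b}" and w: "\<bar>s - t\<bar> \<le> ht (\<alpha> t) - ht (\<alpha> s) + w"
    and "ht (\<alpha> s) \<le> ht (\<alpha> t)"
  shows "dist (WX (fst (\<alpha> s)) (ht (\<alpha> t))) (fst (\<alpha> t)) \<le> 2 * w + CX"
  using geo_dist[OF g st] geo_heights(2)[OF g st] X.dist_lower[OF assms(5)] w assms(5) by auto

lemma geo_close_Y:
  assumes g: "geo \<alpha> a b" and st: "s \<in> {a..b}" "t \<in> {a..b}" and w: "\<bar>s - t\<bar> \<le> ht (\<alpha> s) - ht (\<alpha> t) + w"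
    and "ht (\<alpha> t) \<le> ht (\<alpha> s)"
  shows "dist (WY (snd (\<alpha> s)) (- ht (\<alpha> t))) (snd (\<alpha> t)) \<le> 2 * w + CY"
  using geo_dist[OF g st] geo_heights(1)[OF g st] Y.dist_lower[of "snd (\<alpha> s)" "snd (\<alpha> t)"] w assms(5)
    HP_height[OF geo_in[OF g st(1)]] HP_height[OF geo_in[OF g st(2)]] by auto

text \<open>The geodesic goes up to \<open>\<alpha> v\<close>, down to \<open>\<alpha> u\<close> and up again. It competes with the
  path that goes down from \<open>\<alpha> s\<close> to the height of \<open>\<alpha> u\<close>, up to the height of \<open>\<alpha> v\<close>
  and down to \<open>\<alpha> t\<close>. The gaps along this path are controlled by the gaps along the geodesic, so
  that no comparison between values of \<open>N\<close> is needed.\<close>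

lemma geo_zigzag:
  "\<exists>C\<ge>0. \<forall>\<alpha> s v u t. geo \<alpha> s t \<longrightarrow> s \<le> v \<longrightarrow> v \<le> u \<longrightarrow> u \<le> t \<longrightarrow>
    (\<forall>r\<in>{s..t}. ht (\<alpha> u) \<le> ht (\<alpha> r) \<and> ht (\<alpha> r) \<le> ht (\<alpha> v)) \<longrightarrow>
    (\<forall>r\<in>{s..v}. ht (\<alpha> s) \<le> ht (\<alpha> r)) \<longrightarrow> (\<forall>r\<in>{u..t}. ht (\<alpha> r) \<le> ht (\<alpha> t)) \<longrightarrow>
    ht (\<alpha> t) \<le> ht (\<alpha> s) + C"
proof -
  obtain w where w: "0 \<le> w" and av: "\<forall>\<alpha> a b c c' k. geo \<alpha> a b \<longrightarrow> 0 \<le> k \<longrightarrow>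
    (\<forall>u\<in>{a..b}. c' \<le> ht (\<alpha> u) \<and> ht (\<alpha> u) \<le> c) \<longrightarrow>
    ht (\<alpha> a) \<le> c' + k \<longrightarrow> c - k \<le> ht (\<alpha> b) \<longrightarrow> b - a \<le> ht (\<alpha> b) - ht (\<alpha> a) + w * (1 + k)"
    using geo_almost_vertical by blast
  \<comment> \<open>\<open>c1\<close> is the closeness of each leg to its lines. In
    \<open>\<kappa>0\<close> the 5 collects coordinate errors \<open>2 * c1\<close> and
    \<open>3 * c1\<close>. The outer legs of the detour see a horizontal error in both factors,
    hence \<open>2 * \<kappa>0\<close> in \<open>\<kappa>\<close>.\<close>
  define c1 where "c1 = 2 * w + CX + CY"
  define \<kappa>0 where "\<kappa>0 = 2 * w + 5 * K * c1"
  define \<kappa> where "\<kappa> = 2 * \<kappa>0 + K * (CX + CY)"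
  have c1: "0 \<le> c1" using w X.C_nonneg Y.C_nonneg by (simp add: c1_def)
  then have Kc: "0 \<le> K * c1" using K_ge by simp
  have KC: "0 \<le> K * (CX + CY)" using K_ge X.C_nonneg Y.C_nonneg by simp
  have \<kappa>0: "0 \<le> \<kappa>0" using w Kc by (simp add: \<kappa>0_def)
  then have \<kappa>: "0 \<le> \<kappa>" using KC by (simp add: \<kappa>_def)
  have C: "0 \<le> \<kappa> + 51 * K * c1" using \<kappa> Kc by simp
  show ?thesis
  proof (intro exI[of _ "\<kappa> + 51 * K * c1"] conjI C allI impI)
    fix \<alpha> s v u t
    assume g: "geo \<alpha> s t" and o: "s \<le> v" "v \<le> u" "u \<le> t"
      and rng: "\<forall>r\<in>{s..t}. ht (\<alpha> u) \<le> ht (\<alpha> r) \<and> ht (\<alpha> r) \<le> ht (\<alpha> v)"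
      and first: "\<forall>r\<in>{s..v}. ht (\<alpha> s) \<le> ht (\<alpha> r)" and last: "\<forall>r\<in>{u..t}. ht (\<alpha> r) \<le> ht (\<alpha> t)"
    define H L where "H = ht (\<alpha> v)" and "L = ht (\<alpha> u)"
    define xs xu xt ys yv yt where "xs = fst (\<alpha> s)" and "xu = fst (\<alpha> u)" and "xt = fst (\<alpha> t)"
      and "ys = snd (\<alpha> s)" and "yv = snd (\<alpha> v)" and "yt = snd (\<alpha> t)"
    define hs where "hs = ht (\<alpha> s)"
    define h't where "h't = ht (\<alpha> t)"
    note d = H_def L_def xs_def xu_def xt_def ys_def yv_def yt_def hs_def h't_def
    have lev: "L \<le> hs" "hs \<le> H" "L \<le> h't" "h't \<le> H" using rng o by (auto simp: d)
    show "ht (\<alpha> t) \<le> ht (\<alpha> s) + (\<kappa> + 51 * K * c1)"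
    proof (cases "h't \<le> hs")
      case True
      then show ?thesis using C by (simp add: d)
    next
      case False
      then have st: "hs \<le> h't" by simp
      have g1: "geo \<alpha> s v" and g2: "geo \<alpha> v u" and g3: "geo \<alpha> u t" using geo_sub[OF g] o by auto
      have t1: "v - s \<le> H - hs + w"
        using av[rule_format, OF g1, of 0 hs H] first rng o by (auto simp: d)
      have t2: "u - v \<le> H - L + w"
        using av[rule_format, OF geo_reverse[OF g2], of 0 L H] rng o by (auto simp: d)
      have t3: "t - u \<le> h't - L + w"
        using av[rule_format, OF g3, of 0 L h't] last rng o by (auto simp: d)
      have cut1: "r - s \<le> ht (\<alpha> r) - hs + w" "v - r \<le> H - ht (\<alpha> r) + w" if "r \<in> {s..v}" for r
        using geo_cut[OF g1 _ that, of w] t1 first rng o that by (auto simp: d)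
      have cut2: "r - v \<le> H - ht (\<alpha> r) + w" "u - r \<le> ht (\<alpha> r) - L + w" if "r \<in> {v..u}" for r
        using geo_cut[OF g2 _ that, of w] t2 rng o that by (auto simp: d)
      have cut3: "r - u \<le> ht (\<alpha> r) - L + w" "t - r \<le> h't - ht (\<alpha> r) + w" if "r \<in> {u..t}" for r
        using geo_cut[OF g3 _ that, of w] t3 last rng o that by (auto simp: d)
      have X1: "dist (WX xs (ht (\<alpha> r))) (fst (\<alpha> r)) \<le> c1" and Y1: "dist (WY yv (- ht (\<alpha> r))) (snd (\<alpha> r)) \<le> c1"
        if r: "r \<in> {s..v}" for r
        using geo_close_X[OF g, of s r w] geo_close_Y[OF g, of v r w] cut1[OF r] first rng r o X.C_nonneg Y.C_nonneg
        by (auto simp: d c1_def)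
      have X2: "dist (WX xu (ht (\<alpha> r))) (fst (\<alpha> r)) \<le> c1" and Y2: "dist (WY yv (- ht (\<alpha> r))) (snd (\<alpha> r)) \<le> c1"
        if r: "r \<in> {v..u}" for r
        using geo_close_X[OF g, of u r w] geo_close_Y[OF g, of v r w] cut2[OF r] rng r o X.C_nonneg Y.C_nonneg
        by (auto simp: d c1_def)
      have X3: "dist (WX xu (ht (\<alpha> r))) (fst (\<alpha> r)) \<le> c1" and Y3: "dist (WY yt (- ht (\<alpha> r))) (snd (\<alpha> r)) \<le> c1"
        if r: "r \<in> {u..t}" for r
        using geo_close_X[OF g, of u r w] geo_close_Y[OF g, of t r w] cut3[OF r] last rng r o X.C_nonneg Y.C_nonneg
        by (auto simp: d c1_def)
      have base: "WX xt h't = xt" "WY ys (- hs) = ys" "WX xs hs = xs" "WY yt (- h't) = yt"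
        using pt_self[OF geo_in[OF g, of t]] pt_self[OF geo_in[OF g, of s]] o by (auto simp: d pt_def prod_eq_iff)
      have ut: "dist (WX xu c) (WX xt c) \<le> c1" if "h't \<le> c" for c
        using X.line_antimono[OF that, of xu xt] X3[of t] o base by (auto simp: d)
      have vs: "dist (WY yv (- c)) (WY ys (- c)) \<le> c1" if "c \<le> hs" for c
        using Y.line_antimono[of "- hs" "- c" yv ys] Y1[of s] o base that by (auto simp: d)
      \<comment> \<open>At height \<open>H\<close> the geodesic is near the line of
        \<open>xs\<close> and near that of \<open>xu\<close>, and the latter has joined the line of
        \<open>xt\<close> by height \<open>h't\<close>. So the detour may change lines at
        \<open>H\<close>, and dually at \<open>L\<close>, at bounded cost.\<close>
      have xH: "dist (WX xs H) (WX xt H) \<le> 3 * c1"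
        using X1[of v] X2[of v] ut[of H] lev o dist_triangle[of "WX xs H" "WX xt H" "WX xu H"]
          dist_triangle2[of "WX xs H" "WX xu H" "fst (\<alpha> v)"] by (auto simp: H_def)
      have yL: "dist (WY ys (- L)) (WY yt (- L)) \<le> 3 * c1"
        using Y2[of u] Y3[of u] vs[of L] lev o dist_triangle[of "WY ys (- L)" "WY yt (- L)" "WY yv (- L)"]
          dist_triangle2[of "WY yv (- L)" "WY yt (- L)" "snd (\<alpha> u)"] by (auto simp: L_def dist_commute)
      have cont: "continuous_on {p..q} (\<lambda>r. ht (\<alpha> r))" if "s \<le> p" "q \<le> t" for p q
        by (rule continuous_on_subset[OF geo_ht_continuous[OF g]]) (use that in auto)
      have at1: "\<exists>r\<in>{s..v}. ht (\<alpha> r) = c" if "hs \<le> c" "c \<le> H" for c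
        using IVT'[of "\<lambda>r. ht (\<alpha> r)" s c v] cont[of s v] that o by (auto simp: d)
      have at2: "\<exists>r\<in>{v..u}. ht (\<alpha> r) = c" if "L \<le> c" "c \<le> H" for c
        using IVT2'[of "\<lambda>r. ht (\<alpha> r)" u c v] cont[of v u] that o by (auto simp: d)
      have at3: "\<exists>r\<in>{u..t}. ht (\<alpha> r) = c" if "L \<le> c" "c \<le> h't" for c
        using IVT'[of "\<lambda>r. ht (\<alpha> r)" u c t] cont[of u t] that o by (auto simp: d)
      have quad: "\<bar>dist p q - dist p' q'\<bar> \<le> dist p p' + dist q q'" for p q p' q' :: "'c::metric_space"
        using dist_triangle[of p q p'] dist_triangle[of p' q q'] dist_triangle[of p' q' p] dist_triangle[of p q' q]
        by (simp add: dist_commute abs_le_iff)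
      \<comment> \<open>The geodesic passes height \<open>c\<close> on its second and on its third
        leg, both times near the line of \<open>xu\<close>. The gap between these two points is thus
        nearly \<open>N (0, _)\<close> of the \<open>Y\<close>-distance in question, and it is at
        most the time in between, which is about \<open>2 * (c - L)\<close>.\<close>
      have Yc: "N (0, dist (WY ys (- c)) (WY yt (- c))) \<le> 2 * (c - L) + \<kappa>0" if c: "L \<le> c" "c \<le> hs" for c
      proof -
        obtain r r' where r: "r \<in> {v..u}" "ht (\<alpha> r) = c" and r': "r' \<in> {u..t}" "ht (\<alpha> r') = c"
          using at2[of c] at3[of c] c lev st by auto
        have "N (0, dist (WY ys (- c)) (WY yt (- c))) \<le> gap N (\<alpha> r) (\<alpha> r') + K * (2 * c1 + 3 * c1)"
          unfolding gap_def
        proof (rule N_error)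
          show "\<bar>0 - dist (fst (\<alpha> r)) (fst (\<alpha> r'))\<bar> \<le> 2 * c1"
            using X2[OF r(1)] X3[OF r'(1)] r r' dist_triangle3[of "fst (\<alpha> r)" "fst (\<alpha> r')" "WX xu c"] by auto
          have "dist (WY ys (- c)) (snd (\<alpha> r)) \<le> 2 * c1"
            using Y2[OF r(1)] vs[OF c(2)] r dist_triangle3[of "WY ys (- c)" "snd (\<alpha> r)" "WY yv (- c)"] by auto
          then show "\<bar>dist (WY ys (- c)) (WY yt (- c)) - dist (snd (\<alpha> r)) (snd (\<alpha> r'))\<bar> \<le> 3 * c1"
            using quad[of "WY ys (- c)" "WY yt (- c)" "snd (\<alpha> r)" "snd (\<alpha> r')"] Y3[OF r'(1)] r' by auto
        qed
        also have "gap N (\<alpha> r) (\<alpha> r') \<le> (r' - u) + (u - r)" using geo_gap[OF g, of r r'] r r' o by auto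
        also have "\<dots> \<le> 2 * (c - L) + 2 * w" using cut2(2)[OF r(1)] cut3(1)[OF r'(1)] r r' by simp
        finally show ?thesis by (simp add: \<kappa>0_def algebra_simps)
      qed
      have Xc: "N (dist (WX xs c) (WX xt c), 0) \<le> 2 * (H - c) + \<kappa>0" if c: "h't \<le> c" "c \<le> H" for c
      proof -
        obtain r r' where r: "r \<in> {s..v}" "ht (\<alpha> r) = c" and r': "r' \<in> {v..u}" "ht (\<alpha> r') = c"
          using at1[of c] at2[of c] c lev st by auto
        have "N (dist (WX xs c) (WX xt c), 0) \<le> gap N (\<alpha> r) (\<alpha> r') + K * (3 * c1 + 2 * c1)"
          unfolding gap_def
        proof (rule N_error)
          show "\<bar>0 - dist (snd (\<alpha> r)) (snd (\<alpha> r'))\<bar> \<le> 2 * c1"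
            using Y1[OF r(1)] Y2[OF r'(1)] r r' dist_triangle3[of "snd (\<alpha> r)" "snd (\<alpha> r')" "WY yv (- c)"] by auto
          have "dist (WX xt c) (fst (\<alpha> r')) \<le> 2 * c1"
            using X2[OF r'(1)] ut[OF c(1)] r' dist_triangle3[of "WX xt c" "fst (\<alpha> r')" "WX xu c"] by auto
          then show "\<bar>dist (WX xs c) (WX xt c) - dist (fst (\<alpha> r)) (fst (\<alpha> r'))\<bar> \<le> 3 * c1"
            using quad[of "WX xs c" "WX xt c" "fst (\<alpha> r)" "fst (\<alpha> r')"] X1[OF r(1)] r by auto
        qed
        also have "gap N (\<alpha> r) (\<alpha> r') \<le> (r' - v) + (v - r)" using geo_gap[OF g, of r r'] r r' o by auto
        also have "\<dots> \<le> 2 * (H - c) + 2 * w" using cut1(2)[OF r(1)] cut2(1)[OF r'(1)] r r' by simp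
        finally show ?thesis by (simp add: \<kappa>0_def algebra_simps)
      qed
      have N0: "N (0, 0) = 0" using N_diag[of 0] by simp
      have cl1: "close (pt xs ys L) (pt xs yt L) (3 * c1)" using yL c1 by (simp add: close_def)
      have cl2: "close (pt xs yt H) (pt xt yt H) (3 * c1)" using xH c1 by (simp add: close_def)
      \<comment> \<open>By \<open>gap_pt\<close> two points of the detour differ by a vertical part
        and horizontal parts. The terms \<open>2 * (c - L)\<close> and \<open>2 * (H - c)\<close>
        are the vertical ways from height \<open>c\<close> to a turning point and back, so the gap
        stays within the length of the detour between them.\<close>
      have dist_le: "horo_dist N hX hY (pt xs ys hs) (pt xt yt h't)
        \<le> ereal (\<bar>L - hs\<bar> + \<bar>H - L\<bar> + \<bar>h't - H\<bar> + 2 * \<kappa> + 34 * K * (3 * c1))"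
      proof (rule broken_vertical[OF cl1 cl2 \<kappa>])
        fix p q assume p: "p \<in> closed_segment hs L" 
        then have p: "L \<le> p" "p \<le> hs" using lev by (auto simp: closed_segment_eq_real_ivl split: if_splits)
        {
          assume "q \<in> closed_segment L H"
          then have q: "L \<le> q" "q \<le> H" using lev by (auto simp: closed_segment_eq_real_ivl split: if_splits)
          show "gap N (pt xs ys p) (pt xs yt q) \<le> \<bar>L - p\<bar> + \<bar>q - L\<bar> + \<kappa>"
          proof (cases "p \<le> q")
            case True
            then show ?thesis using gap_pt[OF True, of xs ys xs yt] Yc[OF p] p q N0 \<kappa>0 by (simp add: \<kappa>_def)
          next
            case False
            then show ?thesis
              using gap_pt[of q p xs yt xs ys] Yc[of q] p q N0 \<kappa>0 by (simp add: \<kappa>_def gap_commute dist_commute)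
          qed
        next
          assume "q \<in> closed_segment H h't"
          then have q: "h't \<le> q" "q \<le> H" using lev by (auto simp: closed_segment_eq_real_ivl split: if_splits)
          then have "p \<le> q" using p st by simp
          then show "gap N (pt xs ys p) (pt xt yt q) \<le> \<bar>L - p\<bar> + \<bar>H - L\<bar> + \<bar>q - H\<bar> + \<kappa>"
            using gap_pt[of p q xs ys xt yt] Yc[OF p] Xc[OF q] p q \<kappa>0 by (simp add: \<kappa>_def)
        }
      next
        fix p q assume "p \<in> closed_segment L H" "q \<in> closed_segment H h't"
        then have p: "L \<le> p" "p \<le> H" and q: "h't \<le> q" "q \<le> H"
          using lev by (auto simp: closed_segment_eq_real_ivl split: if_splits)
        show "gap N (pt xs yt p) (pt xt yt q) \<le> \<bar>H - p\<bar> + \<bar>q - H\<bar> + \<kappa>"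
        proof (cases "p \<le> q")
          case True
          then show ?thesis using gap_pt[OF True, of xs yt xt yt] Xc[OF q] p q N0 \<kappa>0 by (simp add: \<kappa>_def)
        next
          case False
          then show ?thesis
            using gap_pt[of q p xt yt xs yt] Xc[of p] p q N0 \<kappa>0 by (simp add: \<kappa>_def gap_commute dist_commute)
        qed
      qed
      have "pt xs ys hs = \<alpha> s" "pt xt yt h't = \<alpha> t" using pt_self geo_in[OF g] o by (auto simp: d)
      then have "\<bar>s - t\<bar> \<le> \<bar>L - hs\<bar> + \<bar>H - L\<bar> + \<bar>h't - H\<bar> + 2 * \<kappa> + 34 * K * (3 * c1)"
        using geo_upper[OF g, of s t] dist_le o by auto
      \<comment> \<open>The geodesic exceeds the vertical length of the detour by
        \<open>2 * (h't - hs)\<close>. Halving gives the constant: 102 is \<open>34 * 3\<close> with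
        jumps of size \<open>3 * c1\<close>.\<close>
      then have "t - s \<le> (hs - L) + (H - L) + (H - h't) + 2 * \<kappa> + 102 * K * c1" using lev o by (simp add: algebra_simps)
      moreover have "H - hs \<le> v - s" "H - L \<le> u - v" "h't - L \<le> t - u"
        using geo_heights(3)[OF g, of s v] geo_heights(3)[OF g, of v u] geo_heights(3)[OF g, of u t] o lev
        by (auto simp: d)
      ultimately have "h't \<le> hs + (\<kappa> + 51 * K * c1)" by (simp add: algebra_simps)
      then show ?thesis by (simp add: d)
    qed
  qed
qed

text \<open>Each outer piece, completed by a part of the middle piece that reaches the same level,
  is a zigzag. So the first piece cannot rise much above its start and the last one cannot sink much
  below its end; both are then almost vertical with slack \<open>C1\<close>.\<close>

lemma geo_shape:
  "\<exists>C\<ge>0. \<forall>\<alpha> a u v b. geo \<alpha> a b \<longrightarrow> a \<le> u \<longrightarrow> u \<le> v \<longrightarrow> v \<le> b \<longrightarrow>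
    (\<forall>r\<in>{a..b}. ht (\<alpha> u) \<le> ht (\<alpha> r) \<and> ht (\<alpha> r) \<le> ht (\<alpha> v)) \<longrightarrow>
    ht (\<alpha> a) \<le> ht (\<alpha> b) + C \<and> u - a \<le> ht (\<alpha> a) - ht (\<alpha> u) + C \<and>
    v - u \<le> ht (\<alpha> v) - ht (\<alpha> u) + C \<and> b - v \<le> ht (\<alpha> v) - ht (\<alpha> b) + C"
proof -
  interpret S: horo_pair hY WY CY hX WX CX "N \<circ> prod.swap" by (rule horo_pair_swap)
  obtain w where w: "0 \<le> w" and av: "\<forall>\<alpha> a b c c' k. geo \<alpha> a b \<longrightarrow> 0 \<le> k \<longrightarrow>
    (\<forall>u\<in>{a..b}. c' \<le> ht (\<alpha> u) \<and> ht (\<alpha> u) \<le> c) \<longrightarrow>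
    ht (\<alpha> a) \<le> c' + k \<longrightarrow> c - k \<le> ht (\<alpha> b) \<longrightarrow> b - a \<le> ht (\<alpha> b) - ht (\<alpha> a) + w * (1 + k)"
    using geo_almost_vertical by blast
  obtain C1 where C1: "0 \<le> C1" "\<forall>\<alpha> s v u t. geo \<alpha> s t \<longrightarrow> s \<le> v \<longrightarrow> v \<le> u \<longrightarrow> u \<le> t \<longrightarrow>
    (\<forall>r\<in>{s..t}. ht (\<alpha> u) \<le> ht (\<alpha> r) \<and> ht (\<alpha> r) \<le> ht (\<alpha> v)) \<longrightarrow>
    (\<forall>r\<in>{s..v}. ht (\<alpha> s) \<le> ht (\<alpha> r)) \<longrightarrow> (\<forall>r\<in>{u..t}. ht (\<alpha> r) \<le> ht (\<alpha> t)) \<longrightarrow>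
    ht (\<alpha> t) \<le> ht (\<alpha> s) + C1"
    using geo_zigzag by blast
  obtain C2 where C2: "0 \<le> C2" "\<forall>\<alpha> s v u t. S.geo \<alpha> s t \<longrightarrow> s \<le> v \<longrightarrow> v \<le> u \<longrightarrow> u \<le> t \<longrightarrow>
    (\<forall>r\<in>{s..t}. hY (fst (\<alpha> u)) \<le> hY (fst (\<alpha> r)) \<and> hY (fst (\<alpha> r)) \<le> hY (fst (\<alpha> v))) \<longrightarrow>
    (\<forall>r\<in>{s..v}. hY (fst (\<alpha> s)) \<le> hY (fst (\<alpha> r))) \<longrightarrow> (\<forall>r\<in>{u..t}. hY (fst (\<alpha> r)) \<le> hY (fst (\<alpha> t))) \<longrightarrow>
    hY (fst (\<alpha> t)) \<le> hY (fst (\<alpha> s)) + C2"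
    using S.geo_zigzag by blast
  define C where "C = max C2 (w * (1 + C1))"
  have C: "0 \<le> C" "C2 \<le> C" "w * (1 + C1) \<le> C" using C2 by (auto simp: C_def)
  have "w * (1 + 0) \<le> w * (1 + C1)" using w C1(1) by (intro mult_left_mono) auto
  then have wC: "w * (1 + 0) \<le> C" using C(3) by linarith
  show ?thesis
  proof (intro exI[of _ C] conjI C(1) allI impI)
    fix \<alpha> a u v b
    assume g: "geo \<alpha> a b" and o: "a \<le> u" "u \<le> v" "v \<le> b"
      and rng: "\<forall>r\<in>{a..b}. ht (\<alpha> u) \<le> ht (\<alpha> r) \<and> ht (\<alpha> r) \<le> ht (\<alpha> v)"
    have cont: "continuous_on {p..q} (\<lambda>r. ht (\<alpha> r))" if "a \<le> p" "q \<le> b" for p q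
      by (rule continuous_on_subset[OF geo_ht_continuous[OF g]]) (use that in auto)
    have amax: "\<exists>m\<in>{p..q}. \<forall>r\<in>{p..q}. ht (\<alpha> r) \<le> ht (\<alpha> m)" if "a \<le> p" "p \<le> q" "q \<le> b" for p q
      using continuous_attains_sup[OF compact_Icc _ cont[OF that(1,3)]] that by auto
    have amin: "\<exists>m\<in>{p..q}. \<forall>r\<in>{p..q}. ht (\<alpha> m) \<le> ht (\<alpha> r)" if "a \<le> p" "p \<le> q" "q \<le> b" for p q
      using continuous_attains_inf[OF compact_Icc _ cont[OF that(1,3)]] that by auto
    obtain v1 where v1: "v1 \<in> {a..u}" "\<forall>r\<in>{a..u}. ht (\<alpha> r) \<le> ht (\<alpha> v1)" using amax[of a u] o by auto
    obtain s1 where s1: "s1 \<in> {a..v1}" "\<forall>r\<in>{a..v1}. ht (\<alpha> s1) \<le> ht (\<alpha> r)" using amin[of a v1] v1 o by auto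
    obtain t1 where t1: "t1 \<in> {u..v}" "ht (\<alpha> t1) = ht (\<alpha> v1)" "\<forall>r\<in>{u..t1}. ht (\<alpha> r) \<le> ht (\<alpha> v1)"
      using first_time_at_level[OF cont[of u v], of "ht (\<alpha> v1)"] v1 rng o by auto
    have "ht (\<alpha> t1) \<le> ht (\<alpha> s1) + C1"
    proof (rule C1(2)[rule_format, of \<alpha> s1 t1 v1 u])
      show "geo \<alpha> s1 t1" using geo_sub[OF g, of s1 t1] s1 v1 t1 o by auto
      fix r assume r: "r \<in> {s1..t1}"
      show "ht (\<alpha> u) \<le> ht (\<alpha> r) \<and> ht (\<alpha> r) \<le> ht (\<alpha> v1)"
        using rng v1 t1 r s1 o by (cases "r \<le> u") auto
    qed (use s1 v1 t1 o in auto)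
    then have a1: "ht (\<alpha> v1) - C1 \<le> ht (\<alpha> a)" using t1(2) s1(2)[rule_format, of a] v1(1) s1(1) by auto
    have "- a - - u \<le> ht (\<alpha> (- (- a))) - ht (\<alpha> (- (- u))) + w * (1 + C1)"
      by (rule av[rule_format, OF geo_reverse[OF geo_sub[OF g, of a u]], of C1 "ht (\<alpha> u)" "ht (\<alpha> v1)"])
        (use rng v1 o C1(1) a1 in auto)
    then show "u - a \<le> ht (\<alpha> a) - ht (\<alpha> u) + C" using C by simp
    have "v - u \<le> ht (\<alpha> v) - ht (\<alpha> u) + w * (1 + 0)"
      by (rule av[rule_format, OF geo_sub[OF g, of u v], of 0 "ht (\<alpha> u)" "ht (\<alpha> v)"]) (use rng o in auto)
    then show "v - u \<le> ht (\<alpha> v) - ht (\<alpha> u) + C" using wC by simp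
    obtain u2 where u2: "u2 \<in> {v..b}" "\<forall>r\<in>{v..b}. ht (\<alpha> u2) \<le> ht (\<alpha> r)" using amin[of v b] o by auto
    obtain t2 where t2: "t2 \<in> {u2..b}" "\<forall>r\<in>{u2..b}. ht (\<alpha> r) \<le> ht (\<alpha> t2)" using amax[of u2 b] u2 o by auto
    obtain s2 where s2: "s2 \<in> {u..v}" "ht (\<alpha> s2) = ht (\<alpha> u2)" "\<forall>r\<in>{s2..v}. ht (\<alpha> u2) \<le> ht (\<alpha> r)"
      using last_time_at_level[OF cont[of u v], of "ht (\<alpha> u2)"] u2 rng o by auto
    have "ht (\<alpha> t2) \<le> ht (\<alpha> s2) + C1"
    proof (rule C1(2)[rule_format, of \<alpha> s2 t2 v u2])
      show "geo \<alpha> s2 t2" using geo_sub[OF g, of s2 t2] s2 u2 t2 o by auto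
      fix r assume r: "r \<in> {s2..t2}"
      show "ht (\<alpha> u2) \<le> ht (\<alpha> r) \<and> ht (\<alpha> r) \<le> ht (\<alpha> v)"
        using rng s2 u2 t2 r o by (cases "r \<le> v") auto
    qed (use s2 u2 t2 o in auto)
    then have b1: "ht (\<alpha> b) \<le> ht (\<alpha> u2) + C1" using s2(2) t2(2)[rule_format, of b] u2(1) by auto
    have "- v - - b \<le> ht (\<alpha> (- (- v))) - ht (\<alpha> (- (- b))) + w * (1 + C1)"
      by (rule av[rule_format, OF geo_reverse[OF geo_sub[OF g, of v b]], of C1 "ht (\<alpha> u2)" "ht (\<alpha> v)"])
        (use rng u2 o C1(1) b1 in auto)
    then show "b - v \<le> ht (\<alpha> v) - ht (\<alpha> b) + C" using C by simp
    have hY: "hY (snd (\<alpha> r)) = - ht (\<alpha> r)" if "r \<in> {a..b}" for r using HP_height geo_in[OF g that] by blast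
    \<comment> \<open>Seen in \<open>Y\<close>, the stretch from \<open>v1\<close> over
      \<open>u\<close> and \<open>v\<close> to \<open>u2\<close> goes up, down and up, so the zigzag
      bound of the exchanged product compares its ends.\<close>
    have "hY (fst ((prod.swap \<circ> \<alpha>) u2)) \<le> hY (fst ((prod.swap \<circ> \<alpha>) v1)) + C2"
    proof (rule C2(2)[rule_format, of "prod.swap \<circ> \<alpha>" v1 u2 u v])
      show "S.geo (prod.swap \<circ> \<alpha>) v1 u2" using geo_swap[OF geo_sub[OF g, of v1 u2]] v1 u2 o by auto
    qed (use v1 u2 o rng hY in auto)
    then have "ht (\<alpha> v1) \<le> ht (\<alpha> u2) + C2" using hY[of u2] hY[of v1] v1 u2 o by auto
    moreover have "ht (\<alpha> a) \<le> ht (\<alpha> v1)" "ht (\<alpha> u2) \<le> ht (\<alpha> b)" using v1 u2 o by auto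
    ultimately show "ht (\<alpha> a) \<le> ht (\<alpha> b) + C" using C by simp
  qed
qed

text \<open>The line of the lowest point in \<open>X\<close> serves the first two pieces and the
  line of the highest point in \<open>Y\<close> the last two. The remaining coordinates follow the
  lines of the end points, so the middle piece lies near the mixed geodesic.\<close>

lemma geo_near_lines:
  "\<exists>M\<ge>0. \<forall>\<alpha> a u v b. geo \<alpha> a b \<longrightarrow> a \<le> u \<longrightarrow> u \<le> v \<longrightarrow> v \<le> b \<longrightarrow>
    (\<forall>r\<in>{a..b}. ht (\<alpha> u) \<le> ht (\<alpha> r) \<and> ht (\<alpha> r) \<le> ht (\<alpha> v)) \<longrightarrow>
    ht (\<alpha> a) \<le> ht (\<alpha> b) + M \<and>
    (\<exists>x1 y1 x2 y2. close (\<alpha> a) (pt x1 y1 (ht (\<alpha> a))) M \<and> close (\<alpha> b) (pt x2 y2 (ht (\<alpha> b))) M \<and>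
      (\<forall>r\<in>{a..b}. close (\<alpha> r) (pt x1 y1 (ht (\<alpha> r))) M \<or> close (\<alpha> r) (pt x1 y2 (ht (\<alpha> r))) M \<or>
        close (\<alpha> r) (pt x2 y2 (ht (\<alpha> r))) M))"
proof -
  obtain C where C: "0 \<le> C" and shape: "\<forall>\<alpha> a u v b. geo \<alpha> a b \<longrightarrow> a \<le> u \<longrightarrow> u \<le> v \<longrightarrow> v \<le> b \<longrightarrow>
    (\<forall>r\<in>{a..b}. ht (\<alpha> u) \<le> ht (\<alpha> r) \<and> ht (\<alpha> r) \<le> ht (\<alpha> v)) \<longrightarrow>
    ht (\<alpha> a) \<le> ht (\<alpha> b) + C \<and> u - a \<le> ht (\<alpha> a) - ht (\<alpha> u) + C \<and>
    v - u \<le> ht (\<alpha> v) - ht (\<alpha> u) + C \<and> b - v \<le> ht (\<alpha> v) - ht (\<alpha> b) + C"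
    using geo_shape by blast
  \<comment> \<open>If the height change from \<open>p\<close> to \<open>r\<close> has the wrong
    sign, it is at most \<open>C\<close> and the time at most \<open>2 * C\<close>, so moving costs
    \<open>4 * C\<close> and the vertical correction another \<open>C\<close>.\<close>
  define M where "M = 5 * C + CX + CY"
  have M: "0 \<le> M" "C \<le> M" using C X.C_nonneg Y.C_nonneg by (auto simp: M_def)
  show ?thesis
  proof (intro exI[of _ M] conjI M(1) allI impI)
    fix \<alpha> a u v b
    assume g: "geo \<alpha> a b" and o: "a \<le> u" "u \<le> v" "v \<le> b"
      and rng: "\<forall>r\<in>{a..b}. ht (\<alpha> u) \<le> ht (\<alpha> r) \<and> ht (\<alpha> r) \<le> ht (\<alpha> v)"
    note sh = shape[rule_format, OF g o rng[rule_format]]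
    show "ht (\<alpha> a) \<le> ht (\<alpha> b) + M" using sh M by simp
    have g1: "geo \<alpha> a u" and g2: "geo \<alpha> u v" and g3: "geo \<alpha> v b" using geo_sub[OF g] o by auto
    have low: "ht (\<alpha> u) \<le> ht (\<alpha> r)" and high: "ht (\<alpha> r) \<le> ht (\<alpha> v)" if "r \<in> {a..b}" for r using rng that by auto
    have X: "dist (fst (\<alpha> r)) (WX (fst (\<alpha> p)) (ht (\<alpha> r))) \<le> M"
      if pr: "p \<in> {a..b}" "r \<in> {a..b}" and w: "\<bar>p - r\<bar> \<le> \<bar>ht (\<alpha> r) - ht (\<alpha> p)\<bar> + C" and k: "ht (\<alpha> p) - C \<le> ht (\<alpha> r)" for p r
    proof (cases "ht (\<alpha> p) \<le> ht (\<alpha> r)")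
      case True
      then show ?thesis using geo_close_X[OF g pr, of C] w C Y.C_nonneg by (simp add: M_def dist_commute)
    next
      case False
      have "dist (fst (\<alpha> r)) (WX (fst (\<alpha> p)) (ht (\<alpha> r))) \<le> dist (fst (\<alpha> p)) (fst (\<alpha> r)) + \<bar>ht (\<alpha> p) - ht (\<alpha> r)\<bar>"
        using dist_triangle3[of "fst (\<alpha> r)" "WX (fst (\<alpha> p)) (ht (\<alpha> r))" "fst (\<alpha> p)"]
          X.dist_line[of "fst (\<alpha> p)" "ht (\<alpha> p)" "ht (\<alpha> r)"] by simp
      also have "\<dots> \<le> 5 * C" using geo_dist[OF g pr] zero_le_dist[of "snd (\<alpha> p)" "snd (\<alpha> r)"] w k False by (smt (verit))
      finally show ?thesis using X.C_nonneg Y.C_nonneg by (simp add: M_def)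
    qed
    have Y: "dist (snd (\<alpha> r)) (WY (snd (\<alpha> p)) (- ht (\<alpha> r))) \<le> M"
      if pr: "p \<in> {a..b}" "r \<in> {a..b}" and w: "\<bar>p - r\<bar> \<le> \<bar>ht (\<alpha> r) - ht (\<alpha> p)\<bar> + C" and k: "ht (\<alpha> r) \<le> ht (\<alpha> p) + C" for p r
    proof (cases "ht (\<alpha> r) \<le> ht (\<alpha> p)")
      case True
      then show ?thesis using geo_close_Y[OF g pr, of C] w C X.C_nonneg by (simp add: M_def dist_commute)
    next
      case False
      have "WY (snd (\<alpha> p)) (- ht (\<alpha> p)) = snd (\<alpha> p)" using pt_self[OF geo_in[OF g pr(1)]] by (simp add: pt_def prod_eq_iff)
      then have "dist (snd (\<alpha> r)) (WY (snd (\<alpha> p)) (- ht (\<alpha> r))) \<le> dist (snd (\<alpha> p)) (snd (\<alpha> r)) + \<bar>ht (\<alpha> p) - ht (\<alpha> r)\<bar>"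
        using dist_triangle3[of "snd (\<alpha> r)" "WY (snd (\<alpha> p)) (- ht (\<alpha> r))" "snd (\<alpha> p)"]
          Y.dist_line[of "snd (\<alpha> p)" "- ht (\<alpha> p)" "- ht (\<alpha> r)"] by (simp add: abs_minus_commute)
      also have "\<dots> \<le> 5 * C" using geo_dist[OF g pr] zero_le_dist[of "fst (\<alpha> p)" "fst (\<alpha> r)"] w k False by (smt (verit))
      finally show ?thesis using X.C_nonneg Y.C_nonneg by (simp add: M_def)
    qed
    have c1: "close (\<alpha> r) (pt (fst (\<alpha> u)) (snd (\<alpha> a)) (ht (\<alpha> r))) M" if r: "r \<in> {a..u}" for r
    proof -
      note cut = geo_cut[OF g1 _ r, of C]
      have "ht (\<alpha> r) \<le> ht (\<alpha> a) + C"
        using geo_heights(3)[OF g1, of a r] geo_heights(3)[OF g1, of r u] sh r by auto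
      then show ?thesis
        unfolding close_def using cut sh low[of a] low[of r] r o C by (auto intro!: X Y simp: abs_minus_commute)
    qed
    have c2: "close (\<alpha> r) (pt (fst (\<alpha> u)) (snd (\<alpha> v)) (ht (\<alpha> r))) M" if r: "r \<in> {u..v}" for r
    proof -
      note cut = geo_cut[OF g2 _ r, of C]
      show ?thesis
        unfolding close_def using cut sh low[of r] low[of v] high[of r] r o C by (auto intro!: X Y simp: abs_minus_commute)
    qed
    have c3: "close (\<alpha> r) (pt (fst (\<alpha> b)) (snd (\<alpha> v)) (ht (\<alpha> r))) M" if r: "r \<in> {v..b}" for r
    proof -
      note cut = geo_cut[OF g3 _ r, of C]
      have "ht (\<alpha> b) - C \<le> ht (\<alpha> r)"
        using geo_heights(3)[OF g3, of v r] geo_heights(3)[OF g3, of r b] sh r by auto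
      then show ?thesis
        unfolding close_def using cut sh high[of r] high[of b] r o C by (auto intro!: X Y simp: abs_minus_commute)
    qed
    show "\<exists>x1 y1 x2 y2. close (\<alpha> a) (pt x1 y1 (ht (\<alpha> a))) M \<and> close (\<alpha> b) (pt x2 y2 (ht (\<alpha> b))) M \<and>
      (\<forall>r\<in>{a..b}. close (\<alpha> r) (pt x1 y1 (ht (\<alpha> r))) M \<or> close (\<alpha> r) (pt x1 y2 (ht (\<alpha> r))) M \<or>
        close (\<alpha> r) (pt x2 y2 (ht (\<alpha> r))) M)"
    proof (intro exI conjI ballI)
      show "close (\<alpha> a) (pt (fst (\<alpha> u)) (snd (\<alpha> a)) (ht (\<alpha> a))) M" using c1 o by simp
      show "close (\<alpha> b) (pt (fst (\<alpha> b)) (snd (\<alpha> v)) (ht (\<alpha> b))) M" using c3 o by simp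
      fix r assume "r \<in> {a..b}"
      then consider "r \<in> {a..u}" | "r \<in> {u..v}" | "r \<in> {v..b}" by fastforce
      then show "close (\<alpha> r) (pt (fst (\<alpha> u)) (snd (\<alpha> a)) (ht (\<alpha> r))) M \<or>
        close (\<alpha> r) (pt (fst (\<alpha> u)) (snd (\<alpha> v)) (ht (\<alpha> r))) M \<or>
        close (\<alpha> r) (pt (fst (\<alpha> b)) (snd (\<alpha> v)) (ht (\<alpha> r))) M"
        using c1 c2 c3 by cases blast+
    qed
  qed
qed

end

section \<open>Neighbourhoods of vertical geodesics\<close>

context horo_pair
begin

text \<open>The upper and lower bounds coincide because both coordinates move by the same amount and
  \<open>N (1, 1) = 1\<close>.\<close>

lemma vertical_geodesic_pt: "vertical_geodesic hX hY (horo_dist N hX hY) (pt x y)"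
proof -
  have "horo_dist N hX hY (pt x y s) (pt x y t) = ereal \<bar>s - t\<bar>" for s t
  proof (rule antisym)
    have "s + sgn (t - s) * \<bar>t - s\<bar> = t" by (auto simp: sgn_if)
    then show "horo_dist N hX hY (pt x y s) (pt x y t) \<le> ereal \<bar>s - t\<bar>"
      using route_horo_dist[OF pt_route[of x y s t]] by (simp add: abs_minus_commute)
    show "ereal \<bar>s - t\<bar> \<le> horo_dist N hX hY (pt x y s) (pt x y t)"
      using horo_dist_ge_gap[of N "pt x y s" "pt x y t" hX hY] by (simp add: gap_pt_same)
  qed
  then show ?thesis
    unfolding vertical_geodesic_def horo_geodesic_on_def horo_height_def by (auto simp: pt_in)
qed

lemma mixed_pt: "mixed (pt x y) (pt x' y') = pt x y'"
  by (rule ext) (simp add: mixed_def pt_def)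

lemma close_imp_nbhd:
  assumes "p \<in> HP" "close p (pt x y (ht p)) R" "4 * K * R \<le> M" "range (pt x y) \<subseteq> S"
  shows "p \<in> nbhd (horo_dist N hX hY) (ereal M) S"
proof -
  have "ht p = ht (pt x y (ht p))" by simp
  from level_route[OF assms(1) pt_in this assms(2)] obtain \<gamma> T \<phi> where
    \<gamma>: "route \<gamma> T \<phi>" "\<gamma> 0 = p" "\<gamma> T = pt x y (ht p)" "\<phi> T - \<phi> 0 \<le> 4 * K * R" by metis
  have "horo_dist N hX hY p (pt x y (ht p)) \<le> ereal (\<phi> T - \<phi> 0)"
    using route_horo_dist[OF \<gamma>(1)] by (simp add: \<gamma>)
  also have "\<dots> \<le> ereal M" using \<gamma>(4) assms(3) by simp
  finally show ?thesis unfolding nbhd_def using assms(4) by blast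
qed

lemma geodesics_near_vertical:
  "\<exists>M>0. \<forall>p\<in>HP. \<forall>q\<in>HP. \<forall>\<alpha> a b.
    a \<le> b \<and> horo_geodesic_on hX hY (horo_dist N hX hY) {a..b} \<alpha> \<and> \<alpha> a = p \<and> \<alpha> b = q \<longrightarrow>
    (\<exists>V1 V2. vertical_geodesic hX hY (horo_dist N hX hY) V1 \<and> vertical_geodesic hX hY (horo_dist N hX hY) V2 \<and>
      (horo_height hX p \<le> horo_height hX q - M \<longrightarrow>
        \<alpha> ` {a..b} \<subseteq> nbhd (horo_dist N hX hY) (ereal M) (range V1 \<union> range (mixed V1 V2) \<union> range V2)) \<and>
      (horo_height hX p \<ge> horo_height hX q + M \<longrightarrow>
        \<alpha> ` {a..b} \<subseteq> nbhd (horo_dist N hX hY) (ereal M) (range V1 \<union> range (mixed V2 V1) \<union> range V2)) \<and>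
      (\<bar>horo_height hX p - horo_height hX q\<bar> \<le> M \<longrightarrow>
        \<alpha> ` {a..b} \<subseteq> nbhd (horo_dist N hX hY) (ereal M) (range V1 \<union> range (mixed V1 V2) \<union> range V2) \<or>
        \<alpha> ` {a..b} \<subseteq> nbhd (horo_dist N hX hY) (ereal M) (range V1 \<union> range (mixed V2 V1) \<union> range V2)) \<and>
      p \<in> nbhd (horo_dist N hX hY) (ereal M) (range V1) \<and> q \<in> nbhd (horo_dist N hX hY) (ereal M) (range V2))"
proof -
  interpret S: horo_pair hY WY CY hX WX CX "N \<circ> prod.swap" by (rule horo_pair_swap)
  let ?near = "\<lambda>ht close pt M \<alpha> a b. \<exists>x1 y1 x2 y2. close (\<alpha> a) (pt x1 y1 (ht (\<alpha> a))) M \<and>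
      close (\<alpha> b) (pt x2 y2 (ht (\<alpha> b))) M \<and>
      (\<forall>r\<in>{a..b}. close (\<alpha> r) (pt x1 y1 (ht (\<alpha> r))) M \<or> close (\<alpha> r) (pt x1 y2 (ht (\<alpha> r))) M \<or>
        close (\<alpha> r) (pt x2 y2 (ht (\<alpha> r))) M)"
  obtain M1 where M1: "0 \<le> M1" "\<forall>\<alpha> a u v b. geo \<alpha> a b \<longrightarrow> a \<le> u \<longrightarrow> u \<le> v \<longrightarrow> v \<le> b \<longrightarrow>
    (\<forall>r\<in>{a..b}. ht (\<alpha> u) \<le> ht (\<alpha> r) \<and> ht (\<alpha> r) \<le> ht (\<alpha> v)) \<longrightarrow>
    ht (\<alpha> a) \<le> ht (\<alpha> b) + M1 \<and> ?near ht close pt M1 \<alpha> a b"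
    using geo_near_lines by blast
  obtain M2 where M2: "0 \<le> M2" "\<forall>\<alpha> a u v b. S.geo \<alpha> a b \<longrightarrow> a \<le> u \<longrightarrow> u \<le> v \<longrightarrow> v \<le> b \<longrightarrow>
    (\<forall>r\<in>{a..b}. S.ht (\<alpha> u) \<le> S.ht (\<alpha> r) \<and> S.ht (\<alpha> r) \<le> S.ht (\<alpha> v)) \<longrightarrow>
    S.ht (\<alpha> a) \<le> S.ht (\<alpha> b) + M2 \<and> ?near S.ht close S.pt M2 \<alpha> a b"
    using S.geo_near_lines by blast
  define M0 where "M0 = max M1 M2"
  \<comment> \<open>The term \<open>4 * K * M0\<close> converts coordinatewise closeness into
    induced distance; \<open>M0 + 1\<close> exceeds the height bound of the shape, so that the
    premise of the opposite case fails.\<close>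
  define M where "M = 4 * K * M0 + M0 + 1"
  have M0: "0 \<le> M0" "M1 \<le> M0" "M2 \<le> M0" using M1 by (auto simp: M0_def)
  have KM0: "0 \<le> K * M0" "4 * K * M1 \<le> 4 * K * M0" "4 * K * M2 \<le> 4 * K * M0"
    using K_ge M0 by (auto intro!: mult_left_mono)
  have M: "0 < M" "M1 < M" "M2 < M" "4 * K * M1 \<le> M" "4 * K * M2 \<le> M" using KM0 M0 by (auto simp: M_def)
  show ?thesis
  proof (intro exI[of _ M] conjI M(1) ballI allI impI)
    fix p q \<alpha> a b
    assume "a \<le> b \<and> horo_geodesic_on hX hY (horo_dist N hX hY) {a..b} \<alpha> \<and> \<alpha> a = p \<and> \<alpha> b = q"
    then have ab: "a \<le> b" and g: "geo \<alpha> a b" and pq: "p = \<alpha> a" "q = \<alpha> b" by (auto simp: geo_def)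
    note inH = geo_in[OF g]
    have cont: "continuous_on {a..b} (\<lambda>r. ht (\<alpha> r))" by (rule geo_ht_continuous[OF g])
    obtain u where u: "u \<in> {a..b}" "\<forall>r\<in>{a..b}. ht (\<alpha> u) \<le> ht (\<alpha> r)"
      using continuous_attains_inf[OF compact_Icc _ cont] ab by auto
    obtain v where v: "v \<in> {a..b}" "\<forall>r\<in>{a..b}. ht (\<alpha> r) \<le> ht (\<alpha> v)"
      using continuous_attains_sup[OF compact_Icc _ cont] ab by auto
    let ?nb = "nbhd (horo_dist N hX hY) (ereal M)"
    let ?concl = "\<lambda>V1 V2. vertical_geodesic hX hY (horo_dist N hX hY) V1 \<and> vertical_geodesic hX hY (horo_dist N hX hY) V2 \<and>
      (horo_height hX p \<le> horo_height hX q - M \<longrightarrow> \<alpha> ` {a..b} \<subseteq> ?nb (range V1 \<union> range (mixed V1 V2) \<union> range V2)) \<and>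
      (horo_height hX p \<ge> horo_height hX q + M \<longrightarrow> \<alpha> ` {a..b} \<subseteq> ?nb (range V1 \<union> range (mixed V2 V1) \<union> range V2)) \<and>
      (\<bar>horo_height hX p - horo_height hX q\<bar> \<le> M \<longrightarrow>
        \<alpha> ` {a..b} \<subseteq> ?nb (range V1 \<union> range (mixed V1 V2) \<union> range V2) \<or>
        \<alpha> ` {a..b} \<subseteq> ?nb (range V1 \<union> range (mixed V2 V1) \<union> range V2)) \<and>
      p \<in> ?nb (range V1) \<and> q \<in> ?nb (range V2)"
    have "\<exists>x1 y1 x2 y2. ?concl (pt x1 y1) (pt x2 y2)"
    proof (cases "u \<le> v")
      case True
      have "ht (\<alpha> a) \<le> ht (\<alpha> b) + M1 \<and> ?near ht close pt M1 \<alpha> a b"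
        by (rule M1(2)[rule_format, OF g _ True]) (use u v in auto)
      then obtain x1 y1 x2 y2 where le: "ht (\<alpha> a) \<le> ht (\<alpha> b) + M1"
        and ca: "close (\<alpha> a) (pt x1 y1 (ht (\<alpha> a))) M1" and cb: "close (\<alpha> b) (pt x2 y2 (ht (\<alpha> b))) M1"
        and c: "\<And>r. r \<in> {a..b} \<Longrightarrow> close (\<alpha> r) (pt x1 y1 (ht (\<alpha> r))) M1 \<or>
          close (\<alpha> r) (pt x1 y2 (ht (\<alpha> r))) M1 \<or> close (\<alpha> r) (pt x2 y2 (ht (\<alpha> r))) M1"
        by blast
      have "\<alpha> ` {a..b} \<subseteq> ?nb (range (pt x1 y1) \<union> range (mixed (pt x1 y1) (pt x2 y2)) \<union> range (pt x2 y2))"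
      proof (rule image_subsetI)
        fix r assume r: "r \<in> {a..b}"
        show "\<alpha> r \<in> ?nb (range (pt x1 y1) \<union> range (mixed (pt x1 y1) (pt x2 y2)) \<union> range (pt x2 y2))"
          using c[OF r] by (elim disjE) (auto simp: mixed_pt intro!: close_imp_nbhd[OF inH[OF r] _ M(4)])
      qed
      moreover have "p \<in> ?nb (range (pt x1 y1))" "q \<in> ?nb (range (pt x2 y2))"
        unfolding pq using close_imp_nbhd[OF inH ca M(4)] close_imp_nbhd[OF inH cb M(4)] ab by auto
      moreover have "\<not> horo_height hX q + M \<le> horo_height hX p" using le M by (simp add: pq horo_height_def)
      ultimately show ?thesis using vertical_geodesic_pt by blast
    next
      case False
      \<comment> \<open>Exchanging the factors negates heights, so \<open>v\<close> becomes the
        lowest point and precedes \<open>u\<close>. The coordinates of the mixed geodesic are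
        exchanged as well, which yields \<open>mixed V2 V1\<close>.\<close>
      define \<beta> where "\<beta> = prod.swap \<circ> \<alpha>"
      have Sg: "S.geo \<beta> a b" unfolding \<beta>_def by (rule geo_swap[OF g])
      have hY: "S.ht (\<beta> r) = - ht (\<alpha> r)" if "r \<in> {a..b}" for r using HP_height[OF inH[OF that]] by (simp add: \<beta>_def)
      have tr: "close (\<alpha> r) (pt x y (ht (\<alpha> r))) M2" if "close (\<beta> r) (S.pt y x (S.ht (\<beta> r))) M2" "r \<in> {a..b}" for r x y
        using that by (simp add: hY close_def) (simp add: \<beta>_def)
      have "S.ht (\<beta> a) \<le> S.ht (\<beta> b) + M2 \<and> ?near S.ht close S.pt M2 \<beta> a b"
        by (rule M2(2)[rule_format, OF Sg, of v u]) (use u v False hY in auto)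
      then obtain y1 x1 y2 x2 where le: "S.ht (\<beta> a) \<le> S.ht (\<beta> b) + M2"
        and ca: "close (\<beta> a) (S.pt y1 x1 (S.ht (\<beta> a))) M2" and cb: "close (\<beta> b) (S.pt y2 x2 (S.ht (\<beta> b))) M2"
        and c: "\<And>r. r \<in> {a..b} \<Longrightarrow> close (\<beta> r) (S.pt y1 x1 (S.ht (\<beta> r))) M2 \<or>
          close (\<beta> r) (S.pt y1 x2 (S.ht (\<beta> r))) M2 \<or> close (\<beta> r) (S.pt y2 x2 (S.ht (\<beta> r))) M2"
        by blast
      have c': "close (\<alpha> r) (pt x1 y1 (ht (\<alpha> r))) M2 \<or> close (\<alpha> r) (pt x2 y1 (ht (\<alpha> r))) M2 \<or>
          close (\<alpha> r) (pt x2 y2 (ht (\<alpha> r))) M2" if "r \<in> {a..b}" for r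
        using c[OF that] tr[OF _ that] by blast
      have "\<alpha> ` {a..b} \<subseteq> ?nb (range (pt x1 y1) \<union> range (mixed (pt x2 y2) (pt x1 y1)) \<union> range (pt x2 y2))"
      proof (rule image_subsetI)
        fix r assume r: "r \<in> {a..b}"
        show "\<alpha> r \<in> ?nb (range (pt x1 y1) \<union> range (mixed (pt x2 y2) (pt x1 y1)) \<union> range (pt x2 y2))"
          using c'[OF r] by (elim disjE) (auto simp: mixed_pt intro!: close_imp_nbhd[OF inH[OF r] _ M(5)])
      qed
      moreover have "p \<in> ?nb (range (pt x1 y1))" "q \<in> ?nb (range (pt x2 y2))"
        unfolding pq using close_imp_nbhd[OF inH tr[OF ca] M(5)] close_imp_nbhd[OF inH tr[OF cb] M(5)] ab by auto
      moreover have "\<not> horo_height hX p \<le> horo_height hX q - M"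
        using le M hY[of a] hY[of b] ab by (simp add: pq horo_height_def)
      ultimately show ?thesis using vertical_geodesic_pt by blast
    qed
    then show "\<exists>V1 V2. ?concl V1 V2" by blast
  qed
qed

end

theorem theorem1p2:
  fixes \<delta> :: real
    and wX :: "'a::heine_borel" and aX :: "(real \<Rightarrow> 'a) set" and hX :: "'a \<Rightarrow> real"
    and wY :: "'b::heine_borel" and aY :: "(real \<Rightarrow> 'b) set" and hY :: "'b \<Rightarrow> real"
    and d :: "'a \<times> 'b \<Rightarrow> 'a \<times> 'b \<Rightarrow> ereal"
  assumes "geodesically_complete TYPE('a)" "hyperbolic_space \<delta> TYPE('a)" "busemann_space TYPE('a)"
    and "geodesically_complete TYPE('b)" "hyperbolic_space \<delta> TYPE('b)" "busemann_space TYPE('b)"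
    and "aX \<in> geodesic_boundary" "aY \<in> geodesic_boundary"
    and "hX = height aX wX" "hY = height aY wY"
    and "admissible_dist hX hY d"
  shows "\<exists>M>0. \<forall>p\<in>horo_product hX hY. \<forall>q\<in>horo_product hX hY. \<forall>\<alpha> a b.
    a \<le> b \<and> horo_geodesic_on hX hY d {a..b} \<alpha> \<and> \<alpha> a = p \<and> \<alpha> b = q \<longrightarrow>
    (\<exists>V1 V2. vertical_geodesic hX hY d V1 \<and> vertical_geodesic hX hY d V2 \<and>
      (horo_height hX p \<le> horo_height hX q - M \<longrightarrow>
        \<alpha> ` {a..b} \<subseteq> nbhd d (ereal M) (range V1 \<union> range (mixed V1 V2) \<union> range V2)) \<and>
      (horo_height hX p \<ge> horo_height hX q + M \<longrightarrow>
        \<alpha> ` {a..b} \<subseteq> nbhd d (ereal M) (range V1 \<union> range (mixed V2 V1) \<union> range V2)) \<and>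
      (\<bar>horo_height hX p - horo_height hX q\<bar> \<le> M \<longrightarrow>
        \<alpha> ` {a..b} \<subseteq> nbhd d (ereal M) (range V1 \<union> range (mixed V1 V2) \<union> range V2) \<or>
        \<alpha> ` {a..b} \<subseteq> nbhd d (ereal M) (range V1 \<union> range (mixed V2 V1) \<union> range V2)) \<and>
      p \<in> nbhd d (ereal M) (range V1) \<and> q \<in> nbhd d (ereal M) (range V2))"
proof -
  obtain WX CX where "height_space hX WX CX"
    using height_space_of_boundary_point[OF assms(1-3,7)] assms(9) by blast
  moreover obtain WY CY where "height_space hY WY CY"
    using height_space_of_boundary_point[OF assms(4-6,8)] assms(10) by blast
  moreover obtain N where N: "admissible_norm N" "d = horo_dist N hX hY"
    using assms(11) unfolding admissible_dist_def by blast
  ultimately interpret horo_pair hX WX CX hY WY CY N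
    by (simp add: horo_pair_def admissible_def)
  show ?thesis unfolding N(2) by (rule geodesics_near_vertical)
qed

end
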